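(* Assume the Riemann Hypothesis. Then \[ P(s)=\lim_{x\to \infty}\Bigg\{\sum_{p\leq x}\frac{1}{p^s}+\operatorname{E_1}[(s-1)\log(x)]\Bigg\}, \] and the right-hand side is analytic for $\Re(s)>\tfrac{1}{2}$ with a branch cut on $(\tfrac{1}{2},1]$.
   Context: $p$ ranges over the primes $2,3,5,7,\ldots$. The prime zeta function is $P(s)=\sum_{p}p^{-s}$ for $\Re(s)>1$, extended to $\Re(s)>0$ by the M\"obius inversion formula $P(s)=\sum_{n=1}^{\infty}\frac{\mu(n)}{n}\log\zeta(ns)$, where $\mu$ is the M\"obius function and $\zeta$ the Riemann zeta function. The exponential integral is $\operatorname{E_1}(z)=\int_{z}^{\infty}\frac{e^{-t}}{t}\,dt$ for complex $z$ with $|\arg(z)|<\pi$, with branch cut on $(-\infty,0]$; equivalently $\operatorname{E_1}(z)=-\gamma-\log(z)-\sum_{k=1}^{\infty}\frac{(-z)^k}{k\cdot k!}$, where $\gamma$ is the Euler--Mascheroni constant. (RH) denotes the Riemann Hypothesis. *)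

theory Defs
  imports
    "HOL-Complex_Analysis.Complex_Analysis"
    "HOL-Computational_Algebra.Computational_Algebra"
begin

(* The value at s of the analytic continuation of the Dirichlet series to a punctured half-plane
   {Re w > c} - {1} containing s. By the identity theorem this value depends neither on c nor on f,
   and c may be any real number below Re s, so zeta is the usual function on the whole of
   UNIV - {1}. At s = 1 the value is unspecified. *)
definition zeta :: "complex \<Rightarrow> complex" where
  "zeta s = (THE z. \<exists>c f. c < Re s \<and> f holomorphic_on ({w. c < Re w} - {1}) \<and>
     (\<forall>w. 1 < Re w \<longrightarrow> f w = (\<Sum>n. 1 / of_nat (Suc n) powr w)) \<and> f s = z)"

definition riemann_hypothesis :: bool where
  "riemann_hypothesis \<longleftrightarrow> (\<forall>s. 0 < Re s \<and> Re s < 1 \<and> zeta s = 0 \<longrightarrow> Re s = 1/2)"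

(* The branch of log zeta(s) obtained by continuous variation along the horizontal ray from
   s to s + infinity, where it tends to 0. For Re s > 1 it is the logarithm of the Euler product;
   this is in general not the principal value Ln (zeta s). The value is unspecified if the ray
   meets the pole or a zero. *)
definition log_zeta :: "complex \<Rightarrow> complex" where
  "log_zeta s = (THE w. \<exists>l::real \<Rightarrow> complex. continuous_on {0..} l \<and>
     (\<forall>u\<ge>0. exp (l u) = zeta (s + of_real u)) \<and> (l \<longlongrightarrow> 0) at_top \<and> l 0 = w)"

definition moebius_mu :: "nat \<Rightarrow> int" where
  "moebius_mu n = (if squarefree n then (-1) ^ card (prime_factors n) else 0)"

definition prime_zeta :: "complex \<Rightarrow> complex" where
  "prime_zeta s =
     (if 1 < Re s then \<Sum>\<^sub>\<infinity>p\<in>{p::nat. prime p}. 1 / of_nat p powr s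
      else \<Sum>n. of_int (moebius_mu (Suc n)) / of_nat (Suc n) * log_zeta (of_nat (Suc n) * s))"

(* The integral of exp (-t) / t from z to infinity, taken along the horizontal ray t = z + u.
   For z outside the cut (-infinity, 0] this ray does not meet the cut. Values on the cut carry
   no meaning. *)
definition E1 :: "complex \<Rightarrow> complex" where
  "E1 z = integral {0..} (\<lambda>u::real. exp (- (z + of_real u)) / (z + of_real u))"

(* F crosses the horizontal line through c discontinuously: on either side of the line it
   continues analytically to a full neighbourhood of c, but the two continuations differ at c. *)
definition jumps_across :: "(complex \<Rightarrow> complex) \<Rightarrow> complex \<Rightarrow> bool" where
  "jumps_across F c \<longleftrightarrow> (\<exists>r>0. \<exists>g h. g holomorphic_on ball c r \<and> h holomorphic_on ball c r \<and>
     (\<forall>z\<in>ball c r. Im z > Im c \<longrightarrow> F z = g z) \<and>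
     (\<forall>z\<in>ball c r. Im z < Im c \<longrightarrow> F z = h z) \<and> g c \<noteq> h c)"

(* F is analytic on S minus the real segment (a, b], and the segment is a genuine branch cut with
   branch point b: F jumps across every interior point and has no limit at b. *)
definition analytic_with_branch_cut ::
    "(complex \<Rightarrow> complex) \<Rightarrow> complex set \<Rightarrow> real \<Rightarrow> real \<Rightarrow> bool" where
  "analytic_with_branch_cut F S a b \<longleftrightarrow>
     F analytic_on (S - of_real ` {a<..b}) \<and>
     (\<forall>c\<in>{a<..<b}. jumps_across F (of_real c)) \<and>
     \<not> (\<exists>l. (F \<longlongrightarrow> l) (at (of_real b) within (S - of_real ` {a<..b})))"

definition truncated_prime_zeta :: "real \<Rightarrow> complex \<Rightarrow> complex" where
  "truncated_prime_zeta x s =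
     (\<Sum>p | prime (p::nat) \<and> real p \<le> x. 1 / of_nat p powr s) + E1 ((s - 1) * of_real (ln x))"

end

theory Submission
  imports Defs "HOL-Real_Asymp.Real_Asymp"
begin

text \<open>Under the Riemann hypothesis, \<open>W(s) = (s - 1) \<zeta>(s)\<close> has a holomorphic logarithm \<open>L\<close> on
  \<open>Re s > 1/2\<close>, which is \<open>O(log |t|)\<close> on closed vertical strips in this half-plane by
  Borel--Caratheodory. Hence \<open>P(s) - E\<^sub>1(s - 1)\<close> extends to a holomorphic function \<open>D\<close> on
  \<open>Re s > 1/2\<close> of the same growth, and the truncated sums minus \<open>E\<^sub>1(s - 1)\<close> extend to
  entire functions \<open>D\<^sub>x\<close>. Newman's contour argument on a box of radius \<open>R = \<surd>x\<close> about \<open>1\<close> shows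
  \<open>D\<^sub>x(s) \<longlonglongrightarrow> D(s)\<close>: elementary bounds for \<open>D - D\<^sub>x\<close> (right of \<open>Re w = 1\<close>) and
  \<open>D\<^sub>x\<close> (left of it) contribute \<open>O(x\<^sup>1\<^sup>-\<^sup>\<sigma> / R)\<close>, and the growth of \<open>D\<close> on a line \<open>Re w = a\<close> with
  \<open>1/2 < a < \<sigma>\<close> contributes \<open>O(x\<^sup>a\<^sup>-\<^sup>\<sigma> log\<^sup>2 x)\<close>. The only singularity of \<open>P\<close> is the term
  \<open>- log(s - 1)\<close>, which produces the cut.\<close>

subsection \<open>The zeta function to the right of the imaginary axis\<close>

text \<open>In the usual form of Newman's argument the radius stays fixed. Here primes are bounded
  only by sums over all integers, so the elementary bounds leave x^(1-\<sigma>)/R; for \<sigma> < 1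
  the radius has to grow with x, and x^(1/2) is the smallest power that works for every \<sigma> >
  1/2. The unbounded contour is the reason why the size of the continued function at large height
  has to be known. The other obstacle is the logarithm. Since zeta has a pole at 1, its logarithm is
  not single-valued around 1; the factor s - 1 removes the pole and leaves a zero-free function on a
  convex set. The logarithm of zeta, E1(s - 1) and E1((s - 1) log x) all carry the same term -Ln(s -
  1). It cancels in both differences, and so the contour may cross the cut. The hypothesis speaks of
  the open strip 0 < Re s < 1, so the line Re s = 1 needs its own non-vanishing proof, and the
  branch of log zeta fixed along horizontal rays has to be matched with the logarithm found by
  convexity.\<close>

lemma norm_of_nat_powr:
  assumes "n > 0"
  shows "norm (of_nat n powr s :: complex) = real n powr Re s"
  using norm_powr_real_powr[of "of_nat n" s] by simp

lemma holomorphic_suminf: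
  fixes f :: "nat \<Rightarrow> complex \<Rightarrow> complex"
  assumes "open S" and "\<And>n. f n holomorphic_on S"
    and bound: "\<And>x. x \<in> S \<Longrightarrow> \<exists>d>0. cball x d \<subseteq> S \<and>
                  (\<exists>M. summable M \<and> (\<forall>n. \<forall>z\<in>cball x d. norm (f n z) \<le> M n))"
  shows "(\<lambda>z. \<Sum>n. f n z) holomorphic_on S"
proof (rule holomorphic_uniform_sequence[OF \<open>open S\<close>])
  show "(\<lambda>z. \<Sum>i<n. f i z) holomorphic_on S" for n
    using assms(2) by (intro holomorphic_intros)
  fix x assume "x \<in> S"
  then obtain d M where "d > 0" "cball x d \<subseteq> S" "summable M"
      "\<And>n z. z \<in> cball x d \<Longrightarrow> norm (f n z) \<le> M n"
    using bound by metis
  then show "\<exists>d>0. cball x d \<subseteq> S \<and>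
      uniform_limit (cball x d) (\<lambda>n z. \<Sum>i<n. f i z) (\<lambda>z. \<Sum>n. f n z) sequentially"
    by (intro exI[of _ d] conjI Weierstrass_m_test) auto
qed

lemma summable_Suc_powr:
  assumes "\<sigma> > 1"
  shows "summable (\<lambda>n. real (Suc n) powr (-\<sigma>))"
  using assms summable_Suc_iff[of "\<lambda>n. real n powr (-\<sigma>)"] summable_real_powr_iff[of "-\<sigma>"] by simp

definition zeta_term :: "nat \<Rightarrow> complex \<Rightarrow> complex" where
  "zeta_term n s = (s - 1) * of_nat n powr (-s) + of_nat (Suc n) powr (1 - s) - of_nat n powr (1 - s)"

text \<open>This is \<open>(s - 1) \<zeta>(s)\<close>: \<open>zeta_term n s\<close> is the integral of \<open>(s - 1) (n\<^sup>-\<^sup>s - x\<^sup>-\<^sup>s)\<close>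
  over \<open>n \<le> x \<le> n + 1\<close>, so that the series converges for \<open>Re s > 0\<close>.\<close>
definition reg_zeta :: "complex \<Rightarrow> complex" where
  "reg_zeta s = 1 + (\<Sum>n. zeta_term (Suc n) s)"

text \<open>The mean value inequality is applied twice. \<open>zeta_term n s\<close> is the
  increment over one unit step of g(z) = (s - 1) n^(-s) z + z^(1-s), whose derivative (s - 1)
  (n^(-s) - z^(-s)) vanishes at z = n; bounding that difference by another derivative gains a
  further power of n, which moves convergence from Re s > 1 to Re s > 0.\<close>

lemma norm_zeta_term:
  assumes "n > 0" "Re s > 0"
  shows "norm (zeta_term n s) \<le> norm (s - 1) * norm s * real n powr (- Re s - 1)"
proof -
  define I where "I = closed_segment (of_nat n :: complex) (of_nat (Suc n))"
  have I: "z \<in> \<real> \<and> real n \<le> Re z \<and> Re z \<le> real (Suc n) \<and> z \<noteq> 0 \<and> z \<notin> \<real>\<^sub>\<le>\<^sub>0 \<and> norm (of_nat n - z) \<le> 1"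
    if "z \<in> I" for z
  proof -
    have "z \<in> closed_segment (of_real (real n)) (of_real (real (Suc n)))"
      using that by (simp add: I_def)
    then obtain x where x: "z = of_real x" "x \<in> closed_segment (real n) (real (Suc n))"
      unfolding closed_segment_of_real by auto
    then have "real n \<le> x" "x \<le> real (Suc n)"
      by (auto simp: closed_segment_eq_real_ivl)
    moreover have "norm (of_nat n - of_real x :: complex) = \<bar>real n - x\<bar>"
      by (metis norm_of_real of_real_diff of_real_of_nat_eq)
    ultimately show ?thesis using \<open>n > 0\<close> x by (auto simp: complex_nonpos_Reals_iff)
  qed
  have ends: "of_nat n \<in> I" "of_nat (Suc n) \<in> I" by (auto simp: I_def)
  have norm_powr: "norm (z powr w) \<le> real n powr Re w" if "z \<in> I" "Re w \<le> 0" for z w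
    using norm_powr_real_powr[of z w] I[OF that(1)] that(2) \<open>n > 0\<close> by (auto intro!: powr_mono2')
  have inner: "norm (of_nat n powr (-s) - z powr (-s)) \<le> norm s * real n powr (- Re s - 1)"
    if z: "z \<in> I" for z
  proof -
    have "norm (of_nat n powr (-s) - z powr (-s)) \<le>
        (norm s * real n powr (- Re s - 1)) * norm (of_nat n - z)"
    proof (rule field_differentiable_bound[of I _ "\<lambda>z. -s * z powr (-s - 1)"])
      fix w assume "w \<in> I"
      then show "((\<lambda>z. z powr (-s)) has_field_derivative -s * w powr (-s - 1)) (at w within I)"
        using I by (auto intro!: derivative_eq_intros)
      show "norm (-s * w powr (-s - 1)) \<le> norm s * real n powr (- Re s - 1)"
        using norm_powr[OF \<open>w \<in> I\<close>, of "-s - 1"] assms by (auto simp: norm_mult intro!: mult_left_mono)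
    qed (use z ends in \<open>auto simp: I_def\<close>)
    also have "\<dots> \<le> (norm s * real n powr (- Re s - 1)) * 1"
      using I[OF z] by (intro mult_left_mono) auto
    finally show ?thesis by simp
  qed
  define g where "g = (\<lambda>z. (s - 1) * of_nat n powr (-s) * z + z powr (1 - s))"
  have "norm (g (of_nat (Suc n)) - g (of_nat n)) \<le>
      (norm (s - 1) * (norm s * real n powr (- Re s - 1))) * norm (of_nat (Suc n) - of_nat n :: complex)"
  proof (rule field_differentiable_bound[of I _ "\<lambda>z. (s - 1) * (of_nat n powr (-s) - z powr (-s))"])
    fix w assume w: "w \<in> I"
    have "(g has_field_derivative (s - 1) * of_nat n powr (-s) + (1 - s) * w powr (1 - s - 1)) (at w within I)"
      unfolding g_def using I[OF w] by (auto intro!: derivative_eq_intros)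
    then show "(g has_field_derivative (s - 1) * (of_nat n powr (-s) - w powr (-s))) (at w within I)"
      by (simp add: algebra_simps)
    show "norm ((s - 1) * (of_nat n powr (-s) - w powr (-s))) \<le> norm (s - 1) * (norm s * real n powr (- Re s - 1))"
      using inner[OF w] by (auto simp: norm_mult intro!: mult_left_mono)
  qed (use ends in \<open>auto simp: I_def\<close>)
  moreover have "g (of_nat (Suc n)) - g (of_nat n) = zeta_term n s"
    by (simp add: g_def zeta_term_def algebra_simps)
  ultimately show ?thesis by (simp add: mult.assoc)
qed

lemma zeta_term_1 [simp]: "n > 0 \<Longrightarrow> zeta_term n 1 = 0"
  by (simp add: zeta_term_def del: of_nat_Suc)

lemma reg_zeta_1 [simp]: "reg_zeta 1 = 1"
  by (simp add: reg_zeta_def del: of_nat_Suc)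

lemma summable_norm_zeta_term:
  assumes "Re s > 0"
  shows "summable (\<lambda>n. norm (zeta_term (Suc n) s))"
proof (rule summable_comparison_test)
  show "summable (\<lambda>n. norm (s - 1) * norm s * real (Suc n) powr (- (Re s + 1)))"
    using assms by (intro summable_mult summable_Suc_powr) auto
  show "\<exists>N. \<forall>n\<ge>N. norm (norm (zeta_term (Suc n) s)) \<le> norm (s - 1) * norm s * real (Suc n) powr (- (Re s + 1))"
    using norm_zeta_term[of "Suc _" s] assms by (simp del: of_nat_Suc)
qed

lemma holomorphic_reg_zeta: "reg_zeta holomorphic_on {s. Re s > 0}"
proof -
  have "(\<lambda>s. \<Sum>n. zeta_term (Suc n) s) holomorphic_on {s. Re s > 0}"
  proof (rule holomorphic_suminf)
    show "open {s. Re s > 0}" by (rule open_halfspace_Re_gt)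
    show "zeta_term (Suc n) holomorphic_on {s. Re s > 0}" for n
      unfolding zeta_term_def by (intro holomorphic_intros) (auto simp del: of_nat_Suc)
    fix x :: complex assume x: "x \<in> {s. Re s > 0}"
    define d where "d = Re x / 2"
    have d: "d > 0" using x by (simp add: d_def)
    have z: "Re z \<ge> d \<and> norm z \<le> norm x + d" if "z \<in> cball x d" for z
      using that abs_Re_le_cmod[of "x - z"] norm_triangle_ineq2[of z x]
      by (auto simp: d_def dist_norm norm_minus_commute)
    define C where "C = (norm x + d + 1) * (norm x + d)"
    have "norm (zeta_term (Suc n) z) \<le> C * real (Suc n) powr (- (d + 1))" if "z \<in> cball x d" for n z
    proof -
      have "norm (zeta_term (Suc n) z) \<le> norm (z - 1) * norm z * real (Suc n) powr (- Re z - 1)"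
        using z[OF that] d by (intro norm_zeta_term) auto
      also have "\<dots> \<le> C * real (Suc n) powr (- (d + 1))"
        unfolding C_def using z[OF that] d norm_triangle_ineq4[of z 1]
        by (intro mult_mono powr_mono) auto
      finally show ?thesis .
    qed
    moreover have "summable (\<lambda>n. C * real (Suc n) powr (- (d + 1)))"
      using d by (intro summable_mult summable_Suc_powr) auto
    moreover have "cball x d \<subseteq> {s. Re s > 0}" using z d by force
    ultimately show "\<exists>d>0. cball x d \<subseteq> {s. Re s > 0} \<and>
        (\<exists>M. summable M \<and> (\<forall>n. \<forall>z\<in>cball x d. norm (zeta_term (Suc n) z) \<le> M n))"
      using d by blast
  qed
  then have "(\<lambda>s. 1 + (\<Sum>n. zeta_term (Suc n) s)) holomorphic_on {s. Re s > 0}"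
    by (intro holomorphic_intros)
  then show ?thesis by (simp add: reg_zeta_def[abs_def])
qed

text \<open>Polynomial growth of \<open>reg_zeta\<close> says that the real part of its logarithm
  grows at most logarithmically, the one-sided bound from which Borel-Caratheodory starts. The
  exponent 3/2 is Re s + 1 at Re s = 1/2.\<close>

lemma norm_reg_zeta_le:
  obtains K where "K \<ge> 0" "\<And>s. Re s \<ge> 1/2 \<Longrightarrow> norm (reg_zeta s) \<le> 1 + K * (norm s + 1) ^ 2"
proof
  let ?K = "\<Sum>n. real (Suc n) powr (- (3/2))"
  have summ: "summable (\<lambda>n. real (Suc n) powr (- (3/2)))" by (rule summable_Suc_powr) simp
  show "?K \<ge> 0" by (rule suminf_nonneg[OF summ]) simp
  show "norm (reg_zeta s) \<le> 1 + ?K * (norm s + 1) ^ 2" if s: "Re s \<ge> 1/2" for s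
  proof -
    have "norm (\<Sum>n. zeta_term (Suc n) s) \<le> (\<Sum>n. norm (zeta_term (Suc n) s))"
      using s by (intro summable_norm summable_norm_zeta_term) auto
    also have "\<dots> \<le> (\<Sum>n. (norm s + 1)^2 * real (Suc n) powr (- (3/2)))"
    proof (rule suminf_le)
      fix n
      have "norm (zeta_term (Suc n) s) \<le> norm (s - 1) * norm s * real (Suc n) powr (- Re s - 1)"
        using s by (intro norm_zeta_term) auto
      also have "\<dots> \<le> ((norm s + 1) * (norm s + 1)) * real (Suc n) powr (- (3/2))"
        using s norm_triangle_ineq4[of s 1] by (intro mult_mono powr_mono) auto
      finally show "norm (zeta_term (Suc n) s) \<le> (norm s + 1)^2 * real (Suc n) powr (- (3/2))"
        by (simp add: power2_eq_square)
    qed (use s in \<open>auto intro!: summable_norm_zeta_term summable_mult summ simp del: of_nat_Suc\<close>)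
    also have "\<dots> = ?K * (norm s + 1)^2" using summ by (subst suminf_mult) auto
    finally show ?thesis
      unfolding reg_zeta_def using norm_triangle_ineq[of 1 "\<Sum>n. zeta_term (Suc n) s"] by simp
  qed
qed

lemma summable_norm_dirichlet:
  assumes "Re s > 1"
  shows "summable (\<lambda>n. norm (of_nat (Suc n) powr (-s) :: complex))"
  using summable_Suc_powr[OF assms] by (simp add: norm_of_nat_powr del: of_nat_Suc)

text \<open>For Re s > 1 the differences of n^(1-s) telescope to -1, which cancels the leading 1 in
  \<open>reg_zeta\<close>.\<close>

lemma reg_zeta_eq:
  assumes "Re s > 1"
  shows "reg_zeta s = (s - 1) * (\<Sum>n. of_nat (Suc n) powr (-s))"
proof -
  have "(\<lambda>n. of_nat n powr (1 - s) :: complex) \<longlonglongrightarrow> 0"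
  proof (rule tendsto_norm_zero_cancel)
    have "(\<lambda>n. real n powr (1 - Re s)) \<longlonglongrightarrow> 0"
      using assms by real_asymp
    then show "(\<lambda>n. norm (of_nat n powr (1 - s) :: complex)) \<longlonglongrightarrow> 0"
      by (rule Lim_transform_eventually)
         (use eventually_gt_at_top[of 0] in eventually_elim, simp add: norm_of_nat_powr)
  qed
  then have "(\<lambda>n. of_nat (Suc n) powr (1 - s) :: complex) \<longlonglongrightarrow> 0" by (rule LIMSEQ_Suc)
  from telescope_sums[OF this]
  have "(\<lambda>n. of_nat (Suc (Suc n)) powr (1 - s) - of_nat (Suc n) powr (1 - s)) sums (0 - 1 :: complex)"
    by simp
  moreover have "(\<lambda>n. (s - 1) * of_nat (Suc n) powr (-s)) sums ((s - 1) * (\<Sum>n. of_nat (Suc n) powr (-s)))"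
    by (intro sums_mult summable_sums summable_norm_cancel[OF summable_norm_dirichlet] assms)
  ultimately have "(\<lambda>n. (s - 1) * of_nat (Suc n) powr (-s) +
      (of_nat (Suc (Suc n)) powr (1 - s) - of_nat (Suc n) powr (1 - s)))
      sums ((s - 1) * (\<Sum>n. of_nat (Suc n) powr (-s)) + (0 - 1))"
    by (rule sums_add[rotated])
  then have "(\<lambda>n. zeta_term (Suc n) s) sums ((s - 1) * (\<Sum>n. of_nat (Suc n) powr (-s)) + (0 - 1))"
    by (simp only: zeta_term_def add_diff_eq)
  then show ?thesis by (simp add: reg_zeta_def sums_unique[symmetric])
qed

text \<open>The description operator in \<open>zeta\<close> needs a witness, given by c = 0, and
  uniqueness. A competing continuation lives on Re w > c with c unknown, so it is compared on Re w >
  max c 0 without the point 1, which is still connected, starting from the half-plane Re w > max c 1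
  where both are the Dirichlet series.\<close>

lemma zeta_eq:
  assumes "Re s > 0" "s \<noteq> 1"
  shows "zeta s = reg_zeta s / (s - 1)"
proof -
  let ?cont = "\<lambda>c f. c < Re s \<and> f holomorphic_on ({w. c < Re w} - {1}) \<and>
     (\<forall>w. 1 < Re w \<longrightarrow> f w = (\<Sum>n. 1 / of_nat (Suc n) powr w))"
  have series: "reg_zeta w / (w - 1) = (\<Sum>n. 1 / of_nat (Suc n) powr w)" if "Re w > 1" for w
  proof -
    have "w \<noteq> 1" using that by auto
    then show ?thesis using reg_zeta_eq[OF that] by (simp add: powr_minus inverse_eq_divide)
  qed
  have hol: "(\<lambda>w. reg_zeta w / (w - 1)) holomorphic_on ({w. 0 < Re w} - {1})"
    using holomorphic_reg_zeta by (intro holomorphic_intros) (auto elim: holomorphic_on_subset)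
  have uniq: "f s = reg_zeta s / (s - 1)" if f: "?cont c f" for c f
  proof (rule analytic_continuation_open[of "{w. max c 1 < Re w}" "{w. max c 0 < Re w} - {1}" f "\<lambda>s. reg_zeta s / (s - 1)"])
    show "connected ({w. max c 0 < Re w} - {1})"
      by (intro connected_open_delete open_halfspace_Re_gt convex_connected convex_halfspace_Re_gt) auto
    show "open {w. max c 1 < Re w}" by (rule open_halfspace_Re_gt)
    show "open ({w. max c 0 < Re w} - {1})" by (intro open_Diff open_halfspace_Re_gt closed_singleton)
    have "of_real (max c 1 + 1) \<in> {w. max c 1 < Re w}" by (auto simp: max_def)
    then show "{w. max c 1 < Re w} \<noteq> {}" by blast
    have "f holomorphic_on ({w. c < Re w} - {1})" using f by blast
    then show "f holomorphic_on ({w. max c 0 < Re w} - {1})" by (rule holomorphic_on_subset) auto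
    show "(\<lambda>s. reg_zeta s / (s - 1)) holomorphic_on ({w. max c 0 < Re w} - {1})"
      by (rule holomorphic_on_subset[OF hol]) auto
  qed (use f assms series in auto)
  show ?thesis unfolding zeta_def
  proof (rule the_equality)
    show "\<exists>c f. c < Re s \<and> f holomorphic_on ({w. c < Re w} - {1}) \<and>
     (\<forall>w. 1 < Re w \<longrightarrow> f w = (\<Sum>n. 1 / of_nat (Suc n) powr w)) \<and> f s = reg_zeta s / (s - 1)"
      by (rule exI[of _ 0], rule exI[of _ "\<lambda>w. reg_zeta w / (w - 1)"]) (use hol series assms in auto)
  qed (use uniq in blast)
qed

subsection \<open>The logarithm of the Euler product\<close>

text \<open>The radius 3/4 is a rational bound for 2^(-1/2), the largest modulus of p^(-s) for a
  prime p and Re s \<ge> 1/2; the factor 4 is 1 / (1 - 3/4).\<close>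

lemma norm_Ln_one_minus_plus_le:
  fixes z :: complex
  assumes "norm z \<le> 3/4"
  shows "norm (z + Ln (1 - z)) \<le> 4 * (norm z)\<^sup>2"
proof -
  have "norm (Ln (1 + (-z)) - (-z)) \<le> (norm (-z))\<^sup>2 / (1 - norm (-z))"
    using assms by (intro Ln_approx_linear) auto
  also have "\<dots> \<le> (norm z)\<^sup>2 / (1/4)"
    using assms by (simp only: norm_minus_cancel) (intro divide_left_mono, auto)
  finally show ?thesis by (simp add: add.commute)
qed

lemma norm_Ln_one_minus_le:
  fixes z :: complex
  assumes "norm z \<le> 3/4"
  shows "norm (Ln (1 - z)) \<le> 4 * norm z"
proof -
  have "norm (Ln (1 - z)) \<le> norm z + 4 * (norm z)\<^sup>2"
    using norm_Ln_one_minus_plus_le[OF assms] norm_triangle_ineq4[of "z + Ln (1 - z)" z] by simp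
  moreover have "4 * (norm z)\<^sup>2 \<le> 3 * norm z"
    using assms mult_right_mono[of "norm z" "3/4" "norm z"] by (simp add: power2_eq_square)
  ultimately show ?thesis by simp
qed

lemma norm_prime_powr_le:
  assumes "prime p" "Re s \<ge> 1/2"
  shows "norm (of_nat p powr (-s) :: complex) \<le> 3/4"
proof -
  have p: "p \<ge> 2" using assms(1) by (rule prime_ge_2_nat)
  have "norm (of_nat p powr (-s) :: complex) = real p powr (- Re s)"
    using p by (simp add: norm_of_nat_powr)
  also have "\<dots> \<le> real p powr (-1/2)" using p assms by (intro powr_mono) auto
  also have "\<dots> \<le> 2 powr (-1/2)" using p by (intro powr_mono2') auto
  also have "\<dots> = 1 / sqrt 2" by (simp add: powr_minus powr_half_sqrt inverse_eq_divide)
  also have "\<dots> \<le> 3/4"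
  proof -
    have "4/3 \<le> sqrt 2" by (rule real_le_rsqrt) (simp add: power2_eq_square)
    then show ?thesis by (simp add: field_simps)
  qed
  finally show ?thesis .
qed

text \<open>Serves two abscissae: b = 1 for \<open>prime_log\<close>, whose terms have size n^(-Re
  s), and b = 2 for \<open>prime_rem\<close>, whose terms are quadratically smaller.\<close>

lemma holomorphic_suminf_powr_bound:
  fixes f :: "nat \<Rightarrow> complex \<Rightarrow> complex"
  assumes "b > 0" "\<And>n. f n holomorphic_on {z. Re z > 1 / b}"
    and bound: "\<And>n z. Re z > 1 / b \<Longrightarrow> norm (f n z) \<le> C * real n powr (- (b * Re z))"
  shows "(\<lambda>z. \<Sum>n. f n z) holomorphic_on {z. Re z > 1 / b}"
proof (rule holomorphic_suminf[OF open_halfspace_Re_gt assms(2)])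
  fix x :: complex assume x: "x \<in> {z. Re z > 1 / b}"
  define d where "d = (Re x - 1 / b) / 2"
  have d: "d > 0" using x by (simp add: d_def)
  have z: "Re z \<ge> 1 / b + d" if "z \<in> cball x d" for z
    using that abs_Re_le_cmod[of "x - z"] by (auto simp: d_def dist_norm field_simps)
  \<comment> \<open>The bound at n = 1 decides the sign, because 1 powr e = 1.\<close>
  have C: "C \<ge> 0"
  proof -
    have "0 \<le> norm (f 1 x)" by simp
    also have "\<dots> \<le> C" using bound[of x 1] x by simp
    finally show ?thesis .
  qed
  have "norm (f n z) \<le> C * real n powr (- (1 + b * d))" if "z \<in> cball x d" for n z
  proof -
    have "b * (1 / b + d) \<le> b * Re z" using z[OF that] assms(1) by (intro mult_left_mono) auto
    then have *: "1 + b * d \<le> b * Re z" using assms(1) by (simp add: distrib_left)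
    have "norm (f n z) \<le> C * real n powr (- (b * Re z))"
      using z[OF that] d by (intro bound) auto
    also have "\<dots> \<le> C * real n powr (- (1 + b * d))"
      using * C by (cases "n = 0") (auto intro!: mult_left_mono powr_mono)
    finally show ?thesis .
  qed
  moreover have "summable (\<lambda>n. C * real n powr (- (1 + b * d)))"
    using assms(1) d by (intro summable_mult) (simp add: summable_real_powr_iff)
  moreover have "cball x d \<subseteq> {z. Re z > 1 / b}" using z d by force
  ultimately show "\<exists>d>0. cball x d \<subseteq> {z. Re z > 1 / b} \<and>
      (\<exists>M. summable M \<and> (\<forall>n. \<forall>z\<in>cball x d. norm (f n z) \<le> M n))"
    using d by blast
qed

definition prime_log :: "complex \<Rightarrow> complex" where
  "prime_log s = (\<Sum>n. if prime n then - Ln (1 - of_nat n powr (-s)) else 0)"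

text \<open>The linear term of the logarithm cancels, which leaves minus the sum of p^(-ks)/k over
  primes p and k \<ge> 2. This is P(s) - log zeta(s), absolutely convergent for Re s > 1/2, so that
  continuing P there amounts to continuing log zeta.\<close>

definition prime_rem :: "complex \<Rightarrow> complex" where
  "prime_rem s = (\<Sum>n. if prime n then of_nat n powr (-s) + Ln (1 - of_nat n powr (-s)) else 0)"

lemma one_minus_prime_powr_not_nonpos:
  assumes "prime p" "Re s \<ge> 1/2"
  shows "1 - of_nat p powr (-s) \<notin> \<real>\<^sub>\<le>\<^sub>0"
proof
  assume "1 - of_nat p powr (-s) \<in> (\<real>\<^sub>\<le>\<^sub>0 :: complex set)"
  then have "Re (of_nat p powr (-s)) \<ge> 1" by (simp add: complex_nonpos_Reals_iff)
  with norm_prime_powr_le[OF assms] complex_Re_le_cmod[of "of_nat p powr (-s)"] show False by simp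
qed

lemma norm_prime_log_term:
  assumes "Re s \<ge> 1/2"
  shows "norm (if prime n then - Ln (1 - of_nat n powr (-s)) else 0 :: complex) \<le> 4 * real n powr (- Re s)"
  using norm_Ln_one_minus_le[OF norm_prime_powr_le[OF _ assms, of n]]
  by (auto simp: norm_of_nat_powr prime_gt_0_nat)

lemma norm_prime_rem_term:
  assumes "Re s \<ge> 1/2"
  shows "norm (if prime n then of_nat n powr (-s) + Ln (1 - of_nat n powr (-s)) else 0 :: complex)
           \<le> 4 * real n powr (- (2 * Re s))"
proof (cases "prime n")
  case True
  have "(real n powr (- Re s))\<^sup>2 = real n powr (- (2 * Re s))"
    using True by (simp add: power2_eq_square prime_gt_0_nat flip: powr_add)
  then show ?thesis
    using norm_Ln_one_minus_plus_le[OF norm_prime_powr_le[OF True assms]] True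
    by (simp add: norm_of_nat_powr prime_gt_0_nat)
qed simp

lemma holomorphic_prime_log: "prime_log holomorphic_on {s. Re s > 1}"
proof -
  have "prime_log holomorphic_on {s. Re s > 1 / 1}"
    unfolding prime_log_def[abs_def]
  proof (rule holomorphic_suminf_powr_bound[where C = 4])
    show "(\<lambda>s. if prime n then - Ln (1 - of_nat n powr (-s)) else 0) holomorphic_on {s. Re s > 1 / 1}" for n
      using one_minus_prime_powr_not_nonpos[of n]
      by (cases "prime n") (auto intro!: holomorphic_intros simp: prime_gt_0_nat)
  qed (use norm_prime_log_term in auto)
  then show ?thesis by simp
qed

lemma holomorphic_prime_rem: "prime_rem holomorphic_on {s. Re s > 1/2}"
  unfolding prime_rem_def[abs_def]
proof (rule holomorphic_suminf_powr_bound[where C = 4])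
  show "(\<lambda>s. if prime n then of_nat n powr (-s) + Ln (1 - of_nat n powr (-s)) else 0)
      holomorphic_on {s. Re s > 1/2}" for n
    using one_minus_prime_powr_not_nonpos[of n]
    by (cases "prime n") (auto intro!: holomorphic_intros simp: prime_gt_0_nat)
qed (use norm_prime_rem_term in auto)

lemma summable_norm_prime_log:
  assumes "Re s > 1"
  shows "summable (\<lambda>n. norm (if prime n then - Ln (1 - of_nat n powr (-s)) else 0 :: complex))"
proof (rule summable_comparison_test)
  show "summable (\<lambda>n. 4 * real n powr (- Re s))"
    using assms by (intro summable_mult) (simp add: summable_real_powr_iff)
  show "\<exists>N. \<forall>n\<ge>N. norm (norm (if prime n then - Ln (1 - of_nat n powr (-s)) else 0 :: complex)) \<le> 4 * real n powr (- Re s)"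
    using norm_prime_log_term[of s] assms by auto
qed

lemma summable_norm_prime_rem:
  assumes "Re s > 1/2"
  shows "summable (\<lambda>n. norm (if prime n then of_nat n powr (-s) + Ln (1 - of_nat n powr (-s)) else 0 :: complex))"
proof (rule summable_comparison_test)
  show "summable (\<lambda>n. 4 * real n powr (- (2 * Re s)))"
    using assms by (intro summable_mult) (simp add: summable_real_powr_iff)
  show "\<exists>N. \<forall>n\<ge>N. norm (norm (if prime n then of_nat n powr (-s) + Ln (1 - of_nat n powr (-s)) else 0 :: complex)) \<le> 4 * real n powr (- (2 * Re s))"
    using norm_prime_rem_term[of s] assms by auto
qed

lemma summable_norm_prime_powr:
  assumes "Re s > 1"
  shows "summable (\<lambda>n. norm (if prime n then of_nat n powr (-s) else 0 :: complex))"
proof (rule summable_comparison_test)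
  show "summable (\<lambda>n. real n powr (- Re s))"
    using assms by (simp add: summable_real_powr_iff)
  show "\<exists>N. \<forall>n\<ge>N. norm (norm (if prime n then of_nat n powr (-s) else 0 :: complex)) \<le> real n powr (- Re s)"
    by (auto simp: norm_of_nat_powr prime_gt_0_nat)
qed

lemma prime_zeta_eq_suminf:
  assumes "Re s > 1"
  shows "prime_zeta s = (\<Sum>n. if prime n then of_nat n powr (-s) else 0)"
proof -
  have "((\<lambda>n. if prime n then of_nat n powr (-s) else 0 :: complex) has_sum
      (\<Sum>n. if prime n then of_nat n powr (-s) else 0)) UNIV"
    by (intro norm_summable_imp_has_sum summable_sums summable_norm_cancel[OF summable_norm_prime_powr]
         summable_norm_prime_powr assms)
  then have "((\<lambda>p. 1 / of_nat p powr s) has_sum (\<Sum>n. if prime n then of_nat n powr (-s) else 0)) {p. prime p}"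
    by (rule has_sum_cong_neutral[THEN iffD1, rotated -1]) (auto simp: powr_minus inverse_eq_divide)
  then show ?thesis using assms by (simp add: prime_zeta_def infsumI)
qed

lemma prime_zeta_eq_prime_log:
  assumes "Re s > 1"
  shows "prime_zeta s = prime_log s + prime_rem s"
proof -
  have "prime_log s + prime_rem s = (\<Sum>n. (if prime n then - Ln (1 - of_nat n powr (-s)) else 0) +
      (if prime n then of_nat n powr (-s) + Ln (1 - of_nat n powr (-s)) else 0))"
    unfolding prime_log_def prime_rem_def using assms
    by (intro suminf_add summable_norm_cancel[OF summable_norm_prime_log]
          summable_norm_cancel[OF summable_norm_prime_rem]) auto
  also have "\<dots> = prime_zeta s"
    unfolding prime_zeta_eq_suminf[OF assms] by (intro suminf_cong) auto
  finally show ?thesis by simp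
qed

text \<open>The sieve of Eratosthenes: multiplying by 1 - p^(-s) subtracts the terms at multiples of
  p. Unordered sums make the removal of a subset of indices a single subtraction.\<close>

lemma euler_sieve:
  assumes "finite A" "\<And>p. p \<in> A \<Longrightarrow> prime p" "Re s > 1"
  shows "((\<lambda>n. of_nat n powr (-s)) has_sum
           ((\<Sum>n. of_nat (Suc n) powr (-s)) * (\<Prod>p\<in>A. 1 - of_nat p powr (-s) :: complex)))
           {n. n > 0 \<and> (\<forall>p\<in>A. \<not> p dvd n)}"
  using assms(1,2)
proof (induction A)
  case empty
  have "((\<lambda>n. of_nat (Suc n) powr (-s)) has_sum (\<Sum>n. of_nat (Suc n) powr (-s) :: complex)) UNIV"
    by (intro norm_summable_imp_has_sum summable_sums summable_norm_cancel[OF summable_norm_dirichlet]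
         summable_norm_dirichlet assms)
  then have "((\<lambda>n. of_nat n powr (-s)) has_sum (\<Sum>n. of_nat (Suc n) powr (-s) :: complex)) (range Suc)"
    by (subst has_sum_reindex) (auto simp: o_def)
  moreover have "range Suc = {n. n > 0}" by (auto simp: gr0_conv_Suc)
  ultimately show ?case by simp
next
  case (insert p A)
  define S where "S = (\<Sum>n. of_nat (Suc n) powr (-s)) * (\<Prod>p\<in>A. 1 - of_nat p powr (-s) :: complex)"
  define X where "X = {n::nat. n > 0 \<and> (\<forall>p\<in>A. \<not> p dvd n)}"
  have p: "prime p" "p > 0" using insert.prems by (auto simp: prime_gt_0_nat)
  have IH: "((\<lambda>n. of_nat n powr (-s)) has_sum S) X"
    unfolding S_def X_def by (rule insert.IH) (use insert.prems in auto)
  from has_sum_cmult_right[OF this, of "of_nat p powr (-s)"]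
  have "((\<lambda>n. of_nat (p * n) powr (-s)) has_sum of_nat p powr (-s) * S) X"
    by (simp add: powr_times_real)
  then have mult: "((\<lambda>n. of_nat n powr (-s)) has_sum of_nat p powr (-s) * S) ((*) p ` X)"
    using p by (subst has_sum_reindex) (auto simp: o_def inj_on_def)
  have "\<not> q dvd p * n" if "q \<in> A" "\<not> q dvd n" for q n
    using that insert p prime_dvd_mult_iff[of q p n] primes_dvd_imp_eq[of q p] by auto
  then have sub: "(*) p ` X \<subseteq> X" using p by (auto simp: X_def)
  have "((\<lambda>n. of_nat n powr (-s)) has_sum S - of_nat p powr (-s) * S) (X - (*) p ` X)"
    by (rule has_sum_Diff[OF IH mult sub])
  moreover have "X - (*) p ` X = {n. n > 0 \<and> (\<forall>q\<in>insert p A. \<not> q dvd n)}"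
    by (force simp: X_def elim!: dvdE)
  moreover have "S - of_nat p powr (-s) * S = (\<Sum>n. of_nat (Suc n) powr (-s)) *
      (\<Prod>p\<in>insert p A. 1 - of_nat p powr (-s))"
    using insert.hyps by (simp add: S_def algebra_simps)
  ultimately show ?case by simp
qed

text \<open>After sieving by all primes below N, every index n with 1 < n < N has disappeared, so
  the sieved series tends to its term 1 at n = 1 by dominated convergence. The finite product
  \<open>E N\<close> is the inverse of \<open>exp (L N)\<close>, and passing to the limit gives the
  Euler product in exponential form.\<close>

lemma exp_prime_log:
  assumes "Re s > 1"
  shows "exp (prime_log s) = (\<Sum>n. of_nat (Suc n) powr (-s))"
proof -
  define Z where "Z = (\<Sum>n. of_nat (Suc n) powr (-s) :: complex)"
  define E where "E = (\<lambda>N. \<Prod>p | prime p \<and> p < N. 1 - of_nat p powr (-s) :: complex)"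
  define c where "c = (\<lambda>N n. if n > 0 \<and> (\<forall>p. prime p \<and> p < N \<longrightarrow> \<not> p dvd n) then of_nat n powr (-s) else 0 :: complex)"
  have fin: "finite {p. prime p \<and> p < (N::nat)}" for N by (rule finite_subset[of _ "{..<N}"]) auto
  have sums: "c N sums (Z * E N)" for N
  proof -
    have "((\<lambda>n. of_nat n powr (-s)) has_sum (Z * E N)) {n. n > 0 \<and> (\<forall>p\<in>{p. prime p \<and> p < N}. \<not> p dvd n)}"
      unfolding Z_def E_def by (rule euler_sieve) (use fin assms in auto)
    then have "(c N has_sum (Z * E N)) UNIV"
      by (rule has_sum_cong_neutral[THEN iffD1, rotated -1]) (auto simp: c_def)
    then show ?thesis by (rule has_sum_imp_sums)
  qed
  have "(\<lambda>N. \<Sum>n. c N n) \<longlonglongrightarrow> (\<Sum>n. if n = 1 then 1 else 0)"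
  proof (rule tannerys_theorem[THEN conjunct2, THEN conjunct2])
    fix n :: nat
    have "eventually (\<lambda>N. c N n = (if n = 1 then 1 else 0)) sequentially"
      using eventually_gt_at_top[of n]
    proof eventually_elim
      case (elim N)
      show ?case
      proof (cases "n \<le> 1")
        case True
        then have "n = 0 \<or> n = 1" by auto
        then show ?thesis by (auto simp: c_def)
      next
        case False
        then obtain p where "prime p" "p dvd n" using prime_factor_nat[of n] by auto
        moreover from this have "p < N" using elim False dvd_imp_le[of p n] by auto
        ultimately show ?thesis using False by (auto simp: c_def)
      qed
    qed
    then show "(\<lambda>N. c N n) \<longlonglongrightarrow> (if n = 1 then 1 else 0)" by (rule tendsto_eventually)
  next
    show "\<forall>\<^sub>F (n, N) in at_top \<times>\<^sub>F sequentially. norm (c N n) \<le> real n powr (- Re s)"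
      by (rule always_eventually) (auto simp: c_def norm_of_nat_powr)
    show "summable (\<lambda>n. real n powr (- Re s))" using assms by (simp add: summable_real_powr_iff)
  qed auto
  also have "(\<lambda>N. \<Sum>n. c N n) = (\<lambda>N. Z * E N)" using sums by (simp add: sums_iff)
  also have "(\<Sum>n. if n = 1 then 1 else 0 :: complex) = 1"
    using sums_single[of 1 "\<lambda>_. 1::complex"] by (simp add: sums_iff)
  finally have lim1: "(\<lambda>N. Z * E N) \<longlonglongrightarrow> 1" .
  define L where "L = (\<lambda>N. \<Sum>n<N. if prime n then - Ln (1 - of_nat n powr (-s)) else 0 :: complex)"
  have "L \<longlonglongrightarrow> prime_log s"
    unfolding L_def prime_log_def
    by (intro summable_LIMSEQ summable_norm_cancel[OF summable_norm_prime_log] assms)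
  then have lim2: "(\<lambda>N. exp (L N)) \<longlonglongrightarrow> exp (prime_log s)" by (intro tendsto_intros)
  have EL: "exp (L N) * E N = 1" for N
  proof -
    have "L N = (\<Sum>p | prime p \<and> p < N. - Ln (1 - of_nat p powr (-s)))"
      unfolding L_def by (intro sum.mono_neutral_cong_right) (auto simp: fin)
    then have "exp (L N) = (\<Prod>p | prime p \<and> p < N. exp (- Ln (1 - of_nat p powr (-s))))"
      using fin by (simp add: exp_sum)
    then have "exp (L N) * E N = (\<Prod>p | prime p \<and> p < N. exp (- Ln (1 - of_nat p powr (-s))) * (1 - of_nat p powr (-s)))"
      by (simp add: E_def prod.distrib)
    also have "\<dots> = (\<Prod>p | prime p \<and> p < N. 1)"
    proof (rule prod.cong)
      fix p assume "p \<in> {p. prime p \<and> p < N}"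
      then have "1 - of_nat p powr (-s) \<noteq> (0::complex)"
        using one_minus_prime_powr_not_nonpos[of p s] assms by auto
      then show "exp (- Ln (1 - of_nat p powr (-s))) * (1 - of_nat p powr (-s)) = (1::complex)"
        by (simp add: exp_minus)
    qed simp
    finally show ?thesis by simp
  qed
  have "(\<lambda>N. exp (L N) * (Z * E N)) \<longlonglongrightarrow> exp (prime_log s) * 1"
    by (intro tendsto_mult lim1 lim2)
  moreover have "exp (L N) * (Z * E N) = Z" for N using EL[of N] by (simp add: mult.left_commute)
  ultimately have "(\<lambda>N::nat. Z) \<longlonglongrightarrow> exp (prime_log s)" by simp
  then show ?thesis unfolding Z_def by (simp add: LIMSEQ_const_iff)
qed

subsection \<open>Zero-free region and the logarithm of zeta\<close>

text \<open>The series may start at n = 0, because division by zero makes that term 0.\<close>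

lemma minus_Ln_one_minus_sums:
  fixes z :: complex
  assumes "norm z < 1"
  shows "(\<lambda>n. z ^ n / of_nat n) sums (- Ln (1 - z))"
  using sums_minus[OF Ln_series'[of "-z"]] assms by simp

text \<open>Mertens' inequality 3 + 4 cos \<theta> + cos 2\<theta> = 2 (1 + cos \<theta>)^2 \<ge> 0,
  applied to each coefficient of the logarithmic series with v = w^n on the unit circle.\<close>

lemma Re_Ln_341:
  fixes w :: complex
  assumes "norm w = 1" "0 \<le> r" "r < 1"
  shows "0 \<le> Re (3 * (- Ln (1 - of_real r)) + 4 * (- Ln (1 - of_real r * w)) + (- Ln (1 - of_real r * w\<^sup>2)))"
proof -
  let ?t = "\<lambda>n. 3 * (of_real r ^ n / of_nat n) + 4 * ((of_real r * w) ^ n / of_nat n) + (of_real r * w\<^sup>2) ^ n / of_nat n"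
  have "?t sums (3 * (- Ln (1 - of_real r)) + 4 * (- Ln (1 - of_real r * w)) + (- Ln (1 - of_real r * w\<^sup>2)))"
    using assms by (intro sums_add sums_mult minus_Ln_one_minus_sums) (auto simp: norm_mult norm_power)
  then have sums: "(\<lambda>n. Re (?t n)) sums Re (3 * (- Ln (1 - of_real r)) + 4 * (- Ln (1 - of_real r * w)) + (- Ln (1 - of_real r * w\<^sup>2)))"
    by (rule sums_Re)
  have "Re (?t n) \<ge> 0" for n
  proof -
    define v where "v = w ^ n"
    have "norm v = 1" using assms by (simp add: v_def norm_power)
    then have "(Re v)\<^sup>2 + (Im v)\<^sup>2 = 1" by (metis cmod_power2 one_power2)
    then have "Re (3 + 4 * v + v\<^sup>2) = 2 * (1 + Re v)\<^sup>2"
      by (simp add: power2_eq_square algebra_simps)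
    moreover have "(w\<^sup>2) ^ n = v\<^sup>2" by (simp only: v_def mult.commute[of 2 n] flip: power_mult)
    then have "?t n = of_real (r ^ n / real n) * (3 + 4 * v + v\<^sup>2)"
      by (simp add: v_def power_mult_distrib add_divide_distrib algebra_simps)
    ultimately have "Re (?t n) = r ^ n / real n * (2 * (1 + Re v)\<^sup>2)" by simp
    then show ?thesis using assms by simp
  qed
  then show ?thesis using sums by (rule sums_le[OF _ sums_zero])
qed

text \<open>The preceding inequality is summed over primes with r = p^(-\<sigma>) and w = p^(-it),
  then exponentiated. The right-hand side collects the factors s - 1 by which
  \<open>reg_zeta\<close> differs from zeta at the three points.\<close>

lemma reg_zeta_341:
  assumes "\<sigma> > 1"
  shows "norm (reg_zeta (of_real \<sigma>)) ^ 3 * norm (reg_zeta (Complex \<sigma> t)) ^ 4 * norm (reg_zeta (Complex \<sigma> (2 * t)))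
    \<ge> (\<sigma> - 1) ^ 3 * norm (Complex (\<sigma> - 1) t) ^ 4 * norm (Complex (\<sigma> - 1) (2 * t))"
proof -
  let ?f = "\<lambda>s n. if prime n then - Ln (1 - of_nat n powr (-s)) else 0 :: complex"
  have sums: "?f s sums prime_log s" if "Re s > 1" for s
    unfolding prime_log_def using that
    by (intro summable_sums summable_norm_cancel[OF summable_norm_prime_log])
  define u where "u = 3 * prime_log (of_real \<sigma>) + 4 * prime_log (Complex \<sigma> t) + prime_log (Complex \<sigma> (2 * t))"
  have "(\<lambda>n. 3 * ?f (of_real \<sigma>) n + 4 * ?f (Complex \<sigma> t) n + ?f (Complex \<sigma> (2 * t)) n) sums u"
    unfolding u_def using assms by (intro sums_add sums_mult sums) auto
  then have sums_u: "(\<lambda>n. Re (3 * ?f (of_real \<sigma>) n + 4 * ?f (Complex \<sigma> t) n + ?f (Complex \<sigma> (2 * t)) n)) sums Re u"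
    by (rule sums_Re)
  have nonneg: "0 \<le> Re (3 * ?f (of_real \<sigma>) n + 4 * ?f (Complex \<sigma> t) n + ?f (Complex \<sigma> (2 * t)) n)" for n
  proof (cases "prime n")
    case True
    then have n: "n > 1" by (rule prime_gt_1_nat)
    define w where "w = (of_nat n :: complex) powr (- (\<i> * of_real t))"
    define r where "r = real n powr (- \<sigma>)"
    have w: "norm w = 1" using n by (simp add: w_def norm_of_nat_powr)
    have r0: "of_nat n powr (- of_real \<sigma>) = complex_of_real r"
      using n powr_of_real[of "real n" "- \<sigma>"] by (simp add: r_def)
    have "- Complex \<sigma> t = - of_real \<sigma> + - (\<i> * of_real t)" by (simp add: complex_eq_iff)
    then have r1: "of_nat n powr (- Complex \<sigma> t) = of_real r * w"
      by (simp only: w_def powr_add r0)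
    have "- Complex \<sigma> (2 * t) = - of_real \<sigma> + (- (\<i> * of_real t) + - (\<i> * of_real t))"
      by (simp add: complex_eq_iff)
    then have r2: "of_nat n powr (- Complex \<sigma> (2 * t)) = of_real r * w\<^sup>2"
      by (simp only: w_def powr_add r0 power2_eq_square)
    have "r < 1" using n assms by (simp add: r_def powr_less_one)
    from Re_Ln_341[OF w _ this] show ?thesis using True by (simp only: r0 r1 r2) (simp add: r_def)
  qed simp
  have "0 \<le> Re u" by (rule sums_le[OF nonneg sums_zero sums_u])
  have e3: "exp (3 * z) = exp z ^ 3" "exp (4 * z) = exp z ^ 4" for z :: complex
    using exp_of_nat_mult[of 3 z] exp_of_nat_mult[of 4 z] by simp_all
  have "1 \<le> norm (exp u)" using \<open>0 \<le> Re u\<close> by simp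
  also have "exp u = exp (prime_log (of_real \<sigma>)) ^ 3 * exp (prime_log (Complex \<sigma> t)) ^ 4 * exp (prime_log (Complex \<sigma> (2 * t)))"
    by (simp only: u_def exp_add e3)
  finally have *: "1 \<le> norm (exp (prime_log (of_real \<sigma>))) ^ 3 * norm (exp (prime_log (Complex \<sigma> t))) ^ 4 * norm (exp (prime_log (Complex \<sigma> (2 * t))))"
    by (simp add: norm_mult norm_power)
  have reg: "norm (reg_zeta s) = norm (s - 1) * norm (exp (prime_log s))" if "Re s > 1" for s
    using that by (simp add: reg_zeta_eq exp_prime_log norm_mult)
  have eqs: "of_real \<sigma> - 1 = complex_of_real (\<sigma> - 1)" "Complex \<sigma> t - 1 = Complex (\<sigma> - 1) t"
    "Complex \<sigma> (2 * t) - 1 = Complex (\<sigma> - 1) (2 * t)" by (auto simp: complex_eq_iff)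
  have n3: "norm (complex_of_real (\<sigma> - 1)) = \<sigma> - 1" using assms by (simp only: norm_of_real)
  have "norm (reg_zeta (of_real \<sigma>)) ^ 3 * norm (reg_zeta (Complex \<sigma> t)) ^ 4 * norm (reg_zeta (Complex \<sigma> (2 * t)))
    = ((\<sigma> - 1) ^ 3 * norm (Complex (\<sigma> - 1) t) ^ 4 * norm (Complex (\<sigma> - 1) (2 * t))) *
      (norm (exp (prime_log (of_real \<sigma>))) ^ 3 * norm (exp (prime_log (Complex \<sigma> t))) ^ 4 * norm (exp (prime_log (Complex \<sigma> (2 * t)))))"
    using assms by (simp only: reg complex.sel Re_complex_of_real eqs n3) (simp only: power_mult_distrib mult_ac)
  also have "\<dots> \<ge> ((\<sigma> - 1) ^ 3 * norm (Complex (\<sigma> - 1) t) ^ 4 * norm (Complex (\<sigma> - 1) (2 * t))) * 1"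
    using assms * by (intro mult_left_mono) auto
  finally show ?thesis by simp
qed

text \<open>A zero at 1 + it would make the fourth power of \<open>reg_zeta\<close> at 1 + e + it of
  order e^4, while the 3-4-1 inequality bounds the product below by a constant times e^3. The case t
  = 0 is the former pole, where \<open>reg_zeta\<close> is 1.\<close>

lemma reg_zeta_nonzero_Re_1:
  assumes "Re s = 1"
  shows "reg_zeta s \<noteq> 0"
proof
  assume zero: "reg_zeta s = 0"
  define t where "t = Im s"
  have s: "s = Complex 1 t" using assms by (simp add: t_def complex_eq_iff)
  have t: "t \<noteq> 0"
  proof
    assume "t = 0"
    then have "s = 1" using s by (simp add: complex_eq_iff)
    then show False using zero by simp
  qed
  have deriv: "(reg_zeta has_field_derivative deriv reg_zeta z) (at z)" if "Re z > 0" for z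
    using holomorphic_derivI[OF holomorphic_reg_zeta open_halfspace_Re_gt] that by blast
  then have cont: "isCont reg_zeta z" if "Re z > 0" for z
    using that DERIV_isCont by blast
  have path: "((\<lambda>e. Complex (1 + e) y) \<longlongrightarrow> Complex 1 y) (at_right 0)" for y
    by (rule tendsto_Complex) (auto intro!: tendsto_eq_intros)
  have W: "((\<lambda>e. reg_zeta (Complex (1 + e) y)) \<longlongrightarrow> reg_zeta (Complex 1 y)) (at_right 0)" for y
    by (rule isCont_tendsto_compose[OF cont path]) simp
  have W': "((\<lambda>e. reg_zeta (Complex (1 + e) t) / of_real e) \<longlongrightarrow> deriv reg_zeta s) (at_right 0)"
  proof -
    have "((\<lambda>h. (reg_zeta (s + h) - reg_zeta s) / h) \<longlongrightarrow> deriv reg_zeta s) (at 0)"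
      using deriv[of s] assms by (simp add: DERIV_def)
    moreover have "filterlim of_real (at (0::complex)) (at_right (0::real))"
      by (auto simp: filterlim_at eventually_at_filter intro!: tendsto_eq_intros)
    ultimately have "((\<lambda>e. (reg_zeta (s + of_real e) - reg_zeta s) / of_real e) \<longlongrightarrow> deriv reg_zeta s) (at_right 0)"
      by (rule filterlim_compose)
    moreover have "s + of_real e = Complex (1 + e) t" for e using s by (simp add: complex_eq_iff)
    ultimately show ?thesis using zero by simp
  qed
  \<comment> \<open>Both sides of the inequality after division by e^3. The assumed zero turns the
    fourth power into a difference quotient to the fourth times e^4, of which one factor e is left
    over and sends the right-hand side to 0.\<close>
  let ?lhs = "\<lambda>e. norm (Complex e t) ^ 4 * norm (Complex e (2 * t))"
  let ?rhs = "\<lambda>e. norm (reg_zeta (Complex (1 + e) 0)) ^ 3 * (norm (reg_zeta (Complex (1 + e) t) / of_real e) ^ 4 * e)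
                * norm (reg_zeta (Complex (1 + e) (2 * t)))"
  have "((\<lambda>e. Complex e y) \<longlongrightarrow> Complex 0 y) (at_right 0)" for y
    by (rule tendsto_Complex) (auto intro!: tendsto_eq_intros)
  then have "(?lhs \<longlongrightarrow> norm (Complex 0 t) ^ 4 * norm (Complex 0 (2 * t))) (at_right 0)"
    by (intro tendsto_intros)
  moreover have "(?rhs \<longlongrightarrow> norm (reg_zeta (Complex 1 0)) ^ 3 * (norm (deriv reg_zeta s) ^ 4 * 0)
                * norm (reg_zeta (Complex 1 (2 * t)))) (at_right 0)"
    by (intro tendsto_intros W W')
  moreover have "eventually (\<lambda>e. ?lhs e \<le> ?rhs e) (at_right 0)"
    using eventually_at_right_less[of "0::real"]
  proof eventually_elim
    case (elim e)
    have "e ^ 3 * ?lhs e \<le> norm (reg_zeta (of_real (1 + e))) ^ 3 * norm (reg_zeta (Complex (1 + e) t)) ^ 4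
                * norm (reg_zeta (Complex (1 + e) (2 * t)))"
      using reg_zeta_341[of "1 + e" t] elim by (simp add: mult.assoc)
    also have "\<dots> = e ^ 3 * ?rhs e"
    proof -
      have "A ^ 3 * B ^ 4 * C = e ^ 3 * (A ^ 3 * ((B / e) ^ 4 * e) * C)" for A B C :: real
        using elim by (simp add: field_simps power3_eq_cube power4_eq_xxxx)
      moreover have "norm (z / of_real e) = norm z / e" for z :: complex
        using elim by (simp add: norm_divide)
      ultimately show ?thesis by (simp only: complex_of_real_def)
    qed
    finally show ?case using elim by simp
  qed
  ultimately have "norm (Complex 0 t) ^ 4 * norm (Complex 0 (2 * t)) \<le> 0"
    by (intro tendsto_le[of "at_right (0::real)" ?rhs _ ?lhs]) auto
  moreover have "norm (Complex 0 t) ^ 4 * norm (Complex 0 (2 * t)) > 0"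
    using t by (intro mult_pos_pos zero_less_power) (auto simp: complex_eq_iff)
  ultimately show False by simp
qed

lemma reg_zeta_nonzero:
  assumes riemann_hypothesis "Re s > 1/2"
  shows "reg_zeta s \<noteq> 0"
proof (cases "Re s" "1::real" rule: linorder_cases)
  case less
  have "zeta s \<noteq> 0"
  proof
    assume "zeta s = 0"
    moreover have "0 < Re s" using assms(2) by linarith
    ultimately have "Re s = 1/2" using assms(1) less unfolding riemann_hypothesis_def by blast
    then show False using assms(2) by simp
  qed
  moreover have "s \<noteq> 1" using less by auto
  ultimately show ?thesis using assms by (simp add: zeta_eq)
next
  case equal
  then show ?thesis by (rule reg_zeta_nonzero_Re_1)
next
  case greater
  then have "s \<noteq> 1" by auto
  then show ?thesis using greater by (simp add: reg_zeta_eq flip: exp_prime_log del: of_nat_Suc)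
qed

text \<open>The values lie in the discrete set of multiples of 2 pi i. This compares two branches of
  a logarithm, once on a half-plane and once along a ray.\<close>

lemma two_pi_int_valued_constant:
  fixes f :: "'a::topological_space \<Rightarrow> complex"
  assumes "connected S" "continuous_on S f" "\<And>x. x \<in> S \<Longrightarrow> exp (f x) = 1"
  shows "f constant_on S"
proof (rule continuous_discrete_range_constant[OF assms(1,2)])
  fix x assume x: "x \<in> S"
  have "2 * pi \<le> norm (f y - f x)" if "y \<in> S" "f y \<noteq> f x" for y
  proof -
    have "exp (f y - f x) = 1" using assms(3) x that by (simp add: exp_diff)
    then obtain n :: int where n: "Re (f y - f x) = 0" "Im (f y - f x) = of_int (2 * n) * pi"
      unfolding exp_eq_1 by blast
    have "n \<noteq> 0" using n that by (auto simp: complex_eq_iff)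
    then have "1 \<le> \<bar>real_of_int n\<bar>" by linarith
    then have "2 * pi * 1 \<le> 2 * pi * \<bar>real_of_int n\<bar>" by (intro mult_left_mono) auto
    also have "\<dots> = \<bar>Im (f y - f x)\<bar>" by (simp only: n abs_mult) simp
    also have "\<dots> \<le> norm (f y - f x)" by (rule abs_Im_le_cmod)
    finally show ?thesis by simp
  qed
  then show "\<exists>e>0. \<forall>y. y \<in> S \<and> f y \<noteq> f x \<longrightarrow> e \<le> norm (f y - f x)"
    by (intro exI[of _ "2 * pi"]) auto
qed

lemma Ln_minus_1_domain: "Re s > 1 \<Longrightarrow> s - 1 \<notin> \<real>\<^sub>\<le>\<^sub>0"
  by (auto simp: complex_nonpos_Reals_iff)

text \<open>A zero-free holomorphic function on a convex set has a logarithm, unique up to a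
  multiple of 2 pi i. Subtracting the constant c by which it differs from the Euler product
  logarithm plus \<open>Ln (s - 1)\<close> selects the branch.\<close>

lemma reg_zeta_log_exists:
  assumes riemann_hypothesis
  obtains L where "L holomorphic_on {s. Re s > 1/2}" "\<And>s. Re s > 1/2 \<Longrightarrow> exp (L s) = reg_zeta s"
    "\<And>s. Re s > 1 \<Longrightarrow> L s = prime_log s + Ln (s - 1)"
proof -
  have "reg_zeta holomorphic_on {s. Re s > 1/2}"
    by (rule holomorphic_on_subset[OF holomorphic_reg_zeta]) auto
  moreover have "contractible {s. Re s > 1/2}"
    by (intro convex_imp_contractible convex_halfspace_Re_gt)
  ultimately obtain g where g: "g holomorphic_on {s. Re s > 1/2}" "\<And>s. Re s > 1/2 \<Longrightarrow> reg_zeta s = exp (g s)"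
    by (rule contractible_imp_holomorphic_log) (use reg_zeta_nonzero[OF assms] in blast)+
  define f where "f = (\<lambda>s. g s - (prime_log s + Ln (s - 1)))"
  have exp_f: "exp (f s) = 1" if "Re s > 1" for s
  proof -
    have "s \<noteq> 1" using that by auto
    moreover have "exp (g s) = (s - 1) * exp (prime_log s)"
      using g(2)[of s] that by (simp only: reg_zeta_eq exp_prime_log)
    ultimately show ?thesis by (simp add: f_def exp_diff exp_add)
  qed
  have "f constant_on {s. Re s > 1}"
  proof (rule two_pi_int_valued_constant)
    show "connected {s. Re s > 1}" by (intro convex_connected convex_halfspace_Re_gt)
    have "f holomorphic_on {s. Re s > 1}"
      unfolding f_def using Ln_minus_1_domain
      by (intro holomorphic_intros holomorphic_prime_log holomorphic_on_subset[OF g(1)]) auto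
    then show "continuous_on {s. Re s > 1} f" by (rule holomorphic_on_imp_continuous_on)
  qed (use exp_f in auto)
  then obtain c where c: "\<And>s. Re s > 1 \<Longrightarrow> f s = c" by (auto simp: constant_on_def)
  have "exp c = 1" using c[of 2] exp_f[of 2] by simp
  show ?thesis
  proof
    show "(\<lambda>s. g s - c) holomorphic_on {s. Re s > 1/2}" by (intro holomorphic_intros g)
    show "exp (g s - c) = reg_zeta s" if "Re s > 1/2" for s
      using g(2)[OF that] \<open>exp c = 1\<close> by (simp add: exp_diff)
    show "g s - c = prime_log s + Ln (s - 1)" if "Re s > 1" for s
      using c[OF that] by (auto simp: f_def)
  qed
qed

subsection \<open>Growth of the logarithm; the exponential integral\<close>

text \<open>Schwarz's lemma after mapping the half-plane containing f - f(c) to the unit disc. Only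
  the real part is bounded in advance; the strict inequality keeps the image in the open disc. The
  product form avoids dividing by R - norm (z - c).\<close>

lemma borel_caratheodory:
  assumes hol: "f holomorphic_on ball c R" and "R > 0"
    and bound: "\<And>w. w \<in> ball c R \<Longrightarrow> Re (f w) < M" and z: "z \<in> ball c R"
  shows "norm (f z - f c) * (R - norm (z - c)) \<le> 2 * norm (z - c) * (M - Re (f c))"
proof -
  define A where "A = M - Re (f c)"
  have A: "A > 0" using bound[of c] \<open>R > 0\<close> by (simp add: A_def)
  define g where "g = (\<lambda>w. f (c + of_real R * w) - f c)"
  have img: "c + of_real R * w \<in> ball c R" if "norm w < 1" for w
    using that \<open>R > 0\<close> by (simp add: dist_norm norm_mult)
  have g: "Re (g w) < A" if "norm w < 1" for w
    using bound[OF img[OF that]] by (simp add: g_def A_def)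
  have g_less: "norm (g w) < norm (2 * of_real A - g w)" if "norm w < 1" for w
  proof -
    have "0 < 4 * A * (A - Re (g w))" using A g[OF that] by simp
    also have "\<dots> = (norm (2 * of_real A - g w))\<^sup>2 - (norm (g w))\<^sup>2"
      unfolding cmod_power2 by (simp add: power2_eq_square algebra_simps)
    finally show ?thesis by (simp add: power2_less_imp_less)
  qed
  \<comment> \<open>The map v / (2A - v) sends the half-plane Re v < A to the unit disc and fixes
    0.\<close>
  define h where "h = (\<lambda>w. g w / (2 * of_real A - g w))"
  have "(\<lambda>w. f (c + of_real R * w)) holomorphic_on ball 0 1"
    by (rule holomorphic_on_compose_gen[OF _ hol, unfolded o_def]) (auto intro!: holomorphic_intros img)
  then have "g holomorphic_on ball 0 1" unfolding g_def by (intro holomorphic_intros)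
  moreover have "2 * of_real A - g w \<noteq> 0" if "norm w < 1" for w
    using g_less[OF that] by auto
  ultimately have "h holomorphic_on ball 0 1"
    unfolding h_def by (intro holomorphic_intros) auto
  moreover have "h 0 = 0" by (simp add: h_def g_def)
  moreover have "norm (h w) < 1" if "norm w < 1" for w
    using order.strict_trans1[OF norm_ge_zero g_less[OF that]] g_less[OF that]
    by (simp add: h_def norm_divide divide_less_eq)
  moreover define u where "u = (z - c) / of_real R"
  moreover have u: "norm u < 1"
    using z \<open>R > 0\<close> by (simp add: u_def norm_divide dist_norm norm_minus_commute)
  ultimately have "norm (h u) \<le> norm u" by (intro Schwarz_Lemma(1)) auto
  then have "norm (g u) \<le> norm u * norm (2 * of_real A - g u)"
    using order.strict_trans1[OF norm_ge_zero g_less[OF u]] by (simp add: h_def norm_divide divide_le_eq)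
  also have "\<dots> \<le> norm u * (2 * A + norm (g u))"
    using norm_triangle_ineq4[of "2 * of_real A" "g u"] A by (intro mult_left_mono) (auto simp: norm_mult)
  finally have "norm (g u) * (1 - norm u) \<le> 2 * norm u * A" by (simp add: algebra_simps)
  moreover have "norm u = norm (z - c) / R" using \<open>R > 0\<close> by (simp add: u_def norm_divide)
  moreover have "g u = f z - f c" using \<open>R > 0\<close> by (simp add: g_def u_def)
  ultimately have "norm (f z - f c) * (1 - norm (z - c) / R) \<le> 2 * (norm (z - c) / R) * A" by simp
  then have "R * (norm (f z - f c) * (1 - norm (z - c) / R)) \<le> R * (2 * (norm (z - c) / R) * A)"
    using \<open>R > 0\<close> by (intro mult_left_mono) auto
  moreover have "R * (x * (1 - y / R)) = x * (R - y)" "R * (2 * (y / R) * A) = 2 * y * A" for x y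
    using \<open>R > 0\<close> by (simp_all add: field_simps)
  ultimately show ?thesis by (simp only: A_def)
qed

text \<open>Every prime is at least 2, so n^(-Re s) \<le> 2^(2 - Re s) n^(-2); the factor 16 is 4
  from the termwise bound times 2^2. The decay identifies the branch that tends to 0 along
  horizontal rays, and it bounds the logarithm at the disc centres below.\<close>

lemma norm_prime_log_le:
  obtains C where "C \<ge> 0" "\<And>s. Re s \<ge> 2 \<Longrightarrow> norm (prime_log s) \<le> C * 2 powr (- Re s)"
proof
  have summ: "summable (\<lambda>n. 16 * real n powr (-2))"
    by (intro summable_mult) (simp add: summable_real_powr_iff)
  show "0 \<le> (\<Sum>n. 16 * real n powr (-2))" by (rule suminf_nonneg[OF summ]) simp
  show "norm (prime_log s) \<le> (\<Sum>n. 16 * real n powr (-2)) * 2 powr (- Re s)" if s: "Re s \<ge> 2" for s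
  proof -
    let ?f = "\<lambda>n. if prime n then - Ln (1 - of_nat n powr (-s)) else 0 :: complex"
    have summ_f: "summable (\<lambda>n. norm (?f n))" using s by (intro summable_norm_prime_log) auto
    have "norm (prime_log s) \<le> (\<Sum>n. norm (?f n))"
      unfolding prime_log_def by (rule summable_norm[OF summ_f])
    also have "\<dots> \<le> (\<Sum>n. 2 powr (- Re s) * (16 * real n powr (-2)))"
    proof (intro suminf_le summ_f summable_mult[OF summ])
      fix n
      show "norm (?f n) \<le> 2 powr (- Re s) * (16 * real n powr (-2))"
      proof (cases "prime n")
        case True
        then have n: "n \<ge> 2" by (rule prime_ge_2_nat)
        have "norm (?f n) \<le> 4 * real n powr (- Re s)" using s by (intro norm_prime_log_term) auto
        also have "real n powr (- Re s) = real n powr (2 - Re s) * real n powr (-2)"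
          by (simp flip: powr_add)
        also have "\<dots> \<le> 2 powr (2 - Re s) * real n powr (-2)"
          using n s by (intro mult_right_mono powr_mono2') auto
        also have "2 powr (2 - Re s) = 4 * 2 powr (- Re s)"
          by (simp add: powr_diff powr_minus divide_inverse)
        finally show ?thesis by simp
      qed simp
    qed
    also have "\<dots> = (\<Sum>n. 16 * real n powr (-2)) * 2 powr (- Re s)"
      using suminf_mult[OF summ, of "2 powr (- Re s)"] by (simp only: mult.commute)
    finally show ?thesis .
  qed
qed

text \<open>Borel-Caratheodory on the disc of radius 3/2 about 2 + it, which touches the line Re s =
  1/2. The centre lies where the Euler product controls \<open>L\<close>, and inside the disc Re
  \<open>L\<close> is the logarithm of a polynomially bounded modulus. Points with Re s \<ge> a on
  the horizontal diameter stay a - 1/2 away from the circle.\<close>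

lemma reg_zeta_log_bound:
  assumes hol: "L holomorphic_on {s. Re s > 1/2}" and exp_L: "\<And>s. Re s > 1/2 \<Longrightarrow> exp (L s) = reg_zeta s"
    and L_eq: "\<And>s. Re s > 1 \<Longrightarrow> L s = prime_log s + Ln (s - 1)" and "a > 1/2"
  obtains C where "\<And>s. a \<le> Re s \<Longrightarrow> Re s \<le> 2 \<Longrightarrow> norm (L s) \<le> C * ln (5 + \<bar>Im s\<bar>)"
proof -
  obtain K where K: "K \<ge> 0" "\<And>s. Re s \<ge> 1/2 \<Longrightarrow> norm (reg_zeta s) \<le> 1 + K * (norm s + 1) ^ 2"
    using norm_reg_zeta_le by metis
  obtain C1 where C1: "C1 \<ge> 0" "\<And>s. Re s \<ge> 2 \<Longrightarrow> norm (prime_log s) \<le> C1 * 2 powr (- Re s)"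
    using norm_prime_log_le by metis
  define B where "B = C1 + 1 + pi"
  define K' where "K' = ln (2 + K) + 2"
  have K': "K' \<ge> 0" using K by (simp add: K'_def)
  show ?thesis
  proof (rule that[of "B + 3 * (K' + B) / (a - 1/2)"])
    fix s assume s: "a \<le> Re s" "Re s \<le> 2"
    define t where "t = Im s"
    \<comment> \<open>The 5 makes l \<ge> 1, so constants can be absorbed into multiples of l, and 5
      + \<bar>t\<bar> dominates norm w + 1 on the disc: 2 + \<bar>t\<bar> for the centre, 2 for the
      radius, and 1.\<close>
    define l where "l = ln (5 + \<bar>t\<bar>)"
    have "exp 1 \<le> 5 + \<bar>t\<bar>" using exp_le by linarith
    then have l1: "l \<ge> 1" unfolding l_def by (subst ln_ge_iff) auto
    define c where "c = Complex 2 t"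
    have sc: "s - c = of_real (Re s - 2)" by (simp add: c_def t_def complex_eq_iff)
    then have norm_sc: "norm (s - c) = 2 - Re s" using s by (simp only: norm_of_real)
    have dom: "Re w > 1/2" if "w \<in> ball c (3/2)" for w
      using that abs_Re_le_cmod[of "c - w"] by (auto simp: dist_norm c_def)
    have Lc: "norm (L c) \<le> B * l"
    proof -
      have "norm (prime_log c) \<le> C1 * 2 powr (- Re c)" by (rule C1) (simp add: c_def)
      also have "\<dots> \<le> C1 * 1" using C1(1) by (intro mult_left_mono) (auto simp: c_def powr_minus)
      also have "\<dots> \<le> C1 * l" using C1(1) l1 by (intro mult_left_mono)
      finally have 1: "norm (prime_log c) \<le> C1 * l" .
      have c1: "norm (c - 1) \<ge> 1" "norm (c - 1) \<le> 5 + \<bar>t\<bar>"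
        using abs_Re_le_cmod[of "c - 1"] cmod_le[of "c - 1"] by (auto simp: c_def)
      then have "c - 1 \<noteq> 0" by auto
      have "norm (Ln (c - 1)) \<le> \<bar>Re (Ln (c - 1))\<bar> + \<bar>Im (Ln (c - 1))\<bar>" by (rule cmod_le)
      also have "\<dots> \<le> l + pi"
      proof (rule add_mono)
        show "\<bar>Re (Ln (c - 1))\<bar> \<le> l"
          using c1 \<open>c - 1 \<noteq> 0\<close> by (auto simp: l_def)
        show "\<bar>Im (Ln (c - 1))\<bar> \<le> pi"
          using mpi_less_Im_Ln[OF \<open>c - 1 \<noteq> 0\<close>] Im_Ln_le_pi[OF \<open>c - 1 \<noteq> 0\<close>] by auto
      qed
      also have "\<dots> \<le> l + pi * l" using l1 by (intro add_left_mono) auto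
      finally have "norm (Ln (c - 1)) \<le> (1 + pi) * l" by (simp add: algebra_simps)
      with 1 have "norm (prime_log c) + norm (Ln (c - 1)) \<le> B * l" by (simp add: B_def algebra_simps)
      then show ?thesis using L_eq[of c] norm_triangle_ineq[of "prime_log c" "Ln (c - 1)"] by (simp add: c_def)
    qed
    have re: "Re (L w) < K' * l" if w: "w \<in> ball c (3/2)" for w
    proof -
      have "norm w \<le> norm c + norm (w - c)" by (metis add.commute diff_add_cancel norm_triangle_ineq)
      also have "\<dots> \<le> (2 + \<bar>t\<bar>) + 2"
        using w cmod_le[of c] by (intro add_mono) (auto simp: c_def dist_norm norm_minus_commute)
      finally have nw: "norm w + 1 \<le> 5 + \<bar>t\<bar>" by simp
      have "exp (Re (L w)) = norm (reg_zeta w)" by (simp flip: exp_L[OF dom[OF w]])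
      also have "\<dots> \<le> 1 + K * (norm w + 1) ^ 2" using dom[OF w] by (intro K) auto
      also have "\<dots> \<le> 1 + K * (5 + \<bar>t\<bar>) ^ 2" using K(1) nw by (intro add_left_mono mult_left_mono power_mono) auto
      also have "\<dots> < (2 + K) * (5 + \<bar>t\<bar>) ^ 2"
      proof -
        have "1 \<le> (5 + \<bar>t\<bar>) ^ 2" by (intro one_le_power) auto
        then have "1 < 2 * (5 + \<bar>t\<bar>) ^ 2" by linarith
        then show ?thesis by (simp only: distrib_right add_less_cancel_right)
      qed
      finally have "Re (L w) < ln ((2 + K) * (5 + \<bar>t\<bar>) ^ 2)"
        by (metis exp_gt_zero exp_less_cancel_iff exp_ln order.strict_trans)
      also have "\<dots> = ln (2 + K) + 2 * l" using K(1) by (simp add: ln_mult ln_realpow l_def)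
      also have "\<dots> \<le> ln (2 + K) * l + 2 * l" using K(1) l1 by (intro add_right_mono) auto
      finally show ?thesis by (simp add: K'_def algebra_simps)
    qed
    have "norm (L s - L c) * (3/2 - norm (s - c)) \<le> 2 * norm (s - c) * (K' * l - Re (L c))"
    proof (rule borel_caratheodory)
      show "L holomorphic_on ball c (3/2)" by (rule holomorphic_on_subset[OF hol]) (use dom in auto)
      show "s \<in> ball c (3/2)" using norm_sc s \<open>a > 1/2\<close> by (simp add: dist_norm norm_minus_commute)
    qed (use re in auto)
    also have "\<dots> \<le> 3 * ((K' + B) * l)"
    proof (rule mult_mono)
      show "2 * norm (s - c) \<le> 3" using norm_sc s \<open>a > 1/2\<close> by simp
      show "K' * l - Re (L c) \<le> (K' + B) * l"
        using Lc abs_Re_le_cmod[of "L c"] by (simp add: algebra_simps)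
      have "Re (L c) < K' * l" by (rule re) simp
      then show "0 \<le> K' * l - Re (L c)" by simp
    qed simp
    finally have *: "norm (L s - L c) * (3/2 - norm (s - c)) \<le> 3 * ((K' + B) * l)" .
    have "norm (L s - L c) * (a - 1/2) \<le> norm (L s - L c) * (3/2 - norm (s - c))"
      using norm_sc s by (intro mult_left_mono) auto
    with * have "norm (L s - L c) * (a - 1/2) \<le> 3 * ((K' + B) * l)" by linarith
    then have "norm (L s - L c) \<le> 3 * (K' + B) / (a - 1/2) * l"
      using \<open>a > 1/2\<close> by (simp add: field_simps)
    then have "norm (L s) \<le> B * l + 3 * (K' + B) / (a - 1/2) * l"
      using Lc norm_triangle_ineq2[of "L s" "L c"] by linarith
    then show "norm (L s) \<le> (B + 3 * (K' + B) / (a - 1/2)) * ln (5 + \<bar>Im s\<bar>)"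
      by (simp add: l_def t_def distrib_right)
  qed
qed

section \<open>The exponential integral: bounds and logarithmic singularity\<close>

lemma E1_tail:
  assumes d: "d > 0" "\<And>u. u \<ge> 0 \<Longrightarrow> norm (z + of_real u) \<ge> d" and "N \<ge> 0"
  shows "(\<lambda>u. exp (- (z + of_real u)) / (z + of_real u)) integrable_on {N..}" (is "?f integrable_on _")
    and "norm (integral {N..} (\<lambda>u. exp (- (z + of_real u)) / (z + of_real u))) \<le> exp (- Re z) / d * exp (- N)"
proof -
  let ?g = "\<lambda>u. exp (- Re z) / d * exp (- u)"
  have g: "(?g has_integral exp (- Re z) / d * exp (- N)) {N..}"
    using has_integral_mult_right[OF has_integral_exp_minus_to_infinity[of 1 N], of "exp (- Re z) / d"] by simp
  have le: "norm (?f u) \<le> ?g u" if "u \<in> {N..}" for u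
  proof -
    have "norm (?f u) = exp (- Re z - u) / norm (z + of_real u)" by (simp add: norm_divide)
    also have "\<dots> \<le> exp (- Re z - u) / d"
      using d(2)[of u] d(1) that \<open>N \<ge> 0\<close> by (intro divide_left_mono mult_pos_pos) auto
    also have "\<dots> = ?g u" by (simp add: exp_diff exp_minus field_simps)
    finally show ?thesis .
  qed
  have "z + of_real u \<noteq> 0" if "u \<ge> 0" for u using d(2)[OF that] d(1) by auto
  then have "continuous_on {N..} ?f" using \<open>N \<ge> 0\<close> by (intro continuous_intros) auto
  then have "?f \<in> borel_measurable (lebesgue_on {N..})"
    by (rule continuous_imp_measurable_on_sets_lebesgue) auto
  then show int: "?f integrable_on {N..}"
    by (rule measurable_bounded_by_integrable_imp_integrable[OF _ has_integral_integrable[OF g] le]) auto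
  have "norm (integral {N..} ?f) \<le> integral {N..} ?g"
    by (rule integral_norm_bound_integral[OF int has_integral_integrable[OF g] le])
  then show "norm (integral {N..} ?f) \<le> exp (- Re z) / d * exp (- N)" by (simp only: integral_unique[OF g])
qed

lemma norm_E1_le:
  assumes "d > 0" "\<And>u. u \<ge> 0 \<Longrightarrow> norm (z + of_real u) \<ge> d"
  shows "norm (E1 z) \<le> exp (- Re z) / d"
  using E1_tail(2)[OF assms, of 0] by (simp add: E1_def)

lemma norm_E1_le_Im: "Im z \<noteq> 0 \<Longrightarrow> norm (E1 z) \<le> exp (- Re z) / \<bar>Im z\<bar>"
  using abs_Im_le_cmod[of "z + of_real _"] by (intro norm_E1_le) auto

lemma norm_E1_le_Re: "Re z > 0 \<Longrightarrow> norm (E1 z) \<le> exp (- Re z) / Re z"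
  by (intro norm_E1_le) (auto intro: order_trans[OF _ complex_Re_le_cmod])

text \<open>\<open>E\<close> is the classical Ein(z) - \<gamma>, with Ein the entire primitive of (1
  - exp(-z))/z vanishing at 0. On the slit plane \<open>E1\<close> and a primitive minus
  \<open>Ln\<close> have the same derivative; their constant difference is located at infinity, and
  absorbing it into \<open>E\<close> replaces an evaluation of \<gamma>.\<close>

lemma E1_eq_entire_minus_Ln:
  obtains E where "E holomorphic_on UNIV"
    "\<And>z. z \<noteq> 0 \<Longrightarrow> (E has_field_derivative (1 - exp (-z)) / z) (at z)"
    "\<And>z. z \<notin> \<real>\<^sub>\<le>\<^sub>0 \<Longrightarrow> E1 z = E z - Ln z"
proof -
  define f where "f = (\<lambda>z::complex. if z = 0 then 1 else (1 - exp (-z)) / z)"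
  have "f holomorphic_on UNIV"
  proof (rule no_isolated_singularity'[of "{0}"])
    fix z :: complex assume z: "z \<in> {0}"
    have "((\<lambda>w. 1 - exp (-w)) has_field_derivative 1) (at (0::complex))"
      by (auto intro!: derivative_eq_intros)
    then have "((\<lambda>w::complex. (1 - exp (-w)) / w) \<longlongrightarrow> 1) (at 0)" by (simp add: DERIV_def)
    then have "(f \<longlongrightarrow> 1) (at 0)"
      by (rule Lim_transform_eventually) (auto simp: f_def eventually_at_filter)
    then show "(f \<longlongrightarrow> f z) (at z)" using z by (simp add: f_def)
  next
    have "(\<lambda>z. (1 - exp (-z)) / z) holomorphic_on (UNIV - {0})" by (intro holomorphic_intros) auto
    then show "f holomorphic_on (UNIV - {0})" by (rule holomorphic_transform) (auto simp: f_def)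
  qed auto
  then obtain g where g: "\<And>z. (g has_field_derivative f z) (at z)"
    using holomorphic_convex_primitive'[of UNIV f] by auto
  define \<Phi> where "\<Phi> = (\<lambda>z. g z - Ln z)"
  have \<Phi>: "(\<Phi> has_field_derivative - exp (-z) / z) (at z)" if "z \<notin> \<real>\<^sub>\<le>\<^sub>0" for z
  proof -
    have "z \<noteq> 0" using that by auto
    have "(\<Phi> has_field_derivative f z - 1 / z) (at z)"
      unfolding \<Phi>_def using that by (auto intro!: derivative_eq_intros g simp: inverse_eq_divide)
    then show ?thesis using \<open>z \<noteq> 0\<close> by (simp add: f_def diff_divide_distrib)
  qed
  have ray: "z + of_real u \<notin> \<real>\<^sub>\<le>\<^sub>0" if "z \<notin> \<real>\<^sub>\<le>\<^sub>0" "u \<ge> 0" for z :: complex and u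
    using that by (auto simp: complex_nonpos_Reals_iff)
  \<comment> \<open>The fundamental theorem of calculus on a finite piece of the defining ray, plus
    a tail that decays like exp(-N), shows what remains of the primitive at the far end of the
    ray.\<close>
  have lim: "((\<lambda>N. \<Phi> (z + of_real N)) \<longlongrightarrow> \<Phi> z - E1 z) at_top" if z: "z \<notin> \<real>\<^sub>\<le>\<^sub>0" for z
  proof -
    obtain d where d: "d > 0" "\<And>u. u \<ge> 0 \<Longrightarrow> norm (z + of_real u) \<ge> d"
    proof (cases "Im z = 0")
      case True
      then have "Re z > 0" using z by (auto simp: complex_nonpos_Reals_iff)
      then show ?thesis using that[of "Re z"] complex_Re_le_cmod[of "z + of_real _"]
        by (metis add_increasing2 add.commute Re_complex_of_real plus_complex.sel(1) le_add_same_cancel1 order_trans)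
    next
      case False
      then show ?thesis using that[of "\<bar>Im z\<bar>"] abs_Im_le_cmod[of "z + of_real _"] by auto
    qed
    let ?f = "\<lambda>u. exp (- (z + of_real u)) / (z + of_real u)"
    have eq: "E1 z = (\<Phi> z - \<Phi> (z + of_real N)) + integral {N..} ?f" if "N \<ge> 0" for N
    proof -
      have "(?f has_integral (- \<Phi> (z + of_real N)) - (- \<Phi> (z + of_real 0))) {0..N}"
      proof (rule fundamental_theorem_of_calculus[OF that])
        fix u assume "u \<in> {0..N}"
        then have "(\<Phi> has_field_derivative - exp (- (z + of_real u)) / (z + of_real u)) (at (z + of_real u))"
          by (intro \<Phi> ray z) auto
        moreover have "((\<lambda>u. z + of_real u) has_vector_derivative 1) (at u within {0..N})"
          by (auto intro!: derivative_eq_intros simp: has_vector_derivative_def scaleR_conv_of_real)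
        ultimately have "((\<Phi> \<circ> (\<lambda>u. z + of_real u)) has_vector_derivative 1 * (- exp (- (z + of_real u)) / (z + of_real u))) (at u within {0..N})"
          by (intro field_vector_diff_chain_within[where g = \<Phi>]) (auto intro: has_field_derivative_at_within)
        then have "((\<lambda>u. - \<Phi> (z + of_real u)) has_vector_derivative - (1 * (- exp (- (z + of_real u)) / (z + of_real u)))) (at u within {0..N})"
          unfolding o_def by (rule has_vector_derivative_minus)
        then show "((\<lambda>u. - \<Phi> (z + of_real u)) has_vector_derivative ?f u) (at u within {0..N})" by simp
      qed
      moreover have "(?f has_integral integral {N..} ?f) {N..}"
        by (rule integrable_integral[OF E1_tail(1)[OF d that]])
      ultimately have "(?f has_integral (- \<Phi> (z + of_real N)) - (- \<Phi> (z + of_real 0)) + integral {N..} ?f) ({0..N} \<union> {N..})"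
        by (rule has_integral_Un) (use that in auto)
      moreover have "{0..N} \<union> {N..} = {0..}" using that by auto
      ultimately show ?thesis by (simp add: E1_def integral_unique)
    qed
    have "((\<lambda>N. exp (- Re z) / d * exp (- N)) \<longlongrightarrow> 0) at_top"
      by real_asymp
    then have "((\<lambda>N. integral {N..} ?f) \<longlongrightarrow> 0) at_top"
      by (rule Lim_null_comparison[rotated])
         (use eventually_ge_at_top[of 0] in eventually_elim, use E1_tail(2)[OF d] in auto)
    then have "((\<lambda>N. \<Phi> z - E1 z + integral {N..} ?f) \<longlongrightarrow> \<Phi> z - E1 z + 0) at_top"
      by (intro tendsto_intros)
    then have "((\<lambda>N. \<Phi> z - E1 z + integral {N..} ?f) \<longlongrightarrow> \<Phi> z - E1 z) at_top" by simp
    then show ?thesis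
      by (rule Lim_transform_eventually) (use eventually_ge_at_top[of 0] in eventually_elim, use eq in auto)
  qed
  \<comment> \<open>The limits along the rays from z and from 1 agree: far to the right, the
    derivative of \<Phi> is exponentially small on a half-plane containing both points, whose
    distance norm (z - 1) stays fixed.\<close>
  have const: "\<Phi> z - E1 z = \<Phi> 1 - E1 1" if z: "z \<notin> \<real>\<^sub>\<le>\<^sub>0" for z
  proof -
    define M where "M = 1 + norm z"
    have diff: "norm (\<Phi> (z + of_real N) - \<Phi> (1 + of_real N)) \<le> exp (M - N) * norm (z - 1)" if N: "N \<ge> M + 1" for N
    proof -
      define S where "S = {w. Re w \<ge> N - M}"
      have "norm (\<Phi> (z + of_real N) - \<Phi> (1 + of_real N)) \<le> exp (M - N) * norm ((z + of_real N) - (1 + of_real N))"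
      proof (rule field_differentiable_bound)
        show "convex S" unfolding S_def by (rule convex_halfspace_Re_ge)
        fix w assume "w \<in> S"
        then have w: "Re w \<ge> N - M" "Re w \<ge> 1" using N by (auto simp: S_def)
        show "(\<Phi> has_field_derivative - exp (-w) / w) (at w within S)"
          using w by (intro has_field_derivative_at_within[OF \<Phi>]) (auto simp: complex_nonpos_Reals_iff)
        have "norm w \<ge> 1" using w complex_Re_le_cmod[of w] by linarith
        have "norm (- exp (-w) / w) = exp (- Re w) / norm w" by (simp add: norm_divide)
        also have "\<dots> \<le> exp (- Re w) / 1" using \<open>norm w \<ge> 1\<close> by (intro divide_left_mono) auto
        also have "\<dots> \<le> exp (M - N)" using w by simp
        finally show "norm (- exp (-w) / w) \<le> exp (M - N)" .
      next
        show "z + of_real N \<in> S" using abs_Re_le_cmod[of z] by (auto simp: S_def M_def)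
        have "- norm z \<le> 2" by (rule order_trans[of _ 0]) auto
        then show "1 + of_real N \<in> S" unfolding S_def M_def by simp
      qed
      then show ?thesis by simp
    qed
    have "((\<lambda>N. exp (M - N) * norm (z - 1)) \<longlongrightarrow> 0) at_top" by real_asymp
    then have "((\<lambda>N. \<Phi> (z + of_real N) - \<Phi> (1 + of_real N)) \<longlongrightarrow> 0) at_top"
      by (rule Lim_null_comparison[rotated])
         (use eventually_ge_at_top[of "M + 1"] in eventually_elim, use diff in auto)
    moreover have "((\<lambda>N. \<Phi> (z + of_real N) - \<Phi> (1 + of_real N)) \<longlongrightarrow> (\<Phi> z - E1 z) - (\<Phi> 1 - E1 1)) at_top"
      by (intro tendsto_diff lim z) (auto simp: complex_nonpos_Reals_iff)
    ultimately have "0 = (\<Phi> z - E1 z) - (\<Phi> 1 - E1 1)"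
      by (intro tendsto_unique[of "at_top :: real filter"]) auto
    then show ?thesis by simp
  qed
  define E where "E = (\<lambda>z. g z - (\<Phi> 1 - E1 1))"
  have E: "(E has_field_derivative f z) (at z)" for z
    unfolding E_def by (auto intro!: derivative_eq_intros g)
  show ?thesis
  proof
    show "E holomorphic_on UNIV" using E by (auto simp: holomorphic_on_open)
    show "(E has_field_derivative (1 - exp (-z)) / z) (at z)" if "z \<noteq> 0" for z
      using E[of z] that by (simp add: f_def)
    show "E1 z = E z - Ln z" if "z \<notin> \<real>\<^sub>\<le>\<^sub>0" for z
      using const[OF that] by (simp add: E_def \<Phi>_def algebra_simps)
  qed
qed

subsection \<open>Truncated sums\<close>

text \<open>With v = u + 1 this replaces the comparison of one term of a sum with the integral of
  t^(e-1) over a unit interval.\<close>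

lemma powr_mean_value:
  fixes u v e :: real
  assumes "0 < u" "u < v" "e \<noteq> 0"
  obtains \<xi> where "u < \<xi>" "\<xi> < v" "v powr e / e - u powr e / e = (v - u) * \<xi> powr (e - 1)"
proof -
  have "\<exists>\<xi>>u. \<xi> < v \<and> v powr e / e - u powr e / e = (v - u) * \<xi> powr (e - 1)"
    using assms by (intro MVT2) (auto intro!: derivative_eq_intros)
  then show ?thesis using that by blast
qed

text \<open>Comparison with an integral leaves one extra term x^(-\<sigma>), which \<sigma> - 1
  \<le> x absorbs at the price of a factor 2. The bound is uniform in \<sigma>, as it must be on a
  contour where \<sigma> - 1 runs from 0 to R.\<close>

lemma sum_powr_tail_le:
  assumes "\<sigma> > 1" "x > 0" "\<sigma> - 1 \<le> x"
  shows "(\<Sum>n | n < N \<and> real n > x. real n powr (-\<sigma>)) \<le> 2 * x powr (1 - \<sigma>) / (\<sigma> - 1)"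
proof -
  define m where "m = nat \<lfloor>x\<rfloor> + 1"
  have m: "real m > x" and iff: "real n > x \<longleftrightarrow> n \<ge> m" for n
    using \<open>x > 0\<close> unfolding m_def by linarith+
  have bound: "(\<Sum>n\<in>{m..m + k}. real n powr (-\<sigma>)) \<le>
      x powr (-\<sigma>) + (x powr (1 - \<sigma>) - real (m + k) powr (1 - \<sigma>)) / (\<sigma> - 1)" for k
  proof (induction k)
    case 0
    have "real m powr (-\<sigma>) \<le> x powr (-\<sigma>)" "real m powr (1 - \<sigma>) \<le> x powr (1 - \<sigma>)"
      using assms m by (auto intro!: powr_mono2')
    then show ?case using \<open>\<sigma> > 1\<close> by (simp add: add_increasing2)
  next
    case (Suc k)
    have pos: "real (m + k) > 0" using m \<open>x > 0\<close> by linarith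
    then obtain \<xi> where \<xi>: "real (m + k) < \<xi>" "\<xi> < real (m + Suc k)"
      "real (m + Suc k) powr (1 - \<sigma>) / (1 - \<sigma>) - real (m + k) powr (1 - \<sigma>) / (1 - \<sigma>) = \<xi> powr (-\<sigma>)"
      using powr_mean_value[of "real (m + k)" "real (m + Suc k)" "1 - \<sigma>"] \<open>\<sigma> > 1\<close> by auto
    have "real (m + Suc k) powr (-\<sigma>) \<le> \<xi> powr (-\<sigma>)"
      using \<xi> pos \<open>\<sigma> > 1\<close> by (intro powr_mono2') auto
    also have "\<dots> = (real (m + k) powr (1 - \<sigma>) - real (m + Suc k) powr (1 - \<sigma>)) / (\<sigma> - 1)"
      using \<xi>(3) minus_divide_divide[of "real (m + Suc k) powr (1 - \<sigma>) - real (m + k) powr (1 - \<sigma>)" "1 - \<sigma>"]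
      by (simp only: diff_divide_distrib minus_diff_eq)
    finally show ?case using Suc.IH by (simp add: diff_divide_distrib)
  qed
  have "(\<Sum>n | n < N \<and> real n > x. real n powr (-\<sigma>)) \<le> (\<Sum>n\<in>{m..m + N}. real n powr (-\<sigma>))"
    by (intro sum_mono2) (auto simp: iff)
  also have "\<dots> \<le> x powr (-\<sigma>) + (x powr (1 - \<sigma>) - real (m + N) powr (1 - \<sigma>)) / (\<sigma> - 1)" by (rule bound)
  also have "\<dots> \<le> x powr (-\<sigma>) + x powr (1 - \<sigma>) / (\<sigma> - 1)"
    using \<open>\<sigma> > 1\<close> by (intro add_left_mono divide_right_mono) auto
  also have "x powr (-\<sigma>) = x powr (1 - \<sigma>) / x" using \<open>x > 0\<close> by (simp add: powr_diff powr_minus field_simps)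
  also have "\<dots> \<le> x powr (1 - \<sigma>) / (\<sigma> - 1)" using assms by (intro divide_left_mono) auto
  finally show ?thesis by simp
qed

text \<open>For \<sigma> \<ge> 0 the summand decreases and the integral from 0 already dominates.
  For \<sigma> < 0 it increases, and the comparison leaves the last term, at most x^(-\<sigma>),
  which 1 - \<sigma> \<le> x absorbs.\<close>

lemma sum_powr_le:
  assumes "\<sigma> < 1" "x \<ge> 1" "1 - \<sigma> \<le> x"
  shows "(\<Sum>n\<in>{2..nat \<lfloor>x\<rfloor>}. real n powr (-\<sigma>)) \<le> 2 * x powr (1 - \<sigma>) / (1 - \<sigma>)"
proof -
  define M where "M = nat \<lfloor>x\<rfloor>"
  have M: "real M \<le> x" using assms by (simp add: M_def)
  have pos: "0 \<le> x powr (1 - \<sigma>) / (1 - \<sigma>)" using assms by simp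
  have h: "real M powr (1 - \<sigma>) / (1 - \<sigma>) \<le> x powr (1 - \<sigma>) / (1 - \<sigma>)"
    using M assms by (intro divide_right_mono powr_mono2) auto
  show ?thesis
  proof (cases "\<sigma> \<ge> 0")
    case True
    have "(\<Sum>n\<in>{2..k}. real n powr (-\<sigma>)) \<le> real k powr (1 - \<sigma>) / (1 - \<sigma>)" for k
    proof (induction k)
      case (Suc k)
      show ?case
      proof (cases "k = 0")
        case False
        then obtain \<xi> where \<xi>: "real k < \<xi>" "\<xi> < real (Suc k)"
          "real (Suc k) powr (1 - \<sigma>) / (1 - \<sigma>) - real k powr (1 - \<sigma>) / (1 - \<sigma>) = \<xi> powr (-\<sigma>)"
          using powr_mean_value[of "real k" "real (Suc k)" "1 - \<sigma>"] \<open>\<sigma> < 1\<close> by auto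
        moreover have "real (Suc k) powr (-\<sigma>) \<le> \<xi> powr (-\<sigma>)"
          using \<xi> True False by (intro powr_mono2') auto
        ultimately show ?thesis using Suc.IH False by simp
      qed (use assms in auto)
    qed (use assms in auto)
    from this[of M] h pos show ?thesis by (simp add: M_def)
  next
    case False
    have "(\<Sum>n\<in>{2..k}. real n powr (-\<sigma>)) \<le> real k powr (-\<sigma>) + real k powr (1 - \<sigma>) / (1 - \<sigma>)" for k
    proof (induction k)
      case (Suc k)
      show ?case
      proof (cases "k = 0")
        case k: False
        then obtain \<xi> where \<xi>: "real k < \<xi>" "\<xi> < real (Suc k)"
          "real (Suc k) powr (1 - \<sigma>) / (1 - \<sigma>) - real k powr (1 - \<sigma>) / (1 - \<sigma>) = \<xi> powr (-\<sigma>)"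
          using powr_mean_value[of "real k" "real (Suc k)" "1 - \<sigma>"] \<open>\<sigma> < 1\<close> by auto
        moreover have "real k powr (-\<sigma>) \<le> \<xi> powr (-\<sigma>)"
          using \<xi> False k by (intro powr_mono2) auto
        ultimately show ?thesis using Suc.IH k by simp
      qed (use assms in auto)
    qed (use assms in auto)
    from this[of M] have "(\<Sum>n\<in>{2..M}. real n powr (-\<sigma>)) \<le> real M powr (-\<sigma>) + x powr (1 - \<sigma>) / (1 - \<sigma>)"
      using h by linarith
    also have "real M powr (-\<sigma>) \<le> x powr (-\<sigma>)" using M False by (intro powr_mono2) auto
    also have "x powr (-\<sigma>) = x powr (1 - \<sigma>) / x" using \<open>x \<ge> 1\<close> by (simp add: powr_diff powr_minus field_simps)
    also have "\<dots> \<le> x powr (1 - \<sigma>) / (1 - \<sigma>)" using assms by (intro divide_left_mono) auto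
    finally show ?thesis by (simp add: M_def)
  qed
qed

definition prime_partial_sum :: "real \<Rightarrow> complex \<Rightarrow> complex" where
  "prime_partial_sum x s = (\<Sum>p | prime p \<and> real p \<le> x. of_nat p powr (-s))"

lemma finite_primes_le_real [simp]: "finite {p::nat. prime p \<and> real p \<le> x}"
  by (rule finite_subset[of _ "{..nat \<lfloor>x\<rfloor>}"]) (auto simp: le_nat_floor)

lemma holomorphic_prime_partial_sum: "prime_partial_sum x holomorphic_on A"
  unfolding prime_partial_sum_def by (intro holomorphic_intros) (auto simp: prime_gt_0_nat)

lemma norm_prime_partial_sum_le:
  assumes "Re s < 1" "x \<ge> 1" "1 - Re s \<le> x"
  shows "norm (prime_partial_sum x s) \<le> 2 * x powr (1 - Re s) / (1 - Re s)"
proof -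
  have "norm (prime_partial_sum x s) \<le> (\<Sum>p | prime p \<and> real p \<le> x. norm (of_nat p powr (-s) :: complex))"
    unfolding prime_partial_sum_def by (rule norm_sum)
  also have "\<dots> = (\<Sum>p | prime p \<and> real p \<le> x. real p powr (- Re s))"
    by (intro sum.cong) (auto simp: norm_of_nat_powr prime_gt_0_nat)
  also have "\<dots> \<le> (\<Sum>n\<in>{2..nat \<lfloor>x\<rfloor>}. real n powr (- Re s))"
    by (intro sum_mono2) (auto simp: le_nat_floor prime_ge_2_nat)
  also have "\<dots> \<le> 2 * x powr (1 - Re s) / (1 - Re s)" by (rule sum_powr_le[OF assms])
  finally show ?thesis .
qed

lemma norm_prime_zeta_minus_partial_sum_le:
  assumes "Re s > 1" "x > 0" "Re s - 1 \<le> x"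
  shows "norm (prime_zeta s - prime_partial_sum x s) \<le> 2 * x powr (1 - Re s) / (Re s - 1)"
proof -
  let ?f = "\<lambda>n. if prime n then of_nat n powr (-s) else 0 :: complex"
  let ?g = "\<lambda>n. if prime n \<and> real n \<le> x then of_nat n powr (-s) else 0 :: complex"
  have "prime_partial_sum x s = sum ?g {p. prime p \<and> real p \<le> x}"
    unfolding prime_partial_sum_def by (intro sum.cong) auto
  moreover have "?g sums sum ?g {p. prime p \<and> real p \<le> x}"
    by (intro sums_finite) auto
  ultimately have "?g sums prime_partial_sum x s" by simp
  moreover have "?f sums prime_zeta s"
    unfolding prime_zeta_eq_suminf[OF assms(1)]
    by (intro summable_sums summable_norm_cancel[OF summable_norm_prime_powr] assms)
  ultimately have sums: "(\<lambda>n. ?f n - ?g n) sums (prime_zeta s - prime_partial_sum x s)" by (intro sums_diff)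
  have norm_le: "norm (?f n - ?g n) \<le> (if real n > x then real n powr (- Re s) else 0)" for n
    by (auto simp: norm_of_nat_powr prime_gt_0_nat)
  have "(\<lambda>N. \<Sum>n<N. ?f n - ?g n) \<longlonglongrightarrow> prime_zeta s - prime_partial_sum x s"
    using sums by (simp add: sums_def)
  moreover have "norm (\<Sum>n<N. ?f n - ?g n) \<le> 2 * x powr (1 - Re s) / (Re s - 1)" for N
  proof -
    have "norm (\<Sum>n<N. ?f n - ?g n) \<le> (\<Sum>n<N. if real n > x then real n powr (- Re s) else 0)"
      by (rule sum_norm_le) (rule norm_le)
    also have "\<dots> = (\<Sum>n | n < N \<and> real n > x. real n powr (- Re s))"
      by (intro sum.mono_neutral_cong_right) auto
    also have "\<dots> \<le> 2 * x powr (1 - Re s) / (Re s - 1)" by (rule sum_powr_tail_le[OF assms])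
    finally show ?thesis .
  qed
  ultimately show ?thesis
    by (intro Lim_bounded[OF tendsto_norm]) auto
qed

text \<open>The existence lemmas only provide some \<open>E\<close> and \<open>L\<close>; fixing
  them here lets definitions refer to them. Zero-freeness of \<open>reg_zeta\<close>, the content of
  the Riemann hypothesis, is present through \<open>exp_L\<close>.\<close>

locale log_zeta_E1 =
  fixes E L :: "complex \<Rightarrow> complex"
  assumes E_hol: "E holomorphic_on UNIV"
    and E_deriv: "z \<noteq> 0 \<Longrightarrow> (E has_field_derivative (1 - exp (-z)) / z) (at z)"
    and E1_eq: "z \<notin> \<real>\<^sub>\<le>\<^sub>0 \<Longrightarrow> E1 z = E z - Ln z"
    and L_hol: "L holomorphic_on {s. Re s > 1/2}"
    and exp_L: "Re s > 1/2 \<Longrightarrow> exp (L s) = reg_zeta s"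
    and L_eq: "Re s > 1 \<Longrightarrow> L s = prime_log s + Ln (s - 1)"
begin

text \<open>The singularity of \<open>P(s)\<close> at \<open>s = 1\<close> is that of \<open>E\<^sub>1(s - 1)\<close>.\<close>
definition D :: "complex \<Rightarrow> complex" where
  "D s = L s + prime_rem s - E (s - 1)"

text \<open>Off the cut, \<open>DX x s\<close> is the truncated prime zeta function minus \<open>E\<^sub>1(s - 1)\<close>.\<close>
definition DX :: "real \<Rightarrow> complex \<Rightarrow> complex" where
  "DX x s = prime_partial_sum x s + E ((s - 1) * of_real (ln x)) - E (s - 1) - of_real (ln (ln x))"

lemma D_hol: "D holomorphic_on {s. Re s > 1/2}"
  unfolding D_def by (intro holomorphic_intros L_hol holomorphic_prime_rem
      holomorphic_on_compose_gen[OF _ E_hol, unfolded o_def]) auto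

lemma DX_hol: "DX x holomorphic_on UNIV"
  unfolding DX_def by (intro holomorphic_intros holomorphic_prime_partial_sum
      holomorphic_on_compose_gen[OF _ E_hol, unfolded o_def]) auto

text \<open>Positive scaling leaves the argument unchanged, so the logarithm splits exactly. Hence
  E1((s - 1) log x) and E1(s - 1) have the same \<open>Ln (s - 1)\<close>, and their difference
  leaves the term ln (ln x) in \<open>DX\<close>.\<close>

lemma E1_scaled:
  assumes "z \<notin> \<real>\<^sub>\<le>\<^sub>0" "T > 0"
  shows "E1 (z * of_real T) = E (z * of_real T) - Ln z - of_real (ln T)"
proof -
  have "z * of_real T \<notin> \<real>\<^sub>\<le>\<^sub>0"
    using assms by (auto simp: complex_nonpos_Reals_iff mult_le_0_iff)
  moreover have "Ln (z * of_real T) = Ln z + of_real (ln T)"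
    using assms Ln_times_of_real[of T z] by (cases "z = 0") (auto simp: mult.commute Ln_of_real)
  ultimately show ?thesis by (simp add: E1_eq)
qed

text \<open>To the right of Re s = 1 the difference is the tail of the prime series minus E1((s - 1)
  log x). The tail contributes 2 and \<open>E1\<close> contributes 1 to the constant, the latter
  because x \<ge> exp 1 gives ln x \<ge> 1.\<close>

lemma norm_D_minus_DX_le:
  assumes "Re s > 1" "x \<ge> exp 1" "Re s - 1 \<le> x"
  shows "norm (D s - DX x s) \<le> 3 * x powr (1 - Re s) / (Re s - 1)"
proof -
  have x: "x > 0" using assms(2) exp_gt_zero[of "1::real"] by linarith
  have T: "ln x \<ge> 1" using assms(2) x by (simp add: ln_ge_iff)
  have s1: "s - 1 \<notin> \<real>\<^sub>\<le>\<^sub>0" using assms(1) by (rule Ln_minus_1_domain)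
  have "D s - DX x s = (prime_zeta s - prime_partial_sum x s) - E1 ((s - 1) * of_real (ln x))"
    using E1_scaled[OF s1, of "ln x"] T assms(1)
    by (simp add: D_def DX_def L_eq prime_zeta_eq_prime_log)
  also have "norm \<dots> \<le> norm (prime_zeta s - prime_partial_sum x s) + norm (E1 ((s - 1) * of_real (ln x)))"
    by (rule norm_triangle_ineq4)
  also have "\<dots> \<le> 2 * x powr (1 - Re s) / (Re s - 1) + x powr (1 - Re s) / (Re s - 1)"
  proof (rule add_mono)
    show "norm (prime_zeta s - prime_partial_sum x s) \<le> 2 * x powr (1 - Re s) / (Re s - 1)"
      using assms x by (intro norm_prime_zeta_minus_partial_sum_le) auto
    have pos: "(Re s - 1) * 1 \<le> (Re s - 1) * ln x" using T assms(1) by (intro mult_left_mono) auto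
    have "norm (E1 ((s - 1) * of_real (ln x))) \<le> exp (- Re ((s - 1) * of_real (ln x))) / Re ((s - 1) * of_real (ln x))"
      using pos assms(1) by (intro norm_E1_le_Re) auto
    also have "exp (- Re ((s - 1) * of_real (ln x))) = x powr (1 - Re s)"
      using x by (simp add: powr_def algebra_simps)
    also have "x powr (1 - Re s) / Re ((s - 1) * of_real (ln x)) \<le> x powr (1 - Re s) / (Re s - 1)"
      using pos assms(1) by (intro divide_left_mono) auto
    finally show "norm (E1 ((s - 1) * of_real (ln x))) \<le> x powr (1 - Re s) / (Re s - 1)" .
  qed
  finally show ?thesis by (simp add: add_divide_distrib[symmetric])
qed

text \<open>With T = ln x, the non-prime part \<open>J\<close> is minus the integral of exp(-(s -
  1)v)/v over 1 \<le> v \<le> T: the 1/v in the derivative of \<open>E\<close> cancels against that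
  of ln v. No logarithm of s - 1 is involved, so the bound also holds on the cut. Replacing 1/v by 1
  makes the majorant explicitly integrable.\<close>

lemma norm_DX_le:
  assumes "Re s < 1" "x \<ge> exp 1" "1 - Re s \<le> x"
  shows "norm (DX x s) \<le> 3 * x powr (1 - Re s) / (1 - Re s)"
proof -
  have x: "x > 1" using assms(2) exp_gt_one[of 1] by linarith
  define T where "T = ln x"
  have T: "T \<ge> 1" using assms(2) x by (simp add: T_def ln_ge_iff)
  define J where "J = E ((s - 1) * of_real T) - E (s - 1) - of_real (ln T)"
  have J: "norm J \<le> x powr (1 - Re s) / (1 - Re s)"
  proof (cases "T = 1")
    case False
    define f where "f = (\<lambda>v. E ((s - 1) * of_real v) - of_real (ln v))"
    define \<phi> where "\<phi> = (\<lambda>v. exp ((1 - Re s) * v) / (1 - Re s))"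
    have s1: "s - 1 \<noteq> 0" using assms(1) by auto
    have f_deriv: "(f has_vector_derivative - exp (- ((s - 1) * of_real v)) / of_real v) (at v)" if "v > 0" for v
    proof -
      let ?w = "(s - 1) * of_real v"
      have "?w \<noteq> 0" using s1 that by simp
      have "((\<lambda>v. (s - 1) * of_real v) has_vector_derivative (s - 1)) (at v)"
        by (auto intro!: derivative_eq_intros simp: has_vector_derivative_def scaleR_conv_of_real)
      from field_vector_diff_chain_at[OF this E_deriv[OF \<open>?w \<noteq> 0\<close>]]
      have "((\<lambda>v. E ((s - 1) * of_real v)) has_vector_derivative (s - 1) * ((1 - exp (- ?w)) / ?w)) (at v)"
        by (simp add: o_def)
      moreover have "((\<lambda>v. complex_of_real (ln v)) has_vector_derivative of_real (1 / v)) (at v)"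
        using that by (intro has_vector_derivative_of_real) (auto intro!: derivative_eq_intros)
      ultimately have "(f has_vector_derivative (s - 1) * ((1 - exp (- ?w)) / ?w) - of_real (1 / v)) (at v)"
        unfolding f_def by (rule has_vector_derivative_diff)
      moreover have "(s - 1) * ((1 - exp (- ?w)) / ?w) - of_real (1 / v) = - exp (- ?w) / of_real v"
        using s1 that by (simp add: field_simps)
      ultimately show ?thesis by simp
    qed
    have "norm (f T - f 1) \<le> \<phi> T - \<phi> 1"
    proof (rule differentiable_bound_general)
      show "1 < T" using T False by simp
      show "continuous_on {1..T} f"
        by (rule continuous_at_imp_continuous_on)
           (auto intro!: has_vector_derivative_continuous[OF f_deriv])
      show "continuous_on {1..T} \<phi>" unfolding \<phi>_def using assms(1) by (intro continuous_intros) auto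
      fix v assume v: "1 < v" "v < T"
      show "(f has_vector_derivative - exp (- ((s - 1) * of_real v)) / of_real v) (at v)"
        using v by (intro f_deriv) auto
      show "(\<phi> has_vector_derivative exp ((1 - Re s) * v)) (at v)"
        unfolding \<phi>_def using assms(1)
        by (auto intro!: derivative_eq_intros simp flip: has_real_derivative_iff_has_vector_derivative)
      have "norm (- exp (- ((s - 1) * of_real v)) / of_real v) = exp ((1 - Re s) * v) / v"
        using v by (simp add: norm_divide algebra_simps)
      also have "\<dots> \<le> exp ((1 - Re s) * v) / 1" using v by (intro divide_left_mono) auto
      finally show "norm (- exp (- ((s - 1) * of_real v)) / of_real v) \<le> exp ((1 - Re s) * v)" by simp
    qed
    also have "f T - f 1 = J" by (simp add: f_def J_def)
    also have "\<phi> T - \<phi> 1 \<le> \<phi> T" using assms(1) by (simp add: \<phi>_def)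
    also have "\<phi> T = x powr (1 - Re s) / (1 - Re s)"
      using x by (simp add: \<phi>_def T_def powr_def)
    finally show ?thesis .
  qed (use assms in \<open>simp add: J_def\<close>)
  have "DX x s = prime_partial_sum x s + J" by (simp add: DX_def J_def T_def)
  then have "norm (DX x s) \<le> norm (prime_partial_sum x s) + norm J" by (simp add: norm_triangle_ineq)
  also have "\<dots> \<le> 2 * x powr (1 - Re s) / (1 - Re s) + x powr (1 - Re s) / (1 - Re s)"
    using assms x by (intro add_mono J norm_prime_partial_sum_le) auto
  finally show ?thesis by (simp add: add_divide_distrib[symmetric])
qed

lemma norm_prime_rem_le:
  assumes "a > 1/2"
  obtains C where "\<And>s. Re s \<ge> a \<Longrightarrow> norm (prime_rem s) \<le> C"
proof
  fix s assume s: "Re s \<ge> a"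
  have summ: "summable (\<lambda>n. 4 * real n powr (- (2 * a)))"
    using assms by (intro summable_mult) (simp add: summable_real_powr_iff)
  let ?f = "\<lambda>n. if prime n then of_nat n powr (-s) + Ln (1 - of_nat n powr (-s)) else 0 :: complex"
  have summ_f: "summable (\<lambda>n. norm (?f n))" using s assms by (intro summable_norm_prime_rem) auto
  have "norm (prime_rem s) \<le> (\<Sum>n. norm (?f n))"
    unfolding prime_rem_def by (rule summable_norm[OF summ_f])
  also have "\<dots> \<le> (\<Sum>n. 4 * real n powr (- (2 * a)))"
  proof (intro suminf_le summ summ_f)
    fix n
    have "norm (?f n) \<le> 4 * real n powr (- (2 * Re s))"
      using s assms by (intro norm_prime_rem_term) auto
    also have "\<dots> \<le> 4 * real n powr (- (2 * a))"
      using s by (cases "n = 0") (auto intro!: powr_mono)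
    finally show "norm (?f n) \<le> 4 * real n powr (- (2 * a))" .
  qed
  finally show "norm (prime_rem s) \<le> (\<Sum>n. 4 * real n powr (- (2 * a)))" .
qed

text \<open>The pieces E1(s - 1) and \<open>Ln (s - 1)\<close> are separately unbounded near 1, so
  for \<bar>Im s\<bar> \<le> 1 only continuity of \<open>D\<close> on a compact rectangle is used,
  and the pieces are estimated one by one elsewhere.\<close>

lemma norm_D_le:
  assumes "a > 1/2"
  obtains C where "C \<ge> 0" "\<And>s. a \<le> Re s \<Longrightarrow> Re s \<le> 2 \<Longrightarrow> norm (D s) \<le> C * ln (5 + \<bar>Im s\<bar>)"
proof -
  obtain C1 where C1: "\<And>s. a \<le> Re s \<Longrightarrow> Re s \<le> 2 \<Longrightarrow> norm (L s) \<le> C1 * ln (5 + \<bar>Im s\<bar>)"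
    using reg_zeta_log_bound[OF L_hol exp_L L_eq assms] by metis
  obtain C2 where C2: "\<And>s. Re s \<ge> a \<Longrightarrow> norm (prime_rem s) \<le> C2"
    using norm_prime_rem_le[OF assms] by metis
  define K where "K = {s. a \<le> Re s \<and> Re s \<le> 2 \<and> \<bar>Im s\<bar> \<le> 1}"
  have "K = cbox (Complex a (-1)) (Complex 2 1)" by (auto simp: K_def in_cbox_complex_iff)
  then have "compact K" by simp
  then have "bounded (D ` K)"
    using D_hol assms by (intro compact_imp_bounded compact_continuous_image)
      (auto intro!: holomorphic_on_imp_continuous_on elim!: holomorphic_on_subset simp: K_def)
  then obtain C3 where C3: "\<And>s. s \<in> K \<Longrightarrow> norm (D s) \<le> C3" by (auto simp: bounded_iff)
  define C where "C = \<bar>C3\<bar> + \<bar>C1\<bar> + \<bar>C2\<bar> + exp 1 + 1 + pi"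
  show ?thesis
  proof
    show "C \<ge> 0" by (simp add: C_def)
    fix s assume s: "a \<le> Re s" "Re s \<le> 2"
    define l where "l = ln (5 + \<bar>Im s\<bar>)"
    have "exp 1 \<le> 5 + \<bar>Im s\<bar>" using exp_le by linarith
    then have l1: "l \<ge> 1" unfolding l_def by (subst ln_ge_iff) auto
    have "norm (D s) \<le> C * l"
    proof (cases "\<bar>Im s\<bar> \<le> 1")
      case True
      then have "norm (D s) \<le> C3" using s by (intro C3) (auto simp: K_def)
      also have "\<dots> \<le> C" unfolding C_def using pi_gt_zero exp_gt_zero[of "1::real"] by linarith
      also have "\<dots> = C * 1" by simp
      also have "\<dots> \<le> C * l" using l1 \<open>C \<ge> 0\<close> by (intro mult_left_mono)
      finally show ?thesis .
    next
      case False
      have s1: "s - 1 \<notin> \<real>\<^sub>\<le>\<^sub>0" using False by (auto simp: complex_nonpos_Reals_iff)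
      have n1: "norm (s - 1) \<ge> 1" "norm (s - 1) \<le> 5 + \<bar>Im s\<bar>"
        using abs_Im_le_cmod[of "s - 1"] cmod_le[of "s - 1"] False s assms by auto
      then have "s - 1 \<noteq> 0" by auto
      have "norm (Ln (s - 1)) \<le> \<bar>Re (Ln (s - 1))\<bar> + \<bar>Im (Ln (s - 1))\<bar>" by (rule cmod_le)
      also have "\<dots> \<le> l + pi"
      proof (rule add_mono)
        show "\<bar>Re (Ln (s - 1))\<bar> \<le> l" using n1 \<open>s - 1 \<noteq> 0\<close> by (auto simp: l_def)
        show "\<bar>Im (Ln (s - 1))\<bar> \<le> pi"
          using mpi_less_Im_Ln[OF \<open>s - 1 \<noteq> 0\<close>] Im_Ln_le_pi[OF \<open>s - 1 \<noteq> 0\<close>] by auto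
      qed
      finally have 1: "norm (Ln (s - 1)) \<le> l + pi" .
      have "norm (E1 (s - 1)) \<le> exp (- Re (s - 1)) / \<bar>Im (s - 1)\<bar>"
        using False by (intro norm_E1_le_Im) auto
      also have "\<dots> \<le> exp 1 / 1" using False s assms by (intro frac_le) auto
      finally have 2: "norm (E1 (s - 1)) \<le> exp 1" by simp
      have "D s = L s + prime_rem s - (E1 (s - 1) + Ln (s - 1))"
        using E1_eq[OF s1] by (simp add: D_def)
      also have "norm \<dots> \<le> norm (L s) + norm (prime_rem s) + (norm (E1 (s - 1)) + norm (Ln (s - 1)))"
        by (intro order_trans[OF norm_triangle_ineq4] add_mono norm_triangle_ineq)
      also have "\<dots> \<le> C1 * l + C2 + (exp 1 + (l + pi))"
        using C1[OF s] C2[OF s(1)] 1 2 by (intro add_mono) (auto simp: l_def)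
      also have "\<dots> \<le> \<bar>C1\<bar> * l + \<bar>C2\<bar> * l + (exp 1 * l + (1 * l + pi * l))"
      proof -
        have "c \<le> c * l" if "c \<ge> 0" for c :: real using mult_left_mono[OF l1 that] by simp
        from this[of "\<bar>C2\<bar>"] this[of "exp 1"] this[of pi]
        have "C2 \<le> \<bar>C2\<bar> * l" "exp 1 \<le> exp 1 * l" "pi \<le> pi * l" by auto
        moreover have "C1 * l \<le> \<bar>C1\<bar> * l" using l1 by (intro mult_right_mono) auto
        ultimately show ?thesis by linarith
      qed
      also have "\<dots> = (C - \<bar>C3\<bar>) * l" by (simp add: C_def algebra_simps)
      also have "\<dots> \<le> C * l" using l1 by (intro mult_right_mono) auto
      finally show ?thesis .
    qed
    then show "norm (D s) \<le> C * ln (5 + \<bar>Im s\<bar>)" by (simp add: l_def)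
  qed
qed

end

subsection \<open>The contour integral\<close>

lemma contour_integral_rectpath:
  assumes "continuous_on (path_image (rectpath (Complex a c) (Complex b d))) f" "a \<le> b" "c \<le> d"
  shows "contour_integral (rectpath (Complex a c) (Complex b d)) f =
    contour_integral (linepath (Complex a c) (Complex b c)) f +
    contour_integral (linepath (Complex b c) (Complex b d)) f +
    contour_integral (linepath (Complex b d) (Complex a d)) f +
    contour_integral (linepath (Complex a d) (Complex a c)) f"
proof -
  have "path_image (rectpath (Complex a c) (Complex b d)) =
      closed_segment (Complex a c) (Complex b c) \<union> closed_segment (Complex b c) (Complex b d) \<union>
      closed_segment (Complex b d) (Complex a d) \<union> closed_segment (Complex a d) (Complex a c)"
    by (simp add: rectpath_def Let_def path_image_join Un_assoc)
  then have "f contour_integrable_on linepath (Complex a c) (Complex b c)"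
    "f contour_integrable_on linepath (Complex b c) (Complex b d)"
    "f contour_integrable_on linepath (Complex b d) (Complex a d)"
    "f contour_integrable_on linepath (Complex a d) (Complex a c)"
    using assms(1) by (auto intro!: contour_integrable_continuous_linepath intro: continuous_on_subset)
  then show ?thesis by (simp add: rectpath_def Let_def add.assoc)
qed

lemma in_closed_segment_Complex_same_Im:
  "z \<in> closed_segment (Complex a y) (Complex b y) \<longleftrightarrow> Im z = y \<and> Re z \<in> closed_segment a b"
  by (subst closed_segment_same_Im) auto

lemma in_closed_segment_Complex_same_Re:
  "z \<in> closed_segment (Complex x a) (Complex x b) \<longleftrightarrow> Re z = x \<and> Im z \<in> closed_segment a b"
  by (subst closed_segment_same_Re) auto

text \<open>Newman's kernel: the quadratic factor vanishes at \<open>1 \<plusminus> iR\<close> and so absorbs the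
  blow-up of the bounds on the line \<open>Re w = 1\<close>.\<close>
definition newman_kernel :: "real \<Rightarrow> real \<Rightarrow> complex \<Rightarrow> complex \<Rightarrow> complex" where
  "newman_kernel x R s w = (1 + (w - 1)\<^sup>2 / of_real (R\<^sup>2)) * exp ((w - s) * of_real (ln x))"

lemma newman_kernel_hol: "newman_kernel x R s holomorphic_on A"
  unfolding newman_kernel_def[abs_def] divide_inverse by (intro holomorphic_intros)

lemma norm_newman_kernel:
  assumes "x > 0"
  shows "norm (newman_kernel x R s w) = norm (1 + (w - 1)\<^sup>2 / of_real (R\<^sup>2)) * x powr (Re w - Re s)"
  unfolding newman_kernel_def norm_mult using assms by (simp add: powr_def)

text \<open>A square takes the place of Newman's circle, so that all paths are line
  segments.\<close>

definition on_box :: "real \<Rightarrow> complex \<Rightarrow> bool" where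
  "on_box R w \<longleftrightarrow> (\<bar>Re w - 1\<bar> = R \<and> \<bar>Im w\<bar> \<le> R) \<or> (\<bar>Im w\<bar> = R \<and> \<bar>Re w - 1\<bar> \<le> R)"

text \<open>On the horizontal sides w - 1 = y \<plusminus> iR, so (w - 1)^2 + R^2 = y^2 \<plusminus>
  2iyR has modulus at most 3 \<bar>y\<bar> R. On the vertical sides \<bar>Re w - 1\<bar> = R and the
  claim is the trivial bound 3.\<close>

lemma norm_quadratic_factor_on_box:
  assumes "R > 0" "on_box R w"
  shows "norm (1 + (w - 1)\<^sup>2 / of_real (R\<^sup>2)) \<le> 3 * \<bar>Re w - 1\<bar> / R"
proof (cases "\<bar>Im w\<bar> = R")
  case True
  define y where "y = Re w - 1"
  have y: "\<bar>y\<bar> \<le> R" using assms True by (auto simp: on_box_def y_def)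
  have "(Im w)\<^sup>2 = R\<^sup>2" using True by (metis power2_abs)
  moreover have "w - 1 = Complex y (Im w)" by (simp add: complex_eq_iff y_def)
  ultimately have "(w - 1)\<^sup>2 + of_real (R\<^sup>2) = Complex (y * y) (2 * y * Im w)"
    by (simp add: complex_eq_iff power2_eq_square)
  moreover have "1 + (w - 1)\<^sup>2 / of_real (R\<^sup>2) = ((w - 1)\<^sup>2 + of_real (R\<^sup>2)) / of_real (R\<^sup>2)"
    using assms by (simp add: field_simps)
  ultimately have "norm (1 + (w - 1)\<^sup>2 / of_real (R\<^sup>2)) = norm (Complex (y * y) (2 * y * Im w)) / R\<^sup>2"
    by (simp only: norm_divide norm_of_real) simp
  also have "\<dots> \<le> (\<bar>y\<bar> * R + 2 * \<bar>y\<bar> * R) / R\<^sup>2"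
  proof (rule divide_right_mono)
    have "norm (Complex (y * y) (2 * y * Im w)) \<le> \<bar>y * y\<bar> + \<bar>2 * y * Im w\<bar>"
      using cmod_le[of "Complex (y * y) (2 * y * Im w)"] by simp
    also have "\<dots> \<le> \<bar>y\<bar> * R + 2 * \<bar>y\<bar> * R"
    proof (rule add_mono)
      show "\<bar>y * y\<bar> \<le> \<bar>y\<bar> * R" unfolding abs_mult using y by (intro mult_left_mono) auto
      show "\<bar>2 * y * Im w\<bar> \<le> 2 * \<bar>y\<bar> * R" using True by (simp add: abs_mult)
    qed
    finally show "norm (Complex (y * y) (2 * y * Im w)) \<le> \<bar>y\<bar> * R + 2 * \<bar>y\<bar> * R" .
  qed auto
  also have "\<dots> = 3 * \<bar>y\<bar> / R" using assms by (simp add: field_simps power2_eq_square)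
  finally show ?thesis by (simp add: y_def)
next
  case False
  then have w: "\<bar>Re w - 1\<bar> = R" "\<bar>Im w\<bar> \<le> R" using assms by (auto simp: on_box_def)
  then have "(Re w - 1)\<^sup>2 = R\<^sup>2" "(Im w)\<^sup>2 \<le> R\<^sup>2"
    using power2_abs[of "Re w - 1"] power_mono[of "\<bar>Im w\<bar>" R 2] by auto
  then have "(norm (w - 1))\<^sup>2 \<le> 2 * R\<^sup>2" by (simp add: cmod_power2)
  then have "norm ((w - 1)\<^sup>2 / of_real (R\<^sup>2)) \<le> 2"
    using assms by (simp add: norm_divide norm_power divide_le_eq)
  then have "norm (1 + (w - 1)\<^sup>2 / of_real (R\<^sup>2)) \<le> 1 + 2"
    by (intro order_trans[OF norm_triangle_ineq]) auto
  then show ?thesis using w assms by simp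
qed

lemma norm_minus_on_box:
  assumes "R > 0" "on_box R w" "norm (s - 1) \<le> R / 2"
  shows "norm (w - s) \<ge> R / 2"
proof -
  have "R \<le> norm (w - 1)"
    using assms abs_Re_le_cmod[of "w - 1"] abs_Im_le_cmod[of "w - 1"] by (auto simp: on_box_def)
  then show ?thesis using assms(3) norm_triangle_ineq2[of "w - 1" "s - 1"] by simp
qed

text \<open>The x^(1 - Re w) of the hypothesis meets x^(Re w - Re s) from the kernel, so the
  dependence on w disappears. Stating the hypothesis as a product with \<bar>Re w - 1\<bar> includes
  the points on Re w = 1, where the quotient form is meaningless. The 18 is 3 from the hypothesis, 3
  from the quadratic factor and 2 from norm (w - s) \<ge> R/2.\<close>

lemma norm_newman_kernel_ratio_on_box:
  assumes "x > 0" "R > 0" "on_box R w" "norm (s - 1) \<le> R / 2" "norm F * \<bar>Re w - 1\<bar> \<le> 3 * x powr (1 - Re w)"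
  shows "norm (F * newman_kernel x R s w / (w - s)) \<le> 18 * x powr (1 - Re s) / R\<^sup>2"
proof -
  have "norm (F * newman_kernel x R s w / (w - s)) =
      norm F * (norm (1 + (w - 1)\<^sup>2 / of_real (R\<^sup>2)) * x powr (Re w - Re s)) / norm (w - s)"
    using assms by (simp only: norm_divide norm_mult norm_newman_kernel)
  also have "\<dots> \<le> norm F * ((3 * \<bar>Re w - 1\<bar> / R) * x powr (Re w - Re s)) / (R / 2)"
    using assms norm_minus_on_box[of R w s]
    by (intro frac_le mult_left_mono mult_right_mono norm_quadratic_factor_on_box) auto
  also have "\<dots> = (norm F * \<bar>Re w - 1\<bar>) * (6 * x powr (Re w - Re s) / R\<^sup>2)"
    using assms by (simp add: field_simps power2_eq_square)
  also have "\<dots> \<le> (3 * x powr (1 - Re w)) * (6 * x powr (Re w - Re s) / R\<^sup>2)"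
    using assms by (intro mult_right_mono) auto
  also have "\<dots> = 18 * (x powr (1 - Re w) * x powr (Re w - Re s)) / R\<^sup>2" by simp
  also have "x powr (1 - Re w) * x powr (Re w - Re s) = x powr (1 - Re s)" by (simp flip: powr_add)
  finally show ?thesis .
qed

context log_zeta_E1
begin

text \<open>Cauchy's formula with Newman's kernel for \<open>D\<close> on the rectangle \<open>a \<le> Re w \<le> 1 + R\<close> and for the
  entire function \<open>DX x\<close> on \<open>1 - R \<le> Re w \<le> 1 + R\<close>; only to the right of \<open>Re w = 1\<close> is the
  difference \<open>D - DX x\<close> known to be small.\<close>
lemma newman_estimate:
  assumes a: "1/2 < a" "a < Re s" "a \<le> 1" and R: "R \<ge> 2" "norm (s - 1) \<le> R / 2"
    and C: "C \<ge> 0" "\<And>w. a \<le> Re w \<Longrightarrow> Re w \<le> 2 \<Longrightarrow> norm (D w) \<le> C * ln (5 + \<bar>Im w\<bar>)"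
    and M: "M = (1 + \<bar>Im s\<bar>) / (Re s - a) + 1" and x: "x = R\<^sup>2"
  shows "norm (D s - DX x s) \<le> 144 * R * x powr (- Re s) + 12 * C * ln (5 + R) * x powr (1 - Re s) / R
     + 6 * C * M * ln (5 + R) * x powr (a - Re s) * arsinh R"
proof -
  have R0: "R > 0" "R \<ge> 1" using R by auto
  have "x \<ge> 2\<^sup>2" unfolding x using R by (intro power_mono) auto
  then have "x \<ge> exp 1" using exp_le by simp
  have "x > 0" using R0 by (simp add: x)
  have xR: "R + 1 \<le> x" unfolding x power2_eq_square using R mult_right_mono[of 2 R R] by linarith
  have s: "\<bar>Re s - 1\<bar> < R" "\<bar>Im s\<bar> < R"
    using abs_Re_le_cmod[of "s - 1"] abs_Im_le_cmod[of "s - 1"] R by auto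
  define k where "k = newman_kernel x R s"
  define G0 where "G0 = (\<lambda>w. D w * k w / (w - s))"
  define G2 where "G2 = (\<lambda>w. DX x w * k w / (w - s))"
  define G1 where "G1 = (\<lambda>w. (D w - DX x w) * k w / (w - s))"
  have G1_eq: "G1 w = G0 w - G2 w" for w by (simp add: G0_def G1_def G2_def algebra_simps diff_divide_distrib)
  \<comment> \<open>The bound 18 x^(1 - Re s) / R^2 on the square, simplified by x = R^2.\<close>
  define B where "B = 18 * x powr (- Re s)"
  define H where "H = C * ln (5 + R)"
  have B_eq: "18 * x powr (1 - Re s) / R\<^sup>2 = B"
    using \<open>x > 0\<close> by (simp add: B_def powr_diff powr_minus field_simps flip: x)
  have H0: "H \<ge> 0" using C R by (simp add: H_def)
  have small2: "norm (G2 w) \<le> B" if "on_box R w" "Re w \<le> 1" for w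
  proof -
    have "norm (DX x w) * \<bar>Re w - 1\<bar> \<le> 3 * x powr (1 - Re w)"
    proof (cases "Re w = 1")
      case False
      then have "norm (DX x w) \<le> 3 * x powr (1 - Re w) / (1 - Re w)"
        using that \<open>x \<ge> exp 1\<close> xR by (intro norm_DX_le) (auto simp: on_box_def)
      then show ?thesis using False that by (simp add: le_divide_eq abs_if)
    qed (use \<open>x > 0\<close> in auto)
    from norm_newman_kernel_ratio_on_box[OF \<open>x > 0\<close> R0(1) that(1) R(2) this] show ?thesis
      by (simp only: G2_def k_def B_eq)
  qed
  have small1: "norm (G1 w) \<le> B" if "on_box R w" "Re w \<ge> 1" for w
  proof -
    have "norm (D w - DX x w) * \<bar>Re w - 1\<bar> \<le> 3 * x powr (1 - Re w)"
    proof (cases "Re w = 1")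
      case False
      then have "norm (D w - DX x w) \<le> 3 * x powr (1 - Re w) / (Re w - 1)"
        using that \<open>x \<ge> exp 1\<close> xR by (intro norm_D_minus_DX_le) (auto simp: on_box_def)
      then show ?thesis using False that by (simp add: le_divide_eq abs_if)
    qed (use \<open>x > 0\<close> in auto)
    from norm_newman_kernel_ratio_on_box[OF \<open>x > 0\<close> R0(1) that(1) R(2) this] show ?thesis
      by (simp only: G1_def k_def B_eq)
  qed
  have D_H: "norm (D w) \<le> H" if "a \<le> Re w" "Re w \<le> 1" "\<bar>Im w\<bar> \<le> R" for w
  proof -
    have "norm (D w) \<le> C * ln (5 + \<bar>Im w\<bar>)" using that by (intro C) auto
    also have "\<dots> \<le> H" unfolding H_def using that C(1) by (intro mult_left_mono) auto
    finally show ?thesis .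
  qed
  have k_le: "norm (k w) \<le> 3 * x powr (Re w - Re s)" if "a \<le> Re w" "Re w \<le> 1" "\<bar>Im w\<bar> \<le> R" for w
  proof -
    have "\<bar>Re w - 1\<bar> \<le> R" using that a R by auto
    then have "(Re w - 1)\<^sup>2 \<le> R\<^sup>2" "(Im w)\<^sup>2 \<le> R\<^sup>2"
      using that(3) power_mono[of "\<bar>Re w - 1\<bar>" R 2] power_mono[of "\<bar>Im w\<bar>" R 2] by auto
    then have "(norm (w - 1))\<^sup>2 \<le> 2 * R\<^sup>2" by (simp add: cmod_power2)
    then have "norm ((w - 1)\<^sup>2 / of_real (R\<^sup>2)) \<le> 2"
      using R0 by (simp add: norm_divide norm_power divide_le_eq)
    then have "norm (1 + (w - 1)\<^sup>2 / of_real (R\<^sup>2)) \<le> 3"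
      by (intro order_trans[OF norm_triangle_ineq]) auto
    then show ?thesis unfolding k_def norm_newman_kernel[OF \<open>x > 0\<close>] by (intro mult_right_mono) auto
  qed
  \<comment> \<open>These two segments have length at most 1, so the crude bound 3 for the quadratic
    factor is enough: the saving 2/R comes from the distance to s, and \<open>H\<close> is only
    logarithmic in R.\<close>
  have small0: "norm (G0 w) \<le> 6 * H * x powr (1 - Re s) / R" if "\<bar>Im w\<bar> = R" "a \<le> Re w" "Re w \<le> 1" for w
  proof -
    have "on_box R w" using that a R by (auto simp: on_box_def)
    have "norm (k w) \<le> 3 * x powr (Re w - Re s)" using that by (intro k_le) auto
    also have "\<dots> \<le> 3 * x powr (1 - Re s)" using that xR R by (intro mult_left_mono powr_mono) auto
    finally have "norm (G0 w) \<le> H * (3 * x powr (1 - Re s)) / (R / 2)"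
      unfolding G0_def norm_divide norm_mult using that H0 R0 norm_minus_on_box[OF R0(1) \<open>on_box R w\<close> R(2)]
      by (intro frac_le mult_mono D_H) auto
    then show ?thesis by (simp add: field_simps)
  qed
  \<comment> \<open>Near s the distance is at least Re s - a, far away it is at least \<bar>t - Im
    s\<bar>; \<open>M\<close> merges both into one multiple of 1 / sqrt(t^2 + 1). Integrating this
    over the segment costs only arsinh R, a logarithm, instead of a factor R.\<close>
  have vert: "norm (G0 (Complex a t)) \<le> 3 * H * M * x powr (a - Re s) * (1 / sqrt (t\<^sup>2 + 1))" if "\<bar>t\<bar> \<le> R" for t
  proof -
    let ?w = "Complex a t"
    have n1: "norm (?w - s) \<ge> Re s - a" "norm (?w - s) \<ge> \<bar>t - Im s\<bar>"
      using abs_Re_le_cmod[of "?w - s"] abs_Im_le_cmod[of "?w - s"] by auto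
    have "sqrt (t\<^sup>2 + 1) \<le> \<bar>t\<bar> + 1" by (rule real_le_lsqrt) (auto simp: power2_sum)
    also have "\<dots> \<le> (1 + \<bar>Im s\<bar>) + \<bar>t - Im s\<bar>" by linarith
    also have "1 + \<bar>Im s\<bar> = (1 + \<bar>Im s\<bar>) / (Re s - a) * (Re s - a)" using a by simp
    also have "(1 + \<bar>Im s\<bar>) / (Re s - a) * (Re s - a) + \<bar>t - Im s\<bar> \<le>
        (1 + \<bar>Im s\<bar>) / (Re s - a) * norm (?w - s) + norm (?w - s)"
      using n1 a by (intro add_mono mult_left_mono) auto
    also have "\<dots> = M * norm (?w - s)" by (simp add: M distrib_right)
    finally have *: "sqrt (t\<^sup>2 + 1) \<le> M * norm (?w - s)" .
    have "norm (?w - s) > 0" using n1 a by linarith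
    moreover have "sqrt (t\<^sup>2 + 1) > 0" by (simp add: add_nonneg_pos)
    ultimately have inv: "1 / norm (?w - s) \<le> M * (1 / sqrt (t\<^sup>2 + 1))" using * by (simp add: field_simps)
    have "norm (G0 ?w) = norm (D ?w) * norm (k ?w) * (1 / norm (?w - s))"
      by (simp add: G0_def norm_divide norm_mult)
    also have "\<dots> \<le> H * (3 * x powr (a - Re s)) * (M * (1 / sqrt (t\<^sup>2 + 1)))"
      using that a H0 inv k_le[of ?w] by (intro mult_mono D_H) auto
    finally show ?thesis by (simp add: mult_ac)
  qed
  have cont0: "continuous_on ({w. Re w > 1/2} - {s}) G0"
    unfolding G0_def k_def
    by (intro holomorphic_on_imp_continuous_on holomorphic_intros newman_kernel_hol
        holomorphic_on_subset[OF D_hol]) auto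
  have cont2: "continuous_on (UNIV - {s}) G2"
    unfolding G2_def k_def
    by (intro holomorphic_on_imp_continuous_on holomorphic_intros newman_kernel_hol
        holomorphic_on_subset[OF DX_hol]) auto
  define I where "I = (\<lambda>p q f. contour_integral (linepath p q) f :: complex)"
  have rect0: "path_image (rectpath (Complex a (-R)) (Complex (1 + R) R)) \<subseteq> {w. Re w > 1/2} - {s}"
    using a R s by (subst path_image_rectpath) auto
  have rect2: "path_image (rectpath (Complex (1 - R) (-R)) (Complex (1 + R) R)) \<subseteq> UNIV - {s}"
    using R s by (subst path_image_rectpath) auto
  have "contour_integral (rectpath (Complex a (-R)) (Complex (1 + R) R)) G0 = 2 * pi * \<i> * 1 * (D s * k s)"
  proof -
    have "winding_number (rectpath (Complex a (-R)) (Complex (1 + R) R)) s = 1"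
      using a s by (intro winding_number_rectpath) (auto simp: in_box_complex_iff)
    moreover have "(\<lambda>w. D w * k w) holomorphic_on {w. Re w > 1/2}"
      unfolding k_def by (intro holomorphic_intros D_hol newman_kernel_hol)
    then have "((\<lambda>w. D w * k w / (w - s)) has_contour_integral
       (2 * pi * \<i> * winding_number (rectpath (Complex a (-R)) (Complex (1 + R) R)) s * (D s * k s)))
       (rectpath (Complex a (-R)) (Complex (1 + R) R))"
    proof (rule Cauchy_integral_formula_convex_simple[rotated])
      show "s \<in> interior {w. Re w > 1/2}"
        using a by (simp only: interior_open[OF open_halfspace_Re_gt]) simp
      show "convex {w. Re w > 1/2}" by (rule convex_halfspace_Re_gt)
    qed (use rect0 in auto)
    ultimately show ?thesis by (simp only: G0_def contour_integral_unique)
  qed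
  moreover have "contour_integral (rectpath (Complex (1 - R) (-R)) (Complex (1 + R) R)) G2 = 2 * pi * \<i> * 1 * (DX x s * k s)"
  proof -
    have "winding_number (rectpath (Complex (1 - R) (-R)) (Complex (1 + R) R)) s = 1"
      using s by (intro winding_number_rectpath) (auto simp: in_box_complex_iff)
    moreover have "(\<lambda>w. DX x w * k w) holomorphic_on UNIV"
      unfolding k_def by (intro holomorphic_intros DX_hol newman_kernel_hol)
    then have "((\<lambda>w. DX x w * k w / (w - s)) has_contour_integral
       (2 * pi * \<i> * winding_number (rectpath (Complex (1 - R) (-R)) (Complex (1 + R) R)) s * (DX x s * k s)))
       (rectpath (Complex (1 - R) (-R)) (Complex (1 + R) R))"
      using rect2 by (intro Cauchy_integral_formula_convex_simple[OF convex_UNIV]) auto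
    ultimately show ?thesis by (simp only: G2_def contour_integral_unique)
  qed
  ultimately have cauchy: "2 * pi * \<i> * (k s * (D s - DX x s)) =
      contour_integral (rectpath (Complex a (-R)) (Complex (1 + R) R)) G0 -
      contour_integral (rectpath (Complex (1 - R) (-R)) (Complex (1 + R) R)) G2"
    by (simp add: algebra_simps)
  have seg0: "continuous_on (closed_segment (Complex u (\<epsilon> * R)) (Complex v (\<epsilon> * R))) G0"
    if "\<epsilon> = 1 \<or> \<epsilon> = -1" "u > 1/2" "v > 1/2" for u v \<epsilon>
    using that s by (intro continuous_on_subset[OF cont0])
      (auto simp: in_closed_segment_Complex_same_Im closed_segment_eq_real_ivl split: if_splits)
  have seg2: "continuous_on (closed_segment (Complex u (\<epsilon> * R)) (Complex v (\<epsilon> * R))) G2"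
    if "\<epsilon> = 1 \<or> \<epsilon> = -1" for u v \<epsilon>
    using that s by (intro continuous_on_subset[OF cont2]) (auto simp: in_closed_segment_Complex_same_Im)
  have vseg0: "continuous_on (closed_segment (Complex (1 + R) u) (Complex (1 + R) v)) G0" for u v
    using s R by (intro continuous_on_subset[OF cont0]) (auto simp: in_closed_segment_Complex_same_Re)
  have vseg2: "continuous_on (closed_segment (Complex (1 + \<epsilon> * R) u) (Complex (1 + \<epsilon> * R) v)) G2"
    if "\<epsilon> = 1 \<or> \<epsilon> = -1" for u v \<epsilon>
    using that s R by (intro continuous_on_subset[OF cont2]) (auto simp: in_closed_segment_Complex_same_Re)
  have int0: "contour_integral (rectpath (Complex a (-R)) (Complex (1 + R) R)) G0 =
      (I (Complex a (-R)) (Complex 1 (-R)) G0 + I (Complex 1 (-R)) (Complex (1 + R) (-R)) G0) +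
      I (Complex (1 + R) (-R)) (Complex (1 + R) R) G0 +
      (I (Complex (1 + R) R) (Complex 1 R) G0 + I (Complex 1 R) (Complex a R) G0) +
      I (Complex a R) (Complex a (-R)) G0"
  proof -
    have "I (Complex a (-R)) (Complex (1 + R) (-R)) G0 =
        I (Complex a (-R)) (Complex 1 (-R)) G0 + I (Complex 1 (-R)) (Complex (1 + R) (-R)) G0"
      unfolding I_def using a R seg0[of "-1" a "1 + R"]
      by (intro contour_integral_split_linepath) (auto simp: in_closed_segment_Complex_same_Im closed_segment_eq_real_ivl)
    moreover have "I (Complex (1 + R) R) (Complex a R) G0 =
        I (Complex (1 + R) R) (Complex 1 R) G0 + I (Complex 1 R) (Complex a R) G0"
      unfolding I_def using a R seg0[of 1 "1 + R" a]
      by (intro contour_integral_split_linepath) (auto simp: in_closed_segment_Complex_same_Im closed_segment_eq_real_ivl)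
    ultimately show ?thesis
      using contour_integral_rectpath[OF continuous_on_subset[OF cont0 rect0]] a R by (simp add: I_def)
  qed
  have int2: "contour_integral (rectpath (Complex (1 - R) (-R)) (Complex (1 + R) R)) G2 =
      (I (Complex (1 - R) (-R)) (Complex 1 (-R)) G2 + I (Complex 1 (-R)) (Complex (1 + R) (-R)) G2) +
      I (Complex (1 + R) (-R)) (Complex (1 + R) R) G2 +
      (I (Complex (1 + R) R) (Complex 1 R) G2 + I (Complex 1 R) (Complex (1 - R) R) G2) +
      I (Complex (1 - R) R) (Complex (1 - R) (-R)) G2"
  proof -
    have "I (Complex (1 - R) (-R)) (Complex (1 + R) (-R)) G2 =
        I (Complex (1 - R) (-R)) (Complex 1 (-R)) G2 + I (Complex 1 (-R)) (Complex (1 + R) (-R)) G2"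
      unfolding I_def using R seg2[of "-1" "1 - R" "1 + R"]
      by (intro contour_integral_split_linepath) (auto simp: in_closed_segment_Complex_same_Im closed_segment_eq_real_ivl)
    moreover have "I (Complex (1 + R) R) (Complex (1 - R) R) G2 =
        I (Complex (1 + R) R) (Complex 1 R) G2 + I (Complex 1 R) (Complex (1 - R) R) G2"
      unfolding I_def using R seg2[of 1 "1 + R" "1 - R"]
      by (intro contour_integral_split_linepath) (auto simp: in_closed_segment_Complex_same_Im closed_segment_eq_real_ivl)
    ultimately show ?thesis
      using contour_integral_rectpath[OF continuous_on_subset[OF cont2 rect2]] R by (simp add: I_def)
  qed
  have I1: "I p q G0 - I p q G2 = I p q G1"
    if "continuous_on (closed_segment p q) G0" "continuous_on (closed_segment p q) G2" for p q
    unfolding I_def G1_eq[abs_def] using that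
    by (intro contour_integral_diff[symmetric] contour_integrable_continuous_linepath)
  \<comment> \<open>The two rectangles share their part right of Re w = 1, where the integrands
    combine to \<open>G1\<close>. Left of it \<open>G0\<close> and \<open>G2\<close> are estimated
    separately, each on its own contour.\<close>
  have decomp: "2 * pi * \<i> * (k s * (D s - DX x s)) =
      I (Complex 1 (-R)) (Complex (1 + R) (-R)) G1 + I (Complex (1 + R) (-R)) (Complex (1 + R) R) G1
      + I (Complex (1 + R) R) (Complex 1 R) G1 - I (Complex (1 - R) (-R)) (Complex 1 (-R)) G2
      - I (Complex 1 R) (Complex (1 - R) R) G2 - I (Complex (1 - R) R) (Complex (1 - R) (-R)) G2
      + I (Complex a (-R)) (Complex 1 (-R)) G0 + I (Complex 1 R) (Complex a R) G0
      + I (Complex a R) (Complex a (-R)) G0"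
    unfolding cauchy int0 int2
    using I1[of "Complex 1 (-R)" "Complex (1 + R) (-R)"] seg0[of "-1" 1 "1 + R"] seg2[of "-1" 1 "1 + R"]
      I1[of "Complex (1 + R) (-R)" "Complex (1 + R) R"] vseg0[of "-R" R] vseg2[of 1 "-R" R]
      I1[of "Complex (1 + R) R" "Complex 1 R"] seg0[of 1 "1 + R" 1] seg2[of 1 "1 + R" 1] R
    by (simp add: algebra_simps)
  have norm_I: "norm (I p q f) \<le> K * l"
    if "continuous_on (closed_segment p q) f" "\<And>w. w \<in> closed_segment p q \<Longrightarrow> norm (f w) \<le> K"
      "norm (q - p) \<le> l" for p q f K l
  proof -
    have "K \<ge> 0" using that(2)[of p] norm_ge_zero[of "f p"] by (simp add: order_trans[OF norm_ge_zero])
    then have "norm (I p q f) \<le> K * norm (q - p)"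
      unfolding I_def by (intro contour_integral_bound_linepath contour_integrable_continuous_linepath that)
    also have "\<dots> \<le> K * l" using \<open>K \<ge> 0\<close> that(3) by (intro mult_left_mono)
    finally show ?thesis .
  qed
  have nh: "norm (Complex u y - Complex v y) = \<bar>u - v\<bar>" and nv: "norm (Complex y u - Complex y v) = \<bar>u - v\<bar>" for u v y
    by (simp_all add: complex_diff cmod_def)
  have contG1: "continuous_on S G1" if "continuous_on S G0" "continuous_on S G2" for S
    unfolding G1_eq[abs_def] using that by (intro continuous_intros)
  have b1: "norm (I (Complex 1 (-R)) (Complex (1 + R) (-R)) G1) \<le> B * R"
    using seg0[of "-1" 1 "1 + R"] seg2[of "-1" 1 "1 + R"] R
    by (intro norm_I contG1 small1) (auto simp: nh in_closed_segment_Complex_same_Im closed_segment_eq_real_ivl on_box_def)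
  have b2: "norm (I (Complex (1 + R) (-R)) (Complex (1 + R) R) G1) \<le> B * (2 * R)"
    using vseg0[of "-R" R] vseg2[of 1 "-R" R] R
    by (intro norm_I contG1 small1) (auto simp: nv in_closed_segment_Complex_same_Re closed_segment_eq_real_ivl on_box_def)
  have b3: "norm (I (Complex (1 + R) R) (Complex 1 R) G1) \<le> B * R"
    using seg0[of 1 "1 + R" 1] seg2[of 1 "1 + R" 1] R
    by (intro norm_I contG1 small1) (auto simp: nh in_closed_segment_Complex_same_Im closed_segment_eq_real_ivl on_box_def)
  have b4: "norm (I (Complex (1 - R) (-R)) (Complex 1 (-R)) G2) \<le> B * R"
    using seg2[of "-1" "1 - R" 1] R
    by (intro norm_I small2) (auto simp: nh in_closed_segment_Complex_same_Im closed_segment_eq_real_ivl on_box_def)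
  have b5: "norm (I (Complex 1 R) (Complex (1 - R) R) G2) \<le> B * R"
    using seg2[of 1 1 "1 - R"] R
    by (intro norm_I small2) (auto simp: nh in_closed_segment_Complex_same_Im closed_segment_eq_real_ivl on_box_def)
  have b6: "norm (I (Complex (1 - R) R) (Complex (1 - R) (-R)) G2) \<le> B * (2 * R)"
    using vseg2[of "-1" R "-R"] R
    by (intro norm_I small2) (auto simp: nv in_closed_segment_Complex_same_Re closed_segment_eq_real_ivl on_box_def)
  have b7: "norm (I (Complex a (-R)) (Complex 1 (-R)) G0) \<le> 6 * H * x powr (1 - Re s) / R * 1"
    using seg0[of "-1" a 1] R a
    by (intro norm_I small0) (auto simp: nh in_closed_segment_Complex_same_Im closed_segment_eq_real_ivl)
  have b8: "norm (I (Complex 1 R) (Complex a R) G0) \<le> 6 * H * x powr (1 - Re s) / R * 1"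
    using seg0[of 1 1 a] R a
    by (intro norm_I small0) (auto simp: nh in_closed_segment_Complex_same_Im closed_segment_eq_real_ivl split: if_splits)
  have b9: "norm (I (Complex a R) (Complex a (-R)) G0) \<le> 3 * H * M * x powr (a - Re s) * (2 * arsinh R)"
  proof -
    let ?K = "3 * H * M * x powr (a - Re s)"
    have cont: "continuous_on (closed_segment (Complex a (-R)) (Complex a R)) G0"
      using a by (intro continuous_on_subset[OF cont0]) (auto simp: in_closed_segment_Complex_same_Re)
    have "I (Complex a R) (Complex a (-R)) G0 = - I (Complex a (-R)) (Complex a R) G0"
      unfolding I_def using cont by (intro contour_integral_reverse_linepath) (simp add: closed_segment_commute)
    also have "I (Complex a (-R)) (Complex a R) G0 = \<i> * integral {-R..R} (\<lambda>t. G0 (Complex a t))"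
      unfolding I_def using R by (intro contour_integral_linepath_same_Re) auto
    finally have "norm (I (Complex a R) (Complex a (-R)) G0) = norm (integral {-R..R} (\<lambda>t. G0 (Complex a t)))"
      by (simp add: norm_mult)
    also have "\<dots> \<le> integral {-R..R} (\<lambda>t. ?K * (1 / sqrt (t\<^sup>2 + 1)))"
    proof (rule integral_norm_bound_integral)
      have "continuous_on {-R..R} (Complex a)" by (auto simp: Complex_eq intro!: continuous_intros)
      then show "(\<lambda>t. G0 (Complex a t)) integrable_on {-R..R}"
        using R by (intro integrable_continuous_interval continuous_on_compose2[OF cont])
          (auto simp: in_closed_segment_Complex_same_Re closed_segment_eq_real_ivl)
      show "(\<lambda>t. ?K * (1 / sqrt (t\<^sup>2 + 1))) integrable_on {-R..R}"
        by (intro integrable_continuous_interval continuous_intros) (auto simp: add_nonneg_eq_0_iff)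
    qed (use vert in auto)
    also have "((\<lambda>t. ?K * (1 / sqrt (t\<^sup>2 + 1))) has_integral ?K * (arsinh R - arsinh (-R))) {-R..R}"
      using R by (intro has_integral_mult_right fundamental_theorem_of_calculus)
        (auto intro!: derivative_eq_intros simp flip: has_real_derivative_iff_has_vector_derivative)
    then have "integral {-R..R} (\<lambda>t. ?K * (1 / sqrt (t\<^sup>2 + 1))) = ?K * (2 * arsinh R)"
      by (simp add: integral_unique)
    finally show ?thesis .
  qed
  \<comment> \<open>The quadratic factor is centred at 1 and not at s, so the kernel is not 1 at s;
    norm (s - 1) \<le> R/2 keeps it within 1/4 of 1.\<close>
  have ks: "norm (k s) \<ge> 3/4"
  proof -
    have "norm ((s - 1)\<^sup>2 / of_real (R\<^sup>2)) = (norm (s - 1))\<^sup>2 / R\<^sup>2" by (simp add: norm_divide norm_power)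
    also have "\<dots> \<le> (R / 2)\<^sup>2 / R\<^sup>2" using R by (intro divide_right_mono power_mono) auto
    also have "\<dots> = 1/4" using R by (simp add: power_divide)
    finally show ?thesis
      using norm_triangle_ineq2[of 1 "- ((s - 1)\<^sup>2 / of_real (R\<^sup>2))"] by (simp add: k_def newman_kernel_def)
  qed
  let ?total = "B * R + B * (2 * R) + B * R + B * R + B * R + B * (2 * R) + 6 * H * x powr (1 - Re s) / R * 1
      + 6 * H * x powr (1 - Re s) / R * 1 + 3 * H * M * x powr (a - Re s) * (2 * arsinh R)"
  have "norm (2 * pi * \<i> * (k s * (D s - DX x s))) \<le> ?total"
    unfolding decomp by (intro norm_triangle_mono norm_triangle_le_diff add_mono b1 b2 b3 b4 b5 b6 b7 b8 b9)
  also have "norm (2 * pi * \<i> * (k s * (D s - DX x s))) = 2 * pi * (norm (k s) * norm (D s - DX x s))"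
    by (simp add: norm_mult)
  also have "\<dots> \<ge> 2 * pi * (3/4 * norm (D s - DX x s))"
    using ks by (intro mult_left_mono mult_right_mono) auto
  finally have *: "2 * pi * (3/4 * norm (D s - DX x s)) \<le> ?total" by linarith
  \<comment> \<open>The prefactor 2 pi * 3/4 exceeds 1 and is dropped. The six sides bounded by
    \<open>B\<close> have total length 8R, whence 144 = 8 * 18.\<close>
  have "1 * norm (D s - DX x s) \<le> (2 * pi * (3/4)) * norm (D s - DX x s)"
    using pi_gt3 by (intro mult_right_mono) auto
  with * have "norm (D s - DX x s) \<le> ?total" by (simp only: mult.assoc mult_1)
  also have "?total = 8 * (B * R) + 12 * H * x powr (1 - Re s) / R + 6 * H * M * x powr (a - Re s) * arsinh R"
    by simp
  finally show ?thesis by (simp add: B_def H_def mult_ac)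
qed

section \<open>Convergence of the truncated sums and the branch of log zeta\<close>

lemma DX_tendsto:
  assumes "Re s > 1/2"
  shows "((\<lambda>x. DX x s) \<longlongrightarrow> D s) at_top"
proof -
  \<comment> \<open>The midpoint of 1/2 and min (Re s) 1: left of s, at most 1, and still in the
    region where \<open>D\<close> is bounded logarithmically.\<close>
  define a where "a = (1/2 + min (Re s) 1) / 2"
  have a: "1/2 < a" "a < Re s" "a \<le> 1" using assms by (auto simp: a_def)
  obtain C where C: "C \<ge> 0" "\<And>w. a \<le> Re w \<Longrightarrow> Re w \<le> 2 \<Longrightarrow> norm (D w) \<le> C * ln (5 + \<bar>Im w\<bar>)"
    using norm_D_le[OF a(1)] by metis
  define M where "M = (1 + \<bar>Im s\<bar>) / (Re s - a) + 1"
  \<comment> \<open>With x = R^2, both R x^(-Re s) and x^(1 - Re s)/R become R^(-\<delta>), so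
    \<delta> > 0 is exactly Re s > 1/2; x^(a - Re s) becomes R^(-\<eta>). The remaining factors are
    logarithms of R.\<close>
  define \<delta> where "\<delta> = 2 * Re s - 1"
  define \<eta> where "\<eta> = 2 * (Re s - a)"
  have pos: "\<delta> > 0" "\<eta> > 0" using assms a by (auto simp: \<delta>_def \<eta>_def)
  define f where "f = (\<lambda>R. 144 * (R powr (-\<delta>)) + 12 * C * (ln (5 + R) * R powr (-\<delta>))
      + 6 * C * M * (ln (5 + R) * R powr (-\<eta>) * ln (R + sqrt (R\<^sup>2 + 1))))"
  have le: "norm (DX (R\<^sup>2) s - D s) \<le> f R" if R: "R \<ge> 2" "R \<ge> 2 * norm (s - 1)" for R
  proof -
    have p: "(R\<^sup>2) powr e = R powr (2 * e)" for e
      using R powr_powr[of R 2 e] by (simp add: powr_numeral)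
    have "R * R powr e = R powr (1 + e)" "R powr e / R = R powr (e - 1)" for e
      using R by (simp_all add: powr_add powr_diff)
    note q = this
    have "norm (D s - DX (R\<^sup>2) s) \<le> 144 * R * (R\<^sup>2) powr (- Re s) + 12 * C * ln (5 + R) * (R\<^sup>2) powr (1 - Re s) / R
     + 6 * C * M * ln (5 + R) * (R\<^sup>2) powr (a - Re s) * arsinh R"
      using R by (intro newman_estimate[OF a _ _ C M_def refl]) auto
    also have "\<dots> = 144 * (R * R powr (2 * (- Re s))) + 12 * C * (ln (5 + R) * (R powr (2 * (1 - Re s)) / R))
     + 6 * C * M * (ln (5 + R) * R powr (2 * (a - Re s)) * arsinh R)"
      unfolding p by simp
    also have "\<dots> = f R" unfolding q f_def arsinh_real_def by (simp add: \<delta>_def \<eta>_def)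
    finally show ?thesis by (simp add: norm_minus_commute)
  qed
  have "((\<lambda>R. R powr (-\<delta>)) \<longlongrightarrow> 0) at_top" using pos by real_asymp
  moreover have "((\<lambda>R. ln (5 + R) * R powr (-\<delta>)) \<longlongrightarrow> 0) at_top" using pos by real_asymp
  moreover have "((\<lambda>R. ln (5 + R) * R powr (-\<eta>) * ln (R + sqrt (R\<^sup>2 + 1))) \<longlongrightarrow> 0) at_top"
    using pos by real_asymp
  ultimately have "(f \<longlongrightarrow> 144 * 0 + 12 * C * 0 + 6 * C * M * 0) at_top"
    unfolding f_def by (intro tendsto_intros)
  then have "(f \<longlongrightarrow> 0) at_top" by simp
  then have "((\<lambda>R. DX (R\<^sup>2) s - D s) \<longlongrightarrow> 0) at_top"
    by (rule Lim_null_comparison[rotated])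
       (use eventually_ge_at_top[of 2] eventually_ge_at_top[of "2 * norm (s - 1)"] in eventually_elim, rule le)
  then have "((\<lambda>R. DX (R\<^sup>2) s) \<longlongrightarrow> D s) at_top" by (simp add: LIM_zero_iff)
  then have "((\<lambda>x. DX ((sqrt x)\<^sup>2) s) \<longlongrightarrow> D s) at_top"
    by (rule filterlim_compose[OF _ sqrt_at_top])
  then show ?thesis
    by (rule Lim_transform_eventually) (use eventually_ge_at_top[of 0] in eventually_elim, simp)
qed

lemma truncated_prime_zeta_eq:
  assumes "s - 1 \<notin> \<real>\<^sub>\<le>\<^sub>0" "x > 1"
  shows "truncated_prime_zeta x s = DX x s + E1 (s - 1)"
proof -
  have "ln x > 0" using assms by simp
  moreover have "(\<Sum>p | prime (p::nat) \<and> real p \<le> x. 1 / of_nat p powr s) = prime_partial_sum x s"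
    unfolding prime_partial_sum_def by (intro sum.cong) (auto simp: powr_minus inverse_eq_divide)
  ultimately show ?thesis
    using E1_scaled[OF assms(1), of "ln x"] E1_eq[OF assms(1)]
    by (simp add: truncated_prime_zeta_def DX_def)
qed

lemma truncated_prime_zeta_tendsto:
  assumes "Re s > 1/2" "s - 1 \<notin> \<real>\<^sub>\<le>\<^sub>0"
  shows "((\<lambda>x. truncated_prime_zeta x s) \<longlongrightarrow> L s - Ln (s - 1) + prime_rem s) at_top"
proof -
  have "((\<lambda>x. DX x s + E1 (s - 1)) \<longlongrightarrow> D s + E1 (s - 1)) at_top"
    by (intro tendsto_intros DX_tendsto assms)
  moreover have "D s + E1 (s - 1) = L s - Ln (s - 1) + prime_rem s"
    using E1_eq[OF assms(2)] by (simp add: D_def)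
  ultimately have "((\<lambda>x. DX x s + E1 (s - 1)) \<longlongrightarrow> L s - Ln (s - 1) + prime_rem s) at_top" by simp
  then show ?thesis
    by (rule Lim_transform_eventually)
       (use eventually_gt_at_top[of 1] in eventually_elim, simp add: truncated_prime_zeta_eq assms)
qed

text \<open>Off the cut the ray to the right of s avoids the point 1, so \<open>L\<close> minus
  \<open>Ln\<close> along the ray is a continuous logarithm of zeta; from Re > 1 on it is the Euler
  product logarithm and tends to 0. Any other candidate differs from it by a constant, which both
  limits force to be 0.\<close>

lemma log_zeta_eq:
  assumes "Re s > 1/2" "s - 1 \<notin> \<real>\<^sub>\<le>\<^sub>0"
  shows "log_zeta s = L s - Ln (s - 1)"
proof -
  define l where "l = (\<lambda>u::real. L (s + of_real u) - Ln (s + of_real u - 1))"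
  have dom: "s + of_real u - 1 \<notin> \<real>\<^sub>\<le>\<^sub>0" if "u \<ge> 0" for u
    using assms that by (auto simp: complex_nonpos_Reals_iff)
  have cont: "continuous_on {0..} l"
    unfolding l_def
  proof (intro continuous_intros continuous_on_compose2[OF holomorphic_on_imp_continuous_on[OF L_hol]])
    fix u :: real assume "u \<in> {0..}"
    then show "s + complex_of_real u - 1 \<notin> \<real>\<^sub>\<le>\<^sub>0" using dom by auto
  qed (use assms in auto)
  have exp_l: "exp (l u) = zeta (s + of_real u)" if "u \<ge> 0" for u
  proof -
    have "s + of_real u \<noteq> 1" using dom[OF that] by auto
    then show ?thesis using assms that by (simp add: l_def exp_diff exp_L zeta_eq)
  qed
  obtain C where C: "C \<ge> 0" "\<And>s. Re s \<ge> 2 \<Longrightarrow> norm (prime_log s) \<le> C * 2 powr (- Re s)"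
    using norm_prime_log_le by metis
  have "((\<lambda>u. C * 2 powr (- (Re s + u))) \<longlongrightarrow> 0) at_top" by real_asymp
  then have lim: "(l \<longlongrightarrow> 0) at_top"
  proof (rule Lim_null_comparison[rotated])
    show "eventually (\<lambda>u. norm (l u) \<le> C * 2 powr (- (Re s + u))) at_top"
      using eventually_ge_at_top[of 2]
    proof eventually_elim
      case (elim u)
      then have "l u = prime_log (s + of_real u)" using assms by (simp add: l_def L_eq)
      then show ?case using C(2)[of "s + of_real u"] elim assms by simp
    qed
  qed
  show ?thesis unfolding log_zeta_def
  proof (rule the_equality)
    show "\<exists>l. continuous_on {0..} l \<and> (\<forall>u\<ge>0. exp (l u) = zeta (s + of_real u)) \<and> (l \<longlongrightarrow> 0) at_top \<and>
        l 0 = L s - Ln (s - 1)"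
      using cont exp_l lim by (intro exI[of _ l]) (auto simp: l_def)
    fix w assume "\<exists>l. continuous_on {0..} l \<and> (\<forall>u\<ge>0. exp (l u) = zeta (s + of_real u)) \<and> (l \<longlongrightarrow> 0) at_top \<and> l 0 = w"
    then obtain l' where l': "continuous_on {0..} l'" "\<And>u. u \<ge> 0 \<Longrightarrow> exp (l' u) = zeta (s + of_real u)"
      "(l' \<longlongrightarrow> 0) at_top" "l' 0 = w" by blast
    have "(\<lambda>u. l' u - l u) constant_on {0..}"
    proof (rule two_pi_int_valued_constant)
      fix u :: real assume "u \<in> {0..}"
      then have "exp (l' u) = exp (l u)" using l'(2) exp_l by simp
      then show "exp (l' u - l u) = 1" by (simp add: exp_diff)
    qed (auto intro!: continuous_intros l'(1) cont)
    then obtain c where c: "\<And>u. u \<ge> 0 \<Longrightarrow> l' u - l u = c" by (auto simp: constant_on_def)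
    have "((\<lambda>u. l' u - l u) \<longlongrightarrow> 0 - 0) at_top" by (intro tendsto_diff l' lim)
    then have "((\<lambda>_. c) \<longlongrightarrow> 0 - 0) (at_top :: real filter)"
      by (rule Lim_transform_eventually) (use eventually_ge_at_top[of 0] in eventually_elim, use c in auto)
    then have "c = 0" by (simp add: tendsto_const_iff)
    then show "w = L s - Ln (s - 1)" using c[of 0] l'(4) by (simp add: l_def)
  qed
qed

end

subsection \<open>Moebius inversion\<close>

lemma moebius_mu_prime_mult:
  assumes "prime p" "\<not> p dvd d" "d > 0"
  shows "moebius_mu (p * d) = - moebius_mu d"
proof -
  have cop: "coprime p d" using assms by (simp add: prime_imp_coprime)
  have "squarefree (p * d) \<longleftrightarrow> squarefree d"
    using squarefree_mult_coprime[OF cop] squarefree_prime[of p] assms(1) squarefree_mono[of d "p * d"] by auto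
  moreover have "card (prime_factors (p * d)) = Suc (card (prime_factors d))"
  proof -
    have "prime_factors (p * d) = insert p (prime_factors d)"
      using assms by (simp add: prime_factors_product prime_prime_factors)
    moreover have "p \<notin> prime_factors d" using assms by auto
    ultimately show ?thesis by simp
  qed
  ultimately show ?thesis by (simp add: moebius_mu_def)
qed

text \<open>For a prime p dividing m, the divisors d prime to p are paired with pd, which has the
  opposite sign. The divisors outside these two classes are divisible by p^2 and contribute
  0.\<close>

lemma sum_moebius_mu_divisors:
  assumes "m > 0"
  shows "(\<Sum>d | d dvd m. moebius_mu d) = (if m = 1 then 1 else 0)"
proof (cases "m = 1")
  case True
  then show ?thesis by (simp add: moebius_mu_def)
next
  case False
  then obtain p where p: "prime p" "p dvd m" using prime_factor_nat by blast
  define A where "A = {d. d dvd m \<and> \<not> p dvd d}"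
  have fin: "finite {d. d dvd m}" using assms by simp
  have pos: "d > 0" if "d dvd m" for d using that assms by (auto intro: dvd_pos_nat)
  have inj: "inj_on ((*) p) A" using prime_gt_0_nat[OF p(1)] by (auto simp: inj_on_def)
  have sub: "A \<subseteq> {d. d dvd m}" "(*) p ` A \<subseteq> {d. d dvd m}"
    using p by (auto simp: A_def intro!: divides_mult prime_imp_coprime)
  have disj: "A \<inter> (*) p ` A = {}" by (auto simp: A_def)
  have zero: "moebius_mu d = 0" if "d dvd m" "d \<notin> A \<union> (*) p ` A" for d
  proof -
    have "p dvd d" using that by (auto simp: A_def)
    then obtain e where e: "d = p * e" by auto
    have "e dvd m" using that(1) e by (metis dvd_mult_right)
    then have "p dvd e" using that e by (auto simp: A_def)
    then have "p\<^sup>2 dvd d" using e by (simp add: power2_eq_square)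
    then have "\<not> squarefree d" using p(1) by (auto simp: squarefree_def)
    then show ?thesis by (simp add: moebius_mu_def)
  qed
  have "(\<Sum>d | d dvd m. moebius_mu d) = (\<Sum>d\<in>A \<union> (*) p ` A. moebius_mu d)"
    using fin sub zero by (intro sum.mono_neutral_right) auto
  also have "\<dots> = (\<Sum>d\<in>A. moebius_mu d) + (\<Sum>d\<in>(*) p ` A. moebius_mu d)"
    using finite_subset[OF sub(1) fin] by (intro sum.union_disjoint disj) auto
  also have "(\<Sum>d\<in>(*) p ` A. moebius_mu d) = (\<Sum>d\<in>A. moebius_mu (p * d))"
    using inj by (simp add: sum.reindex)
  also have "\<dots> = (\<Sum>d\<in>A. - moebius_mu d)"
    using p pos by (intro sum.cong moebius_mu_prime_mult) (auto simp: A_def)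
  finally show ?thesis using False by (simp add: sum_negf)
qed

lemma abs_moebius_mu_le: "\<bar>moebius_mu n\<bar> \<le> 1"
  by (simp add: moebius_mu_def power_abs)

lemma has_sum_geometric_nat:
  fixes r :: real
  assumes "0 \<le> r" "r < 1"
  shows "((\<lambda>j. r ^ j) has_sum 1 / (1 - r)) UNIV"
  using assms by (intro norm_summable_imp_has_sum geometric_sums) (auto intro!: summable_geometric)

lemma minus_Ln_one_minus_has_sum:
  fixes z :: complex
  assumes "norm z < 1"
  shows "((\<lambda>k. z ^ k / of_nat k) has_sum (- Ln (1 - z))) {1..}"
proof -
  have "((\<lambda>k. z ^ k / of_nat k) has_sum (- Ln (1 - z))) UNIV"
  proof (rule norm_summable_imp_has_sum[OF _ minus_Ln_one_minus_sums[OF assms]])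
    show "summable (\<lambda>n. norm (z ^ n / of_nat n))"
    proof (rule summable_comparison_test)
      show "summable (\<lambda>n. norm z ^ n)" using assms by (intro summable_geometric) auto
      have "norm (z ^ n / of_nat n) \<le> norm z ^ n" for n
        by (cases "n = 0") (auto simp: norm_divide norm_power divide_le_eq mult_le_cancel_left1)
      then show "\<exists>N. \<forall>n\<ge>N. norm (norm (z ^ n / of_nat n)) \<le> norm z ^ n" by simp
    qed
  qed
  then show ?thesis
    by (rule has_sum_cong_neutral[THEN iffD1, rotated -1]) (auto simp: not_le)
qed

text \<open>Expanding the logarithms gives the double series of \<mu>(n) z^(nk) / (nk). Grouping by
  m = nk leaves z^m/m times the divisor sum of \<mu>, so only m = 1 survives.\<close>

lemma moebius_log_has_sum:
  fixes z :: complex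
  assumes "norm z < 1"
  shows "((\<lambda>n. of_int (moebius_mu n) / of_nat n * (- Ln (1 - z ^ n))) has_sum z) {1..}"
proof -
  define r where "r = norm z"
  have r: "0 \<le> r" "r < 1" using assms by (auto simp: r_def)
  define F where "F = (\<lambda>(n, k). of_int (moebius_mu n) / of_nat n * ((z ^ n) ^ k / of_nat k))"
  have "(\<lambda>x. norm (F x)) summable_on {1..} \<times> {1..}"
  proof (rule summable_on_comparison_test)
    \<comment> \<open>For n, k \<ge> 1 one has nk \<ge> (n - 1) + (k - 1), so r^(nk) is dominated by
      a product of two geometric series in the shifted indices.\<close>
    have "(\<lambda>(i, j). r ^ i * r ^ j) summable_on (UNIV \<times> UNIV)"
    proof (rule summable_on_SigmaI)
      show "((\<lambda>j. case (i, j) of (i, j) \<Rightarrow> r ^ i * r ^ j) has_sum r ^ i * (1 / (1 - r))) UNIV" for i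
        using has_sum_cmult_right[OF has_sum_geometric_nat[OF r]] by simp
      show "(\<lambda>i. r ^ i * (1 / (1 - r))) summable_on UNIV"
        using has_sum_cmult_left[OF has_sum_geometric_nat[OF r]] by (rule has_sum_imp_summable)
    qed (use r in auto)
    then have "((\<lambda>(n, k). r ^ (n - 1) * r ^ (k - 1)) \<circ> map_prod Suc Suc) summable_on (UNIV \<times> UNIV)"
      by (simp add: o_def case_prod_unfold)
    then have "(\<lambda>(n, k). r ^ (n - 1) * r ^ (k - 1)) summable_on (map_prod Suc Suc ` (UNIV \<times> UNIV))"
      by (subst summable_on_reindex) (auto simp: inj_on_def)
    moreover have "map_prod Suc Suc ` (UNIV \<times> UNIV) = {1..} \<times> {1..}"
      by (auto simp: image_iff Bex_def gr0_conv_Suc Suc_le_eq)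
    ultimately show "(\<lambda>(n, k). r ^ (n - 1) * r ^ (k - 1)) summable_on ({1..} \<times> {1..})" by simp
    fix x :: "nat \<times> nat" assume "x \<in> {1..} \<times> {1..}"
    then obtain n k where x: "x = (n, k)" "n \<ge> 1" "k \<ge> 1" by auto
    obtain i j where ij: "n = Suc i" "k = Suc j" using x by (metis Suc_le_D One_nat_def)
    have "norm (F x) = \<bar>real_of_int (moebius_mu n)\<bar> / real n * (r ^ (n * k) / real k)"
      by (simp add: x F_def norm_mult norm_divide norm_power r_def power_mult)
    also have "\<dots> \<le> 1 * (r ^ (n * k) / 1)"
    proof (intro mult_mono frac_le)
      have "\<bar>real_of_int (moebius_mu n)\<bar> \<le> 1" using abs_moebius_mu_le[of n] by linarith
      also have "\<dots> \<le> real n" using x by simp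
      finally show "\<bar>real_of_int (moebius_mu n)\<bar> / real n \<le> 1" using x by simp
    qed (use x r in auto)
    also have "\<dots> = r ^ (n * k)" by simp
    also have "\<dots> \<le> r ^ (i + j)" unfolding ij using r by (intro power_decreasing) auto
    finally show "norm (F x) \<le> (case x of (n, k) \<Rightarrow> r ^ (n - 1) * r ^ (k - 1))"
      by (simp add: x ij power_add)
  qed auto
  then have "F summable_on {1..} \<times> {1..}" by (rule abs_summable_summable)
  then obtain S where S: "(F has_sum S) ({1..} \<times> {1..})" by (auto simp: summable_on_def)
  have rows: "((\<lambda>n. of_int (moebius_mu n) / of_nat n * (- Ln (1 - z ^ n))) has_sum S) {1..}"
  proof (rule has_sum_SigmaD[OF S])
    fix n :: nat assume "n \<in> {1..}"
    then have "norm (z ^ n) < 1" using r by (simp add: norm_power r_def power_less_one_iff)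
    from has_sum_cmult_right[OF minus_Ln_one_minus_has_sum[OF this], of "of_int (moebius_mu n) / of_nat n"]
    show "((\<lambda>k. F (n, k)) has_sum of_int (moebius_mu n) / of_nat n * (- Ln (1 - z ^ n))) {1..}"
      by (simp only: F_def prod.case)
  qed
  define G where "G = (\<lambda>(m, d). of_int (moebius_mu d) * (z ^ m / of_nat m))"
  have "bij_betw (\<lambda>(n, k). (n * k, n)) ({1::nat..} \<times> {1..}) (Sigma {1..} (\<lambda>m. {d. d dvd m}))"
    by (rule bij_betwI[of _ _ _ "\<lambda>(m, d). (d, m div d)"])
       (auto simp: Suc_le_eq elim!: dvdE)
  from has_sum_reindex_bij_betw[OF this, of G S]
  have "((\<lambda>x. G ((\<lambda>(n, k). (n * k, n)) x)) has_sum S) ({1..} \<times> {1..}) \<longleftrightarrow> (G has_sum S) (Sigma {1..} (\<lambda>m. {d. d dvd m}))" .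
  moreover have "(\<lambda>x. G ((\<lambda>(n, k). (n * k, n)) x)) = F"
    by (auto simp: G_def F_def fun_eq_iff power_mult)
  ultimately have "(G has_sum S) (Sigma {1..} (\<lambda>m. {d. d dvd m}))" using S by simp
  then have "((\<lambda>m::nat. if m = 1 then z else 0) has_sum S) {1..}"
  proof (rule has_sum_SigmaD)
    fix m :: nat assume m: "m \<in> {1..}"
    have "((\<lambda>d. G (m, d)) has_sum (\<Sum>d | d dvd m. G (m, d))) {d. d dvd m}"
      using m by (intro has_sum_finite) auto
    also have "(\<Sum>d | d dvd m. G (m, d)) = of_int (\<Sum>d | d dvd m. moebius_mu d) * (z ^ m / of_nat m)"
      by (simp only: G_def prod.case of_int_sum sum_distrib_right)
    also have "\<dots> = (if m = 1 then z else 0)" using m by (subst sum_moebius_mu_divisors) auto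
    finally show "((\<lambda>d. G (m, d)) has_sum (if m = 1 then z else 0)) {d. d dvd m}" .
  qed
  moreover have "((\<lambda>_::nat. z) has_sum z) {1}" using has_sum_finite[of "{1::nat}" "\<lambda>_. z"] by simp
  then have "((\<lambda>m::nat. if m = 1 then z else 0) has_sum z) {1..}"
    by (rule has_sum_cong_neutral[THEN iffD1, rotated -1]) auto
  ultimately have "S = z" by (rule has_sum_unique)
  then show ?thesis using rows by simp
qed

lemma powr_of_nat_mult:
  assumes "p > 0"
  shows "of_nat p powr (- (of_nat n * s)) = (of_nat p powr (-s) :: complex) ^ n"
  using assms by (simp add: powr_def exp_of_nat_mult[symmetric] mult.assoc)

lemma prime_log_has_sum:
  assumes "Re s > 1"
  shows "((\<lambda>p. - Ln (1 - of_nat p powr (-s))) has_sum prime_log s) {p. prime p}"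
proof -
  have "((\<lambda>n. if prime n then - Ln (1 - of_nat n powr (-s)) else 0) has_sum prime_log s) UNIV"
    unfolding prime_log_def
    by (intro norm_summable_imp_has_sum summable_sums summable_norm_cancel[OF summable_norm_prime_log]
         summable_norm_prime_log assms)
  then show ?thesis by (rule has_sum_cong_neutral[THEN iffD1, rotated -1]) auto
qed

lemma prime_rem_has_sum:
  assumes "Re s > 1/2"
  shows "((\<lambda>p. of_nat p powr (-s) + Ln (1 - of_nat p powr (-s))) has_sum prime_rem s) {p. prime p}"
proof -
  have "((\<lambda>n. if prime n then of_nat n powr (-s) + Ln (1 - of_nat n powr (-s)) else 0) has_sum prime_rem s) UNIV"
    unfolding prime_rem_def
    by (intro norm_summable_imp_has_sum summable_sums summable_norm_cancel[OF summable_norm_prime_rem]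
         summable_norm_prime_rem assms)
  then show ?thesis by (rule has_sum_cong_neutral[THEN iffD1, rotated -1]) auto
qed

text \<open>From n = 2 on, Re (ns) > 1 and the Euler product logarithm is available, while the sum
  over primes stays absolutely convergent. Of the n factors in p^(-ns), two provide summability over
  p through p^(-2 Re s), and the rest give (3/4)^(n-2) for summability over n; this permits the
  exchange of the two sums.\<close>

lemma moebius_prime_log_has_sum:
  assumes "Re s > 1/2"
  shows "((\<lambda>n. of_int (moebius_mu n) / of_nat n * prime_log (of_nat n * s)) has_sum prime_rem s) {2..}"
proof -
  define F where "F = (\<lambda>(p, n). of_int (moebius_mu n) / of_nat n * (- Ln (1 - (of_nat p powr (-s)) ^ n)) :: complex)"
  define P where "P = {p::nat. prime p}"
  have geo: "((\<lambda>n. (3/4::real) ^ (n - 2)) has_sum 4) {2..}"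
  proof -
    have "(((\<lambda>n. (3/4::real) ^ (n - 2)) \<circ> (\<lambda>n. n + 2)) has_sum 4) UNIV"
      using has_sum_geometric_nat[of "3/4"] by (simp add: o_def)
    then have "((\<lambda>n. (3/4::real) ^ (n - 2)) has_sum 4) (range (\<lambda>n. n + 2))"
      by (subst has_sum_reindex) (auto simp: inj_on_def)
    moreover have "range (\<lambda>n. n + 2) = {2::nat..}" by (auto simp: image_iff) presburger
    ultimately show ?thesis by simp
  qed
  have "(\<lambda>x. norm (F x)) summable_on P \<times> {2..}"
  proof (rule summable_on_comparison_test)
    show "(\<lambda>(p, n). 4 * real p powr (- (2 * Re s)) * (3/4) ^ (n - 2)) summable_on (P \<times> {2..})"
    proof (rule summable_on_SigmaI)
      show "((\<lambda>n. case (p, n) of (p, n) \<Rightarrow> 4 * real p powr (- (2 * Re s)) * (3/4) ^ (n - 2)) has_sum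
          4 * real p powr (- (2 * Re s)) * 4) {2..}" for p
        using has_sum_cmult_right[OF geo, of "4 * real p powr (- (2 * Re s))"] by simp
      have "summable (\<lambda>p. norm (4 * real p powr (- (2 * Re s)) * 4))"
        using assms by (auto intro!: summable_mult summable_mult2 simp: summable_real_powr_iff)
      from norm_summable_imp_summable_on[OF this]
      show "(\<lambda>p. 4 * real p powr (- (2 * Re s)) * 4) summable_on P"
        by (rule summable_on_subset_banach) auto
    qed auto
    fix x :: "nat \<times> nat" assume "x \<in> P \<times> {2..}"
    then obtain p n where x: "x = (p, n)" "prime p" "n \<ge> 2" by (auto simp: P_def)
    define z where "z = (of_nat p powr (-s) :: complex)"
    have z: "norm z \<le> 3/4" unfolding z_def using x assms by (intro norm_prime_powr_le) auto
    have "norm z ^ n = norm z ^ 2 * norm z ^ (n - 2)" using x(3) by (metis le_add_diff_inverse power_add)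
    also have "\<dots> \<le> norm z ^ 2 * (3/4) ^ (n - 2)" using z by (intro mult_left_mono power_mono) auto
    also have "norm z ^ 2 = real p powr (- (2 * Re s))"
      using x by (simp add: z_def norm_of_nat_powr prime_gt_0_nat power2_eq_square flip: powr_add)
    finally have zn: "norm z ^ n \<le> real p powr (- (2 * Re s)) * (3/4) ^ (n - 2)" .
    have "norm z ^ n \<le> norm z ^ 1" using z x by (intro power_decreasing) auto
    then have "norm (Ln (1 - z ^ n)) \<le> 4 * norm (z ^ n)"
      using z by (intro norm_Ln_one_minus_le) (simp add: norm_power)
    moreover have "\<bar>real_of_int (moebius_mu n)\<bar> / real n \<le> 1"
    proof -
      have "\<bar>real_of_int (moebius_mu n)\<bar> \<le> 1" using abs_moebius_mu_le[of n] by linarith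
      also have "\<dots> \<le> real n" using x by simp
      finally show ?thesis using x by simp
    qed
    ultimately have "\<bar>real_of_int (moebius_mu n)\<bar> / real n * norm (Ln (1 - z ^ n)) \<le> 1 * (4 * norm (z ^ n))"
      by (intro mult_mono) auto
    moreover have "norm (F x) = \<bar>real_of_int (moebius_mu n)\<bar> / real n * norm (Ln (1 - z ^ n))"
      by (simp add: F_def x z_def norm_mult norm_divide)
    ultimately show "norm (F x) \<le> (case x of (p, n) \<Rightarrow> 4 * real p powr (- (2 * Re s)) * (3/4) ^ (n - 2))"
      using zn by (simp add: x norm_power)
  qed auto
  then have "F summable_on P \<times> {2..}" by (rule abs_summable_summable)
  then obtain S where S: "(F has_sum S) (P \<times> {2..})" by (auto simp: summable_on_def)
  have "((\<lambda>p. of_nat p powr (-s) + Ln (1 - of_nat p powr (-s))) has_sum S) P"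
  proof (rule has_sum_SigmaD[OF S])
    fix p assume p: "p \<in> P"
    define z where "z = (of_nat p powr (-s) :: complex)"
    have z: "norm z < 1" unfolding z_def using norm_prime_powr_le[of p s] p assms by (simp add: P_def)
    \<comment> \<open>Removing the n = 1 term -Ln(1 - z) from the sum z leaves z + Ln(1 - z), the
      summand of \<open>prime_rem\<close>.\<close>
    have "((\<lambda>n. of_int (moebius_mu n) / of_nat n * (- Ln (1 - z ^ n))) has_sum
        (z - (\<Sum>n\<in>{1}. of_int (moebius_mu n) / of_nat n * (- Ln (1 - z ^ n))))) ({1..} - {1})"
      by (intro has_sum_Diff moebius_log_has_sum z has_sum_finite) auto
    moreover have "{1..} - {1} = {2::nat..}" by auto
    ultimately show "((\<lambda>n. F (p, n)) has_sum of_nat p powr (-s) + Ln (1 - of_nat p powr (-s))) {2..}"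
      by (simp add: F_def z_def moebius_mu_def)
  qed
  then have "S = prime_rem s"
    using prime_rem_has_sum[OF assms] unfolding P_def by (rule has_sum_unique)
  have "((\<lambda>(n, p). F (p, n)) has_sum S) ({2..} \<times> P)" using S by (subst (asm) has_sum_swap)
  then have "((\<lambda>n. of_int (moebius_mu n) / of_nat n * prime_log (of_nat n * s)) has_sum S) {2..}"
  proof (rule has_sum_SigmaD)
    fix n :: nat assume "n \<in> {2..}"
    then have "2 * (1/2) < real n * Re s" using assms by (intro mult_le_less_imp_less) auto
    then have "Re (of_nat n * s) > 1" by simp
    from has_sum_cmult_right[OF prime_log_has_sum[OF this], of "of_int (moebius_mu n) / of_nat n"]
    show "((\<lambda>p. case (n, p) of (n, p) \<Rightarrow> F (p, n)) has_sum
        of_int (moebius_mu n) / of_nat n * prime_log (of_nat n * s)) P"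
      unfolding P_def
      by (rule has_sum_cong[THEN iffD1, rotated])
         (simp add: F_def powr_of_nat_mult prime_gt_0_nat del: mult_minus_left)
  qed
  with \<open>S = prime_rem s\<close> show ?thesis by simp
qed

section \<open>The Moebius series of the prime zeta function for Re s > 1/2\<close>

context log_zeta_E1
begin

text \<open>For Re s \<le> 1 only the term n = 1 of the Moebius series leaves the half-plane of the
  Euler product; it contributes the continued logarithm of zeta, and the other terms add up to
  \<open>prime_rem\<close>.\<close>

lemma prime_zeta_eq_log_zeta:
  assumes "Re s > 1/2" "s - 1 \<notin> \<real>\<^sub>\<le>\<^sub>0"
  shows "prime_zeta s = L s - Ln (s - 1) + prime_rem s"
proof (cases "Re s > 1")
  case True
  then show ?thesis by (simp add: prime_zeta_eq_prime_log L_eq)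
next
  case False
  define g where "g = (\<lambda>n. of_int (moebius_mu n) / of_nat n * log_zeta (of_nat n * s))"
  have "(g has_sum prime_rem s) {2..}"
  proof (rule has_sum_cong[THEN iffD1, OF _ moebius_prime_log_has_sum[OF assms(1)]])
    fix n :: nat assume "n \<in> {2..}"
    then have "2 * (1/2) < real n * Re s" using assms by (intro mult_le_less_imp_less) auto
    then have n: "Re (of_nat n * s) > 1" by simp
    then have "log_zeta (of_nat n * s) = prime_log (of_nat n * s)"
      by (subst log_zeta_eq[OF _ Ln_minus_1_domain[OF n]]) (auto simp: L_eq)
    then show "of_int (moebius_mu n) / of_nat n * prime_log (of_nat n * s) = g n" by (simp add: g_def)
  qed
  then have "(g has_sum (g 1 + prime_rem s)) ({1} \<union> {2..})"
    using has_sum_finite[of "{1}" g] by (intro has_sum_Un_disjoint) auto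
  moreover have "{1} \<union> {2..} = range Suc" by (auto simp: image_iff) presburger
  ultimately have "((g \<circ> Suc) has_sum (g 1 + prime_rem s)) UNIV" by (simp add: has_sum_reindex)
  then have "(\<Sum>n. g (Suc n)) = g 1 + prime_rem s"
    by (simp add: sums_unique[OF has_sum_imp_sums, symmetric] o_def)
  moreover have "g 1 = L s - Ln (s - 1)" using log_zeta_eq[OF assms] by (simp add: g_def moebius_mu_def)
  ultimately show ?thesis using False by (simp add: prime_zeta_def g_def del: of_nat_Suc)
qed

end

text \<open>Applied to z = s - 1, this trades \<open>Ln (s - 1)\<close>, discontinuous on the cut,
  for \<open>Ln (1 - s)\<close>, holomorphic across it left of 1, and a constant that depends on the
  side.\<close>

lemma Ln_eq_Ln_minus:
  assumes "Im z \<noteq> 0"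
  shows "Ln z = Ln (-z) + (if Im z > 0 then \<i> * pi else - (\<i> * pi))"
proof -
  have "z \<noteq> 0" using assms by auto
  then show ?thesis using Ln_minus[of z] assms by auto
qed

section \<open>The limit function as a holomorphic part minus \<open>Ln (s - 1)\<close>\<close>

theorem theorem1:
  assumes "riemann_hypothesis"
  shows "(\<forall>s\<in>{s. Re s > 1/2} - of_real ` {1/2<..1}.
            ((\<lambda>x. truncated_prime_zeta x s) \<longlongrightarrow> prime_zeta s) at_top) \<and>
         analytic_with_branch_cut (\<lambda>s. Lim at_top (\<lambda>x. truncated_prime_zeta x s))
           {s. Re s > 1/2} (1/2) 1"
proof -
  obtain L where L: "L holomorphic_on {s. Re s > 1/2}" "\<And>s. Re s > 1/2 \<Longrightarrow> exp (L s) = reg_zeta s"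
    "\<And>s. Re s > 1 \<Longrightarrow> L s = prime_log s + Ln (s - 1)"
    using reg_zeta_log_exists[OF assms] by metis
  obtain E where E: "E holomorphic_on UNIV"
    "\<And>z. z \<noteq> 0 \<Longrightarrow> (E has_field_derivative (1 - exp (-z)) / z) (at z)"
    "\<And>z. z \<notin> \<real>\<^sub>\<le>\<^sub>0 \<Longrightarrow> E1 z = E z - Ln z"
    using E1_eq_entire_minus_Ln by metis
  interpret log_zeta_E1 E L by unfold_locales (use L E in auto)
  define T where "T = {s. Re s > 1/2} - complex_of_real ` {1/2<..1}"
  have T: "s \<in> T \<longleftrightarrow> Re s > 1/2 \<and> s - 1 \<notin> \<real>\<^sub>\<le>\<^sub>0" for s
  proof -
    have "s \<in> complex_of_real ` {1/2<..1} \<longleftrightarrow> Im s = 0 \<and> 1/2 < Re s \<and> Re s \<le> 1"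
    proof
      assume "Im s = 0 \<and> 1/2 < Re s \<and> Re s \<le> 1"
      then show "s \<in> complex_of_real ` {1/2<..1}"
        by (intro image_eqI[of _ _ "Re s"]) (auto simp: complex_eq_iff)
    qed auto
    then show ?thesis by (auto simp: T_def complex_nonpos_Reals_iff)
  qed
  define H where "H = (\<lambda>s. L s + prime_rem s)"
  define F where "F = (\<lambda>s. Lim at_top (\<lambda>x. truncated_prime_zeta x s))"
  have H_hol: "H holomorphic_on {s. Re s > 1/2}"
    unfolding H_def by (intro holomorphic_intros L holomorphic_prime_rem)
  have lim: "((\<lambda>x. truncated_prime_zeta x s) \<longlongrightarrow> H s - Ln (s - 1)) at_top" if "s \<in> T" for s
    using truncated_prime_zeta_tendsto[of s] that by (simp add: T H_def algebra_simps)
  have F: "F s = H s - Ln (s - 1)" if "s \<in> T" for s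
    unfolding F_def using lim[OF that] by (intro tendsto_Lim) auto
  have "((\<lambda>x. truncated_prime_zeta x s) \<longlongrightarrow> prime_zeta s) at_top" if "s \<in> T" for s
  proof -
    have "prime_zeta s = H s - Ln (s - 1)" using prime_zeta_eq_log_zeta[of s] that by (simp add: T H_def)
    then show ?thesis using lim[OF that] by simp
  qed
  moreover have "F analytic_on T"
  proof -
    have "T = {s. Re s > 1/2} \<inter> (\<lambda>s. s - 1) -` (- \<real>\<^sub>\<le>\<^sub>0)" using T by auto
    moreover have "open ((\<lambda>s. s - 1) -` (- \<real>\<^sub>\<le>\<^sub>0 :: complex set))"
      by (intro open_vimage continuous_intros) (simp add: open_Compl)
    ultimately have "open T" by (simp only: open_Int open_halfspace_Re_gt)
    have "(\<lambda>s. H s - Ln (s - 1)) holomorphic_on T"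
      using T by (intro holomorphic_intros holomorphic_on_subset[OF H_hol]) auto
    then have "F holomorphic_on T" by (rule holomorphic_transform) (simp add: F)
    then show ?thesis using \<open>open T\<close> by (simp add: analytic_on_open)
  qed
  moreover have "jumps_across F (of_real c)" if c: "c \<in> {1/2<..<1}" for c
  proof -
    \<comment> \<open>The ball stays in the strip 1/2 < Re z < 1, where \<open>H\<close> is
      holomorphic and 1 - z has positive real part.\<close>
    define r where "r = min (c - 1/2) (1 - c)"
    have "r > 0" using c by (simp add: r_def)
    have ball: "1/2 < Re z \<and> Re z < 1" if "z \<in> ball (complex_of_real c) r" for z
      using that abs_Re_le_cmod[of "of_real c - z"] by (auto simp: dist_norm r_def)
    have ln_dom: "1 - z \<notin> \<real>\<^sub>\<le>\<^sub>0" if "z \<in> ball (complex_of_real c) r" for z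
      using ball[OF that] by (simp add: complex_nonpos_Reals_iff)
    \<comment> \<open>The continuation from above is e = 1 and that from below is e = -1; they
      differ by the constant 2 pi i.\<close>
    define h where "h = (\<lambda>e z. H z - (Ln (1 - z) + e * (\<i> * pi)))"
    have hol: "h e holomorphic_on ball (of_real c) r" for e
      unfolding h_def
      by (intro holomorphic_intros holomorphic_on_subset[OF H_hol]) (use ball ln_dom in blast)+
    have F_h: "F z = h (if Im z > 0 then 1 else -1) z" if "z \<in> ball (of_real c) r" "Im z \<noteq> 0" for z
    proof -
      have "z \<in> T" using that ball[OF that(1)] by (simp add: T complex_nonpos_Reals_iff)
      then show ?thesis using F[of z] Ln_eq_Ln_minus[of "z - 1"] that(2) by (simp add: h_def)
    qed
    show ?thesis unfolding jumps_across_def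
    proof (rule exI[of _ r], rule conjI[OF \<open>r > 0\<close>], rule exI[of _ "h 1"], rule exI[of _ "h (-1)"],
        intro conjI ballI impI hol)
      fix z assume "z \<in> ball (of_real c) r" "Im z > Im (of_real c)"
      then show "F z = h 1 z" using F_h[of z] by simp
    next
      fix z assume "z \<in> ball (of_real c) r" "Im z < Im (of_real c)"
      then show "F z = h (-1) z" using F_h[of z] by simp
    next
      show "h 1 (of_real c) \<noteq> h (-1) (of_real c)" by (auto simp: h_def complex_eq_iff)
    qed
  qed
  moreover have "\<not> (\<exists>l. (F \<longlongrightarrow> l) (at (of_real 1) within T))"
  proof
    assume "\<exists>l. (F \<longlongrightarrow> l) (at (of_real 1) within T)"
    then obtain l where l: "(F \<longlongrightarrow> l) (at 1 within T)" by auto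
    \<comment> \<open>Along 1 + exp(-n), to the right of the branch point and off the cut,
      \<open>Ln (z n - 1)\<close> is exactly -n, so \<open>F\<close> exceeds a convergent sequence
      by n.\<close>
    define z where "z = (\<lambda>n::nat. 1 + complex_of_real (exp (- real n)))"
    have zT: "z n \<in> T" for n by (auto simp: T z_def complex_nonpos_Reals_iff add_pos_pos)
    have "(\<lambda>n. exp (- real n)) \<longlonglongrightarrow> 0" by real_asymp
    then have "z \<longlonglongrightarrow> 1 + of_real 0" unfolding z_def by (intro tendsto_intros)
    then have z1: "z \<longlonglongrightarrow> 1" by simp
    have "filterlim z (at 1 within T) sequentially"
      unfolding filterlim_at using z1 zT by (auto simp: z_def intro!: always_eventually)
    with l have "(\<lambda>n. F (z n)) \<longlonglongrightarrow> l" by (rule filterlim_compose)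
    moreover have "isCont H 1"
      using holomorphic_on_imp_continuous_on[OF H_hol]
      by (rule continuous_on_interior) (simp only: interior_open[OF open_halfspace_Re_gt], simp)
    then have "(\<lambda>n. H (z n)) \<longlonglongrightarrow> H 1" using z1 by (rule isCont_tendsto_compose)
    ultimately have "(\<lambda>n. H (z n) - F (z n)) \<longlonglongrightarrow> H 1 - l" by (intro tendsto_diff)
    moreover have "H (z n) - F (z n) = of_real (- real n)" for n
      using F[OF zT] by (simp add: z_def Ln_of_real)
    ultimately have "(\<lambda>n. complex_of_real (- real n)) \<longlonglongrightarrow> H 1 - l" by simp
    from tendsto_Re[OF this] have "(\<lambda>n. - real n) \<longlonglongrightarrow> Re (H 1 - l)" by simp
    from tendsto_minus[OF this] have "(\<lambda>n. real n) \<longlonglongrightarrow> - Re (H 1 - l)" by simp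
    with filterlim_at_top_imp_at_infinity[OF filterlim_real_sequentially] show False
      using not_tendsto_and_filterlim_at_infinity trivial_limit_sequentially by blast
  qed
  ultimately show ?thesis
    unfolding analytic_with_branch_cut_def F_def T_def by blast
qed

end
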